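(* (i) For every $x\in\mathbb{R}^d$, the reachable set in law at time $T$ of the system $$dX(t)=\left(A_1X(t)+A_2\mathbb{E}[X(t)]+B_2\mathbb{E}[u(t)]\right)dt+\left(C\,\mathbb{E}[X(t)]+D_2\mathbb{E}[u(t)]\right)dW(t),\quad X(0)=x,$$ consists of normal distributions: $$\mathcal{R}each^{\mathbb{P}}_T(x):=\left\{\mathbb{P}_{X^{x,u}(T)}:\ u\in\mathbb{L}^2_{\mathbb{F}}(\Omega\times[0,T];\mathbb{R}^n)\right\}\subset\mathcal{G}auss:=\left\{\mathcal{N}(\alpha,\Sigma):\ \alpha\in\mathbb{R}^d,\ \Sigma\in\mathcal{S}^d_+\right\}.$$ (ii) For $d=1$, the scalar system $$dx(t)=\left[a_1x(t)+a_2\mathbb{E}[x(t)]+b\,\mathbb{E}[u(t)]\right]dt+\delta\,\mathbb{E}[u(t)]\,dW(t),\quad x(0)=x_0\in\mathbb{R},$$ with $a_1,a_2,b,\delta\in\mathbb{R}$, is exactly terminal controllable to normal laws if and only if $\delta\neq0$.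
   Context: Let $T>0$ be fixed, $W$ a scalar standard Brownian motion on a probability space $(\Omega,\mathcal{F},\mathbb{P})$, and $\mathbb{F}=\{\mathcal{F}_t\}_{t\ge0}$ the augmented Brownian filtration enriched with an initial $\sigma$-field $\mathcal{F}_0$, independent of $W$ and large enough to support all laws in the 2-Wasserstein space $\mathcal{P}_2(\mathbb{R}^d)$. Let $d,n\ge1$ be integers, $A_1,A_2,C\in\mathbb{R}^{d\times d}$ and $B_2,D_2\in\mathbb{R}^{d\times n}$ constant matrices. $\mathbb{L}^2_{\mathbb{F}}(\Omega\times[0,T];\mathbb{R}^n)$ is the space of square-integrable $\mathbb{F}$-progressively measurable $\mathbb{R}^n$-valued processes (for the scalar system in (ii), controls are real-valued). $\mathbb{P}_\xi$ denotes the law of a random variable $\xi$, and $X^{x,u}$ is the solution with deterministic initial value $x$ and control $u$. $\mathcal{S}^d_+$ is the set of positive semidefinite symmetric $d\times d$ matrices (so degenerate Gaussian laws, including Dirac masses, belong to $\mathcal{G}auss$). A system is called exactly terminal controllable to normal laws (ETCNL) if $\bigcup_{x\in\mathbb{R}^d}\mathcal{R}each^{\mathbb{P}}_T(x)=\mathcal{G}auss$, where $\mathcal{R}each^{\mathbb{P}}_T(x)$ is the set of laws $\mathbb{P}_{X^{x,u}(T)}$ over all controls $u\in\mathbb{L}^2_{\mathbb{F}}(\Omega\times[0,T];\mathbb{R}^n)$ (with $n=1$ for the scalar system in (ii)). *)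

theory Defs
  imports "HOL-Probability.Probability"
begin

section \<open>Brownian motion and the augmented filtration\<close>

definition generated_algebra ::
  "'w measure \<Rightarrow> (real \<Rightarrow> 'w \<Rightarrow> 'a::topological_space) \<Rightarrow> real set \<Rightarrow> 'w measure" where
  "generated_algebra M W I =
     sigma (space M) (\<Union>r\<in>I. sets (vimage_algebra (space M) (W r) borel))"

definition brownian_motion :: "'w measure \<Rightarrow> (real \<Rightarrow> 'w \<Rightarrow> real) \<Rightarrow> bool" where
  "brownian_motion M W \<longleftrightarrow>
     prob_space M \<and>
     (\<forall>t\<ge>0. W t \<in> borel_measurable M) \<and>
     (AE \<omega> in M. W 0 \<omega> = 0) \<and>
     (\<forall>s t. 0 \<le> s \<longrightarrow> s < t \<longrightarrow>
        distributed M lborel (\<lambda>\<omega>. W t \<omega> - W s \<omega>) (normal_density 0 (sqrt (t - s))) \<and>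
        prob_space.indep_set M
          (sets (generated_algebra M W {0..s}))
          (sets (vimage_algebra (space M) (\<lambda>\<omega>. W t \<omega> - W s \<omega>) borel))) \<and>
     (AE \<omega> in M. continuous_on {0..} (\<lambda>t. W t \<omega>))"

definition wasserstein2_space :: "('a::euclidean_space) measure set" where
  "wasserstein2_space =
     {\<mu>. prob_space \<mu> \<and> sets \<mu> = sets borel \<and> integrable \<mu> (\<lambda>x. (norm x)\<^sup>2)}"

definition supports_laws :: "'w measure \<Rightarrow> 'w measure \<Rightarrow> 'a::euclidean_space measure set \<Rightarrow> bool" where
  "supports_laws M G P \<longleftrightarrow> (\<forall>\<mu>\<in>P. \<exists>\<xi>\<in>borel_measurable G. distr M borel \<xi> = \<mu>)"

definition initial_algebra :: "'w measure \<Rightarrow> (real \<Rightarrow> 'w \<Rightarrow> real) \<Rightarrow> 'w measure \<Rightarrow> bool" where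
  "initial_algebra M W G \<longleftrightarrow>
     subalgebra M G \<and> prob_space.indep_set M (sets G) (sets (generated_algebra M W {0..}))"

text \<open>If \<open>M\<close> is complete, \<open>null_sets M\<close> consists of all subsets of events of
  probability zero, so this is the usual augmentation.\<close>

definition augmented_filtration ::
  "'w measure \<Rightarrow> (real \<Rightarrow> 'w \<Rightarrow> real) \<Rightarrow> 'w measure \<Rightarrow> real \<Rightarrow> 'w measure" where
  "augmented_filtration M W G t =
     sigma (space M) (sets G \<union> sets (generated_algebra M W {0..t}) \<union> null_sets M)"


section \<open>Square-integrable processes and the Ito integral\<close>

definition progressive :: "(real \<Rightarrow> 'w measure) \<Rightarrow> real \<Rightarrow> (real \<Rightarrow> 'w \<Rightarrow> 'a::euclidean_space) \<Rightarrow> bool" where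
  "progressive F T u \<longleftrightarrow>
     (\<forall>t\<in>{0..T}. (\<lambda>(s, \<omega>). u s \<omega>) \<in> borel_measurable (restrict_space borel {0..t} \<Otimes>\<^sub>M F t))"

definition L2_processes ::
  "'w measure \<Rightarrow> (real \<Rightarrow> 'w measure) \<Rightarrow> real \<Rightarrow> (real \<Rightarrow> 'w \<Rightarrow> 'a::euclidean_space) set" where
  "L2_processes M F T =
     {u. progressive F T u \<and>
         integrable (restrict_space lborel {0..T} \<Otimes>\<^sub>M M) (\<lambda>(s, \<omega>). (norm (u s \<omega>))\<^sup>2)}"

text \<open>A simple process is given by \<open>(N, p, \<xi>)\<close> and takes the value \<open>\<xi> i\<close> on the
  interval \<open>{p i<..p (Suc i)}\<close> for \<open>i < N\<close>.\<close>

definition is_simple ::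
  "'w measure \<Rightarrow> (real \<Rightarrow> 'w measure) \<Rightarrow> real \<Rightarrow> nat \<Rightarrow> (nat \<Rightarrow> real) \<Rightarrow>
   (nat \<Rightarrow> 'w \<Rightarrow> 'a::euclidean_space) \<Rightarrow> bool" where
  "is_simple M F T N p \<xi> \<longleftrightarrow>
     0 \<le> p 0 \<and> p N \<le> T \<and> (\<forall>i<N. p i \<le> p (Suc i)) \<and>
     (\<forall>i<N. \<xi> i \<in> borel_measurable (F (p i)) \<and> bounded (\<xi> i ` space M))"

definition simple_process ::
  "nat \<Rightarrow> (nat \<Rightarrow> real) \<Rightarrow> (nat \<Rightarrow> 'w \<Rightarrow> 'a::euclidean_space) \<Rightarrow> real \<Rightarrow> 'w \<Rightarrow> 'a" where
  "simple_process N p \<xi> s \<omega> = (\<Sum>i<N. indicator {p i<..p (Suc i)} s *\<^sub>R \<xi> i \<omega>)"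

definition simple_integral ::
  "(real \<Rightarrow> 'w \<Rightarrow> real) \<Rightarrow> nat \<Rightarrow> (nat \<Rightarrow> real) \<Rightarrow> (nat \<Rightarrow> 'w \<Rightarrow> 'a::euclidean_space) \<Rightarrow> 'w \<Rightarrow> 'a" where
  "simple_integral W N p \<xi> \<omega> = (\<Sum>i<N. (W (p (Suc i)) \<omega> - W (p i) \<omega>) *\<^sub>R \<xi> i \<omega>)"

text \<open>\<open>is_ito_integral M F W t H Y\<close> says that \<open>Y\<close> is a version of the Ito integral of \<open>H\<close>
  against \<open>W\<close> over \<open>[0, t]\<close>, that is, the mean-square limit of the integrals of simple
  processes that approximate \<open>H\<close> in mean square. By the Ito isometry \<open>Y\<close> is
  determined up to a null set.\<close>

definition is_ito_integral ::
  "'w measure \<Rightarrow> (real \<Rightarrow> 'w measure) \<Rightarrow> (real \<Rightarrow> 'w \<Rightarrow> real) \<Rightarrow> real \<Rightarrow>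
   (real \<Rightarrow> 'w \<Rightarrow> 'a::euclidean_space) \<Rightarrow> ('w \<Rightarrow> 'a) \<Rightarrow> bool" where
  "is_ito_integral M F W t H Y \<longleftrightarrow>
     H \<in> L2_processes M F t \<and> Y \<in> borel_measurable M \<and>
     (\<exists>N p \<xi>.
        (\<forall>k. is_simple M F t (N k) (p k) (\<xi> k)) \<and>
        (\<lambda>k. \<integral>\<^sup>+(s, \<omega>). ennreal ((norm (H s \<omega> - simple_process (N k) (p k) (\<xi> k) s \<omega>))\<^sup>2)
              \<partial>(restrict_space lborel {0..t} \<Otimes>\<^sub>M M)) \<longlonglongrightarrow> 0 \<and>
        (\<lambda>k. \<integral>\<^sup>+\<omega>. ennreal ((norm (Y \<omega> - simple_integral W (N k) (p k) (\<xi> k) \<omega>))\<^sup>2) \<partial>M) \<longlonglongrightarrow> 0)"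


section \<open>Controlled mean-field equations and their reachable laws\<close>

text \<open>The equation is
  \<open>dX(t) = b (X(t)) (E[X(t)]) (E[u(t)]) dt + \<sigma> (X(t)) (E[X(t)]) (E[u(t)]) dW(t)\<close>
  with \<open>X(0) = x\<close>, on the horizon \<open>[0, T]\<close>.\<close>

definition is_solution ::
  "'w measure \<Rightarrow> (real \<Rightarrow> 'w measure) \<Rightarrow> (real \<Rightarrow> 'w \<Rightarrow> real) \<Rightarrow> real \<Rightarrow>
   ('a \<Rightarrow> 'a \<Rightarrow> 'u \<Rightarrow> 'a) \<Rightarrow> ('a \<Rightarrow> 'a \<Rightarrow> 'u \<Rightarrow> 'a) \<Rightarrow> 'a::euclidean_space \<Rightarrow>
   (real \<Rightarrow> 'w \<Rightarrow> 'u::euclidean_space) \<Rightarrow> (real \<Rightarrow> 'w \<Rightarrow> 'a) \<Rightarrow> bool" where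
  "is_solution M F W T b \<sigma> x u X \<longleftrightarrow>
     X \<in> L2_processes M F T \<and>
     (AE \<omega> in M. continuous_on {0..T} (\<lambda>t. X t \<omega>)) \<and>
     (\<forall>t\<in>{0..T}. \<exists>Y.
        is_ito_integral M F W t
          (\<lambda>s \<omega>. \<sigma> (X s \<omega>) (integral\<^sup>L M (X s)) (integral\<^sup>L M (u s))) Y \<and>
        (AE \<omega> in M.
           set_integrable lborel {0..t}
             (\<lambda>s. b (X s \<omega>) (integral\<^sup>L M (X s)) (integral\<^sup>L M (u s))) \<and>
           X t \<omega> = x
             + (LINT s:{0..t}|lborel. b (X s \<omega>) (integral\<^sup>L M (X s)) (integral\<^sup>L M (u s)))
             + Y \<omega>))"

definition reachable_laws ::
  "'w measure \<Rightarrow> (real \<Rightarrow> 'w measure) \<Rightarrow> (real \<Rightarrow> 'w \<Rightarrow> real) \<Rightarrow> real \<Rightarrow>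
   ('a \<Rightarrow> 'a \<Rightarrow> 'u \<Rightarrow> 'a) \<Rightarrow> ('a \<Rightarrow> 'a \<Rightarrow> 'u::euclidean_space \<Rightarrow> 'a) \<Rightarrow> 'a::euclidean_space \<Rightarrow>
   'a measure set" where
  "reachable_laws M F W T b \<sigma> x =
     {distr M borel (X T) | u X. u \<in> L2_processes M F T \<and> is_solution M F W T b \<sigma> x u X}"

text \<open>The covariance is a linear operator, so that one definition covers \<open>real ^ 'd\<close>
  (where it is a matrix) and \<open>real\<close> (where it is a number). The law \<open>N(\<alpha>, S)\<close>
  is given by its characteristic function, which allows degenerate \<open>S\<close>. The lemmas below
  give the concrete forms.\<close>

definition covariance_operator :: "('a::euclidean_space \<Rightarrow> 'a) \<Rightarrow> bool" where
  "covariance_operator S \<longleftrightarrow>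
     linear S \<and> (\<forall>v w. v \<bullet> S w = S v \<bullet> w) \<and> (\<forall>v. 0 \<le> v \<bullet> S v)"

definition normal_law :: "'a::euclidean_space \<Rightarrow> ('a \<Rightarrow> 'a) \<Rightarrow> 'a measure \<Rightarrow> bool" where
  "normal_law \<alpha> S \<mu> \<longleftrightarrow>
     prob_space \<mu> \<and> sets \<mu> = sets borel \<and>
     (\<forall>v. (CLINT x|\<mu>. iexp (v \<bullet> x)) = exp (\<i> * of_real (v \<bullet> \<alpha>) - of_real (v \<bullet> S v) / 2))"

definition Gauss :: "('a::euclidean_space) measure set" where
  "Gauss = {\<mu>. \<exists>\<alpha> S. covariance_operator S \<and> normal_law \<alpha> S \<mu>}"

definition ETCNL ::
  "'w measure \<Rightarrow> (real \<Rightarrow> 'w measure) \<Rightarrow> (real \<Rightarrow> 'w \<Rightarrow> real) \<Rightarrow> real \<Rightarrow>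
   ('a \<Rightarrow> 'a \<Rightarrow> 'u \<Rightarrow> 'a) \<Rightarrow> ('a::euclidean_space \<Rightarrow> 'a \<Rightarrow> 'u::euclidean_space \<Rightarrow> 'a) \<Rightarrow> bool" where
  "ETCNL M F W T b \<sigma> \<longleftrightarrow> (\<Union>x. reachable_laws M F W T b \<sigma> x) = Gauss"

lemma Gauss_vec:
  "(Gauss :: (real ^ 'd) measure set) =
     {\<mu>. \<exists>\<alpha> \<Sigma>. transpose \<Sigma> = \<Sigma> \<and> (\<forall>v. 0 \<le> v \<bullet> (\<Sigma> *v v)) \<and> normal_law \<alpha> ((*v) \<Sigma>) \<mu>}"
proof -
  have sym: "(\<forall>v w. v \<bullet> (\<Sigma> *v w) = (\<Sigma> *v v) \<bullet> w) \<longleftrightarrow> transpose \<Sigma> = \<Sigma>"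
    for \<Sigma> :: "real ^ 'd ^ 'd"
  proof
    assume *: "\<forall>v w. v \<bullet> (\<Sigma> *v w) = (\<Sigma> *v v) \<bullet> w"
    have "transpose \<Sigma> *v v = \<Sigma> *v v" for v
    proof (rule vector_eq_ldot[THEN iffD1], rule allI)
      fix w
      have "w \<bullet> (transpose \<Sigma> *v v) = (\<Sigma> *v w) \<bullet> v"
        by (metis dot_lmul_matrix inner_commute transpose_matrix_vector)
      then show "w \<bullet> (transpose \<Sigma> *v v) = w \<bullet> (\<Sigma> *v v)"
        using * by simp
    qed
    then show "transpose \<Sigma> = \<Sigma>" by (simp add: matrix_eq)
  next
    assume "transpose \<Sigma> = \<Sigma>"
    then show "\<forall>v w. v \<bullet> (\<Sigma> *v w) = (\<Sigma> *v v) \<bullet> w"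
      by (metis dot_lmul_matrix transpose_matrix_vector)
  qed
  have op: "covariance_operator ((*v) \<Sigma>) \<longleftrightarrow> transpose \<Sigma> = \<Sigma> \<and> (\<forall>v. 0 \<le> v \<bullet> (\<Sigma> *v v))"
    for \<Sigma> :: "real ^ 'd ^ 'd"
    unfolding covariance_operator_def sym by (simp add: matrix_vector_mul_linear)
  have mat: "\<exists>\<Sigma> :: real ^ 'd ^ 'd. S = (*v) \<Sigma>" if "covariance_operator S" for S
  proof -
    have "S = (*v) (matrix S)"
      using that by (auto simp: covariance_operator_def linear_linear intro!: ext matrix_works[symmetric])
    then show ?thesis ..
  qed
  show ?thesis
  proof (intro equalityI subsetI)
    fix \<mu> :: "(real ^ 'd) measure" assume "\<mu> \<in> Gauss"
    then obtain \<alpha> S where S: "covariance_operator S" "normal_law \<alpha> S \<mu>"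
      unfolding Gauss_def by blast
    with mat obtain \<Sigma> where "S = (*v) \<Sigma>" by blast
    with S op[of \<Sigma>] show
      "\<mu> \<in> {\<mu>. \<exists>\<alpha> \<Sigma>. transpose \<Sigma> = \<Sigma> \<and> (\<forall>v. 0 \<le> v \<bullet> (\<Sigma> *v v)) \<and> normal_law \<alpha> ((*v) \<Sigma>) \<mu>}"
      by blast
  next
    fix \<mu> :: "(real ^ 'd) measure"
    assume "\<mu> \<in> {\<mu>. \<exists>\<alpha> \<Sigma>. transpose \<Sigma> = \<Sigma> \<and> (\<forall>v. 0 \<le> v \<bullet> (\<Sigma> *v v)) \<and> normal_law \<alpha> ((*v) \<Sigma>) \<mu>}"
    then obtain \<alpha> \<Sigma> where "covariance_operator ((*v) \<Sigma>)" "normal_law \<alpha> ((*v) \<Sigma>) \<mu>"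
      unfolding op by blast
    then show "\<mu> \<in> Gauss" unfolding Gauss_def by blast
  qed
qed

lemma normal_law_density:
  assumes "0 < s"
  shows "normal_law \<alpha> ((*) (s\<^sup>2)) (density lborel (normal_density \<alpha> s))"
proof -
  let ?N = "std_normal_distribution"
  interpret N: prob_space ?N by (rule prob_space_normal_density) simp
  have "distributed ?N lborel (\<lambda>x. x) std_normal_density"
    by (auto simp: distributed_def intro!: distr_id[unfolded id_def] distr_id2)
  from N.normal_density_affine[OF this, of s \<alpha>] assms
  have "distributed ?N lborel (\<lambda>x. \<alpha> + s * x) (normal_density \<alpha> s)" by simp
  then have *: "density lborel (normal_density \<alpha> s) = distr ?N borel (\<lambda>x. \<alpha> + s * x)"
    by (metis distributed_distr_eq_density distr_cong sets_lborel)
  have "(CLINT x|density lborel (normal_density \<alpha> s). iexp (v \<bullet> x))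
      = exp (\<i> * of_real (v \<bullet> \<alpha>) - of_real (v \<bullet> (s\<^sup>2 * v)) / 2)" for v
  proof -
    have "(CLINT x|density lborel (normal_density \<alpha> s). iexp (v \<bullet> x))
        = (CLINT x|?N. iexp (v * \<alpha>) * iexp (v * s * x))"
      unfolding * by (subst integral_distr) (auto simp: algebra_simps exp_add[symmetric])
    also have "\<dots> = iexp (v * \<alpha>) * char ?N (v * s)"
      unfolding char_def by (rule integral_mult_right_zero)
    also have "\<dots> = exp (\<i> * of_real (v \<bullet> \<alpha>) - of_real (v \<bullet> (s\<^sup>2 * v)) / 2)"
      unfolding char_std_normal_distribution exp_of_real[symmetric] exp_add[symmetric]
      by (simp add: power2_eq_square algebra_simps)
    finally show ?thesis .
  qed
  then show ?thesis
    using assms by (auto simp: normal_law_def intro: prob_space_normal_density)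
qed

lemma normal_law_return:
  fixes \<alpha> :: real
  shows "normal_law \<alpha> ((*) 0) (return borel \<alpha>)"
  by (auto simp: normal_law_def prob_space_return integral_return)

lemma normal_law_unique:
  fixes \<mu> \<nu> :: "real measure"
  assumes "normal_law \<alpha> S \<mu>" "normal_law \<alpha> S \<nu>"
  shows "\<mu> = \<nu>"
proof (rule Levy_uniqueness)
  show "real_distribution \<mu>" "real_distribution \<nu>"
    using assms by (auto simp: normal_law_def real_distribution_def real_distribution_axioms_def)
  show "char \<mu> = char \<nu>"
    using assms by (auto simp: normal_law_def char_def fun_eq_iff)
qed

lemma Gauss_real:
  "Gauss = range (return borel) \<union> {density lborel (normal_density \<alpha> s) | \<alpha> s. 0 < s}"
  (is "_ = ?R")
proof
  have op: "covariance_operator ((*) c)" if "0 \<le> c" for c :: real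
    using that by (auto simp: covariance_operator_def linear_times mult.left_commute[of _ c])
  have "return borel \<alpha> \<in> Gauss" for \<alpha> :: real
    unfolding Gauss_def using op[of 0] normal_law_return[of \<alpha>] by blast
  moreover have "density lborel (normal_density \<alpha> s) \<in> Gauss" if "0 < s" for \<alpha> s
    unfolding Gauss_def using op[of "s\<^sup>2"] normal_law_density[OF that, of \<alpha>] by fastforce
  ultimately show "?R \<subseteq> Gauss" by auto
  show "Gauss \<subseteq> ?R"
  proof
    fix \<mu> :: "real measure" assume "\<mu> \<in> Gauss"
    then obtain \<alpha> S where S: "covariance_operator S" and \<mu>: "normal_law \<alpha> S \<mu>"
      by (auto simp: Gauss_def)
    define c where "c = S 1"
    have lin: "linear S" using S by (simp add: covariance_operator_def)
    have "S = (*) c"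
    proof
      fix r
      have "S (r *\<^sub>R 1) = r *\<^sub>R S 1" by (rule linear_scale[OF lin])
      then show "S r = c * r" unfolding c_def by (metis mult.commute mult.right_neutral real_scaleR_def)
    qed
    moreover have "0 \<le> c"
    proof -
      have "0 \<le> 1 \<bullet> S 1" using S unfolding covariance_operator_def by blast
      then show ?thesis by (simp add: c_def)
    qed
    ultimately show "\<mu> \<in> ?R"
    proof (cases "c = 0")
      case True
      then show ?thesis
        using normal_law_unique \<mu> normal_law_return \<open>S = (*) c\<close> by blast
    next
      case False
      with \<open>0 \<le> c\<close> have c: "0 < sqrt c" "(sqrt c)\<^sup>2 = c" by auto
      from normal_law_density[OF c(1), of \<alpha>] have "\<mu> = density lborel (normal_density \<alpha> (sqrt c))"
        unfolding c(2) \<open>S = (*) c\<close>[symmetric] by (rule normal_law_unique[OF \<mu>])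
      with c(1) show ?thesis by blast
    qed
  qed
qed

end

theory Submission
  imports Defs
begin

text \<open>
  The diffusion coefficient depends on expectations only, so it is a deterministic function of time.
  By the Ito isometry its stochastic integrals \<open>Y t\<close> are mean-square limits of linear
  combinations of values of \<open>W\<close>, hence lie in the Gaussian space spanned by \<open>W\<close>. If \<open>q\<close> is a
  centred square-integrable variable orthogonal to that space, then \<open>f t = E (q X t)\<close> solves
  \<open>f t = \<integral>\<^sub>0\<^sup>t A (f s) ds\<close>, so \<open>f = 0\<close> by Gronwall's inequality. Consequently the centred
  \<open>X T\<close> lies in the Gaussian space as well, without solving the equation explicitly. When
  the diffusion vanishes the same argument applied to \<open>q = X T - E (X T)\<close> shows that \<open>X T\<close> is
  constant. In the scalar case with \<open>\<delta> \<noteq> 0\<close>, a control with mean proportional to \<open>exp (a\<^sub>1 * t)\<close> gives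
  \<open>x(t) = m(t) + \<kappa> * exp (a\<^sub>1 * t) * W t\<close>, where the variance at \<open>T\<close> is set by \<open>\<kappa>\<close> and
  the mean by the initial value.\<close>

section \<open>Square-integrable functions\<close>

text \<open>Two features of the definitions shape the proof. The simple processes in
  \<open>is_ito_integral\<close> may be random even when the integrand is deterministic, so a limit
  of their integrals is not visibly Gaussian: the coefficients have to be replaced by their means,
  and the isometry shows that this costs no more than the original approximation error. Moreover
  orthogonality to the Gaussian space is only available up to an error \<epsilon>, so each bound has
  to be linear in \<epsilon> with a constant independent of the test variable \<open>q\<close>.
  Crude constants are harmless for this purpose, and factors 2 and 4 stand where an exact isometry
  would give 1.

  The regularity in time of the mean-field terms comes from the notion of solution: square
  integrability of the diffusion is read off the Ito integral at \<open>T\<close>, and integrability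
  of the drift off the equation itself.

  Characteristic functions treat degenerate and nondegenerate covariances alike. In the scalar case
  an Ito integral has to be exhibited with explicit approximants; integration by parts turns the
  approximation error into an ordinary time integral of Brownian increments.\<close>

definition square_integrable :: "'b measure \<Rightarrow> ('b \<Rightarrow> 'a::euclidean_space) \<Rightarrow> bool" where
  "square_integrable M f \<longleftrightarrow> f \<in> borel_measurable M \<and> integrable M (\<lambda>x. (norm (f x))\<^sup>2)"

lemma square_integrable_norm_sq:
  "square_integrable M f \<Longrightarrow> integrable M (\<lambda>x. (norm (f x))\<^sup>2)"
  by (simp add: square_integrable_def)

lemma square_integrable_real_sq:
  fixes f :: "'b \<Rightarrow> real"
  shows "square_integrable M f \<Longrightarrow> integrable M (\<lambda>x. (f x)\<^sup>2)"
  by (simp add: square_integrable_def)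

text \<open>Second moments are compared without passing to L2 norms, so this inequality plays the
  part of the triangle inequality. Most factors 2 and 4 in later bounds come from it.\<close>

lemma norm_add_sq_le: "(norm (x + y))\<^sup>2 \<le> 2 * (norm x)\<^sup>2 + 2 * (norm (y::'a::real_normed_vector))\<^sup>2"
proof -
  have "(norm (x + y))\<^sup>2 \<le> (norm x + norm y)\<^sup>2"
    by (intro power_mono norm_triangle_ineq) simp
  also have "\<dots> \<le> 2 * (norm x)\<^sup>2 + 2 * (norm y)\<^sup>2"
    using sum_squares_bound[of "norm x" "norm y"] by (simp add: power2_sum)
  finally show ?thesis .
qed

lemma square_integrable_bound:
  assumes "integrable M g" "f \<in> borel_measurable M" "\<And>x. (norm (f x))\<^sup>2 \<le> g x"
  shows "square_integrable M f"
  unfolding square_integrable_def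
proof
  show "integrable M (\<lambda>x. (norm (f x))\<^sup>2)"
    by (rule Bochner_Integration.integrable_bound[OF assms(1)])
      (use assms in \<open>auto intro!: AE_I2 order_trans[OF assms(3) abs_ge_self]\<close>)
qed fact

lemma square_integrable_add:
  assumes "square_integrable M f" "square_integrable M g"
  shows "square_integrable M (\<lambda>x. f x + g x)"
  using assms
  by (intro square_integrable_bound[where g="\<lambda>x. 2 * (norm (f x))\<^sup>2 + 2 * (norm (g x))\<^sup>2"])
    (auto simp: square_integrable_def norm_add_sq_le)

lemma square_integrable_linear:
  assumes "bounded_linear L" "square_integrable M f"
  shows "square_integrable M (\<lambda>x. L (f x))"
proof (rule square_integrable_bound)
  interpret bounded_linear L by fact
  show "(\<lambda>x. L (f x)) \<in> borel_measurable M"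
    using assms by (intro borel_measurable_continuous_on[OF continuous_on] )
      (auto simp: square_integrable_def continuous_on_id)
  show "(norm (L (f x)))\<^sup>2 \<le> (onorm L)\<^sup>2 * (norm (f x))\<^sup>2" for x
    unfolding power_mult_distrib[symmetric]
    by (intro power_mono onorm assms) simp
qed (use assms in \<open>auto simp: square_integrable_def\<close>)

lemma square_integrable_scaleR:
  "square_integrable M f \<Longrightarrow> square_integrable M (\<lambda>x. c *\<^sub>R f x)"
  by (rule square_integrable_linear[OF bounded_linear_scaleR_right])

lemma square_integrable_inner:
  "square_integrable M f \<Longrightarrow> square_integrable M (\<lambda>x. v \<bullet> f x)"
  by (rule square_integrable_linear[OF bounded_linear_inner_right])

lemma square_integrable_diff:
  assumes "square_integrable M f" "square_integrable M g"
  shows "square_integrable M (\<lambda>x. f x - g x)"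
  using square_integrable_add[OF assms(1) square_integrable_scaleR[OF assms(2), of "-1"]] by simp

lemma square_integrable_mult:
  fixes f :: "'b \<Rightarrow> real"
  shows "square_integrable M f \<Longrightarrow> square_integrable M (\<lambda>x. c * f x)"
  using square_integrable_scaleR[of M f c] by simp

lemma square_integrable_sum:
  "(\<And>i. i \<in> I \<Longrightarrow> square_integrable M (f i)) \<Longrightarrow> square_integrable M (\<lambda>x. \<Sum>i\<in>I. f i x)"
proof (induction I rule: infinite_finite_induct)
  case (insert i I)
  then show ?case by (simp add: square_integrable_add)
qed (auto simp: square_integrable_def)

lemma (in finite_measure) square_integrable_const: "square_integrable M (\<lambda>x. c)"
  by (auto simp: square_integrable_def)

lemma (in finite_measure) square_integrable_integrable:
  assumes "square_integrable M f"
  shows "integrable M f"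
proof (rule Bochner_Integration.integrable_bound)
  show "integrable M (\<lambda>x. 1 + (norm (f x))\<^sup>2)"
    using assms by (auto simp: square_integrable_def)
  have "norm (f x) \<le> 1 + (norm (f x))\<^sup>2" for x
    using sum_squares_bound[of 1 "norm (f x)"] by (simp, smt (verit) norm_ge_zero)
  then show "AE x in M. norm (f x) \<le> norm (1 + (norm (f x))\<^sup>2)" by simp
qed (use assms in \<open>auto simp: square_integrable_def\<close>)

section \<open>Products of square-integrable functions and the Cauchy-Schwarz inequality\<close>

lemma mult_le_sum_sq: "a * b \<le> a\<^sup>2 + (b::real)\<^sup>2"
  using sum_squares_bound[of a b] zero_le_power2[of a] zero_le_power2[of b] by linarith

lemma square_integrable_scaleR_product:
  fixes q :: "'b \<Rightarrow> real"
  assumes "square_integrable M q" "square_integrable M f"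
  shows "integrable M (\<lambda>x. q x *\<^sub>R f x)"
proof (rule Bochner_Integration.integrable_bound)
  show "integrable M (\<lambda>x. (norm (q x))\<^sup>2 + (norm (f x))\<^sup>2)"
    using assms by (auto simp: square_integrable_def)
  show "AE x in M. norm (q x *\<^sub>R f x) \<le> norm ((norm (q x))\<^sup>2 + (norm (f x))\<^sup>2)"
    using mult_le_sum_sq[of "\<bar>q x\<bar>" "norm (f x)" for x] by simp
qed (use assms in \<open>auto simp: square_integrable_def\<close>)

lemma square_integrable_inner_product:
  assumes "square_integrable M g" "square_integrable M f"
  shows "integrable M (\<lambda>x. g x \<bullet> f x)"
proof (rule Bochner_Integration.integrable_bound)
  show "integrable M (\<lambda>x. (norm (g x))\<^sup>2 + (norm (f x))\<^sup>2)"
    using assms by (auto simp: square_integrable_def)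
  show "AE x in M. norm (g x \<bullet> f x) \<le> norm ((norm (g x))\<^sup>2 + (norm (f x))\<^sup>2)"
    using order_trans[OF Cauchy_Schwarz_ineq2 mult_le_sum_sq, of "g x" "f x" for x] by simp
qed (use assms in \<open>auto simp: square_integrable_def\<close>)

lemma square_integrable_product:
  fixes f g :: "'b \<Rightarrow> real"
  assumes "square_integrable M g" "square_integrable M f"
  shows "integrable M (\<lambda>x. g x * f x)"
  using square_integrable_inner_product[OF assms] by simp

text \<open>The quadratic \<open>\<eta> - 2 * r * p + r\<^sup>2 * w\<close> is nonnegative for all
  real \<open>r\<close>, so its discriminant cannot be positive. It gives Cauchy-Schwarz below, and
  later the near orthogonality of a residual of almost minimal norm.\<close>

lemma discriminant_bound:
  fixes p \<eta> w :: real
  assumes w: "0 \<le> w" and le: "\<And>r. 2 * r * p - r\<^sup>2 * w \<le> \<eta>"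
  shows "p\<^sup>2 \<le> \<eta> * w"
proof (cases "w = 0")
  case True
  have "p = 0"
  proof (rule ccontr)
    assume "p \<noteq> 0"
    \<comment> \<open>With \<open>w = 0\<close> the left-hand side is linear in \<open>r\<close>,
      and this \<open>r\<close> raises it to \<open>\<eta> + 1\<close>.\<close>
    then have "2 * ((\<eta> + 1) / (2 * p)) * p = \<eta> + 1" by simp
    then show False using le[of "(\<eta> + 1) / (2 * p)"] True by simp
  qed
  then show ?thesis using True by simp
next
  case False
  \<comment> \<open>The choice \<open>r = p / w\<close> maximises the left-hand side of
    \<open>le\<close>.\<close>
  then have "p\<^sup>2 / w \<le> \<eta>"
    using le[of "p / w"] by (simp add: power2_eq_square field_simps)
  then show ?thesis using False w by (simp add: field_simps)
qed

lemma integral_sq_diff_scaled: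
  fixes f g :: "'b \<Rightarrow> real"
  assumes "square_integrable M f" "square_integrable M g"
  shows "(\<integral>x. (f x - r * g x)\<^sup>2 \<partial>M)
    = (\<integral>x. (f x)\<^sup>2 \<partial>M) - 2 * r * (\<integral>x. f x * g x \<partial>M) + r\<^sup>2 * (\<integral>x. (g x)\<^sup>2 \<partial>M)"
proof -
  have "(\<integral>x. (f x - r * g x)\<^sup>2 \<partial>M) = (\<integral>x. (f x)\<^sup>2 - 2 * r * (f x * g x) + r\<^sup>2 * (g x)\<^sup>2 \<partial>M)"
    by (simp add: power2_eq_square algebra_simps)
  then show ?thesis
    using assms[THEN square_integrable_real_sq] square_integrable_product[OF assms] by simp
qed

lemma integral_Cauchy_Schwarz:
  fixes f g :: "'b \<Rightarrow> real"
  assumes "square_integrable M f" "square_integrable M g"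
  shows "(\<integral>x. f x * g x \<partial>M)\<^sup>2 \<le> (\<integral>x. (f x)\<^sup>2 \<partial>M) * (\<integral>x. (g x)\<^sup>2 \<partial>M)"
proof (rule discriminant_bound)
  fix r
  have "0 \<le> (\<integral>x. (f x - r * g x)\<^sup>2 \<partial>M)" by simp
  then show "2 * r * (\<integral>x. f x * g x \<partial>M) - r\<^sup>2 * (\<integral>x. (g x)\<^sup>2 \<partial>M) \<le> (\<integral>x. (f x)\<^sup>2 \<partial>M)"
    unfolding integral_sq_diff_scaled[OF assms] by linarith
qed simp

lemma abs_integral_mult_le:
  fixes f g :: "'b \<Rightarrow> real"
  assumes "square_integrable M f" "square_integrable M g"
  shows "\<bar>\<integral>x. f x * g x \<partial>M\<bar> \<le> sqrt (\<integral>x. (f x)\<^sup>2 \<partial>M) * sqrt (\<integral>x. (g x)\<^sup>2 \<partial>M)"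
  using integral_Cauchy_Schwarz[OF assms]
  by (metis real_sqrt_abs real_sqrt_le_mono real_sqrt_mult)

text \<open>With the weight \<open>exp (- 2 * K * t)\<close> in the supremum norm, \<open>K\<close> times the integral operator is
  a contraction with constant \<open>1/2\<close>, so no continuity of \<open>f\<close> is needed.\<close>

lemma gronwall:
  fixes f :: "real \<Rightarrow> real"
  assumes K: "0 < K" and \<epsilon>: "0 \<le> \<epsilon>" and t: "t \<in> {0..T}"
    and f0: "\<And>t. t \<in> {0..T} \<Longrightarrow> 0 \<le> f t"
    and int: "set_integrable lborel {0..T} f"
    and le: "\<And>t. t \<in> {0..T} \<Longrightarrow> f t \<le> \<epsilon> + K * (LINT s:{0..t}|lborel. f s)"
  shows "f t \<le> 2 * \<epsilon> * exp (2 * K * t)"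
proof -
  have int': "set_integrable lborel {0..t} f" if "t \<in> {0..T}" for t
    by (rule set_integrable_subset[OF int]) (use that in auto)
  define g where "g t = exp (- 2 * K * t) * f t" for t
  \<comment> \<open>The supremum \<open>B\<close> below is meaningful only for a bounded function.
    Boundedness comes from the inequality \<open>le\<close> itself, because the integral over
    \<open>{0..t}\<close> is at most the integral over \<open>{0..T}\<close>.\<close>
  have bdd: "bdd_above (g ` {0..T})"
  proof (rule bdd_aboveI2)
    fix t assume t: "t \<in> {0..T}"
    have "(LINT s:{0..t}|lborel. f s) \<le> (LINT s:{0..T}|lborel. f s)"
      unfolding set_lebesgue_integral_def
      by (intro integral_mono int[unfolded set_integrable_def] int'[OF t, unfolded set_integrable_def])
        (use t f0 in \<open>auto simp: indicator_def\<close>)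
    with le[OF t] K have *: "f t \<le> \<epsilon> + K * (LINT s:{0..T}|lborel. f s)"
      by (smt (verit) mult_left_mono)
    have "g t \<le> 1 * f t"
      unfolding g_def using K t f0[OF t] by (intro mult_right_mono) auto
    with * show "g t \<le> \<epsilon> + K * (LINT s:{0..T}|lborel. f s)" by simp
  qed
  define B where "B = (SUP t\<in>{0..T}. g t)"
  have gB: "g t \<le> B" if "t \<in> {0..T}" for t
    unfolding B_def by (rule cSUP_upper[OF that bdd])
  have fB: "f t \<le> B * exp (2 * K * t)" if "t \<in> {0..T}" for t
    using gB[OF that] unfolding g_def by (simp add: exp_minus field_simps)
  have "0 \<le> g t" using f0[OF t] by (simp add: g_def)
  with gB[OF t] have B0: "0 \<le> B" by linarith
  have "g t \<le> \<epsilon> + B / 2" if t: "t \<in> {0..T}" for t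
  proof -
    have "((\<lambda>s. B * exp (2 * K * s)) has_integral B * exp (2 * K * t) / (2 * K) - B * exp (2 * K * 0) / (2 * K)) {0..t}"
      by (rule fundamental_theorem_of_calculus)
        (use t K in \<open>auto intro!: derivative_eq_intros simp: has_real_derivative_iff_has_vector_derivative[symmetric]\<close>)
    then have H: "((\<lambda>s. B * exp (2 * K * s)) has_integral B * exp (2 * K * t) / (2 * K) - B / (2 * K)) {0..t}"
      by simp
    have E: "set_integrable lborel {0..t} (\<lambda>s. B * exp (2 * K * s))"
      by (rule borel_integrable_atLeastAtMost') (auto intro!: continuous_intros)
    have E': "(LINT s:{0..t}|lborel. B * exp (2 * K * s)) = B * exp (2 * K * t) / (2 * K) - B / (2 * K)"
      by (rule trans[OF set_borel_integral_eq_integral(2)[OF E] integral_unique[OF H]])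
    have "(LINT s:{0..t}|lborel. f s) \<le> (LINT s:{0..t}|lborel. B * exp (2 * K * s))"
      by (rule set_integral_mono[OF int'[OF t] E]) (use fB t in auto)
    also have "\<dots> \<le> B * exp (2 * K * t) / (2 * K)"
      unfolding E' using B0 K by simp
    finally have "K * (LINT s:{0..t}|lborel. f s) \<le> B * exp (2 * K * t) / 2"
      using K by (simp add: field_simps)
    with le[OF t] have "f t \<le> \<epsilon> + B * exp (2 * K * t) / 2" by linarith
    then have "g t \<le> exp (- 2 * K * t) * (\<epsilon> + B * exp (2 * K * t) / 2)"
      unfolding g_def by (rule mult_left_mono) simp
    also have "\<dots> = exp (- 2 * K * t) * \<epsilon> + B / 2"
      by (simp add: exp_minus field_simps)
    also have "exp (- 2 * K * t) * \<epsilon> \<le> 1 * \<epsilon>"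
      using K t \<epsilon> by (intro mult_right_mono) auto
    finally show ?thesis by simp
  qed
  then have "B \<le> \<epsilon> + B / 2"
    unfolding B_def by (intro cSUP_least) (use t in auto)
  then have "B \<le> 2 * \<epsilon>" by simp
  then show ?thesis using fB[OF t] by (smt (verit) exp_gt_zero mult_right_mono)
qed

section \<open>Brownian increments\<close>

lemma sets_vimage_algebra_borel:
  "sets (vimage_algebra X f borel) = {f -` A \<inter> X | A. A \<in> sets borel}"
  by (rule sets_vimage_algebra2) simp

locale brownian_setup = prob_space M for M :: "'w measure" +
  fixes W :: "real \<Rightarrow> 'w \<Rightarrow> real" and G :: "'w measure"
  assumes brownian: "brownian_motion M W" and initial: "initial_algebra M W G"
begin

abbreviation F where "F \<equiv> augmented_filtration M W G"

lemma W_measurable [measurable]: "0 \<le> t \<Longrightarrow> W t \<in> borel_measurable M"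
  using brownian by (simp add: brownian_motion_def)

lemma W_0: "AE \<omega> in M. W 0 \<omega> = 0"
  using brownian by (simp add: brownian_motion_def)

lemma space_generated_algebra [simp]: "space (generated_algebra M W I) = space M"
  unfolding generated_algebra_def by (rule space_measure_of) (auto simp: sets_vimage_algebra_borel)

lemma sets_generated_algebra:
  "sets (generated_algebra M W I) =
     sigma_sets (space M) (\<Union>r\<in>I. sets (vimage_algebra (space M) (W r) borel))"
  unfolding generated_algebra_def by (rule sets_measure_of) (auto simp: sets_vimage_algebra_borel)

lemma sets_generated_algebra_le:
  assumes "I \<subseteq> {0..}"
  shows "sets (generated_algebra M W I) \<subseteq> sets M"
  unfolding sets_generated_algebra
proof (rule sets.sigma_sets_subset, safe)
  fix r A assume r: "r \<in> I" and A: "A \<in> sets (vimage_algebra (space M) (W r) borel)"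
  then obtain B where "A = W r -` B \<inter> space M" "B \<in> sets borel"
    by (auto simp: sets_vimage_algebra_borel)
  then show "A \<in> sets M" using assms r by (auto intro!: measurable_sets[OF W_measurable])
qed

lemma sets_generated_algebra_mono:
  "I \<subseteq> J \<Longrightarrow> sets (generated_algebra M W I) \<subseteq> sets (generated_algebra M W J)"
  unfolding sets_generated_algebra by (rule sigma_sets_mono') blast

lemma sets_G: "sets G \<subseteq> sets M" and space_G: "space G = space M"
  using initial by (auto simp: initial_algebra_def subalgebra_def)

lemma augmented_generator_le:
  "sets G \<union> sets (generated_algebra M W {0..t}) \<union> null_sets M \<subseteq> sets M"
  using sets_G sets_generated_algebra_le[of "{0..t}"] by auto

lemma space_F [simp]: "space (F t) = space M"
  unfolding augmented_filtration_def
  by (rule space_measure_of) (use augmented_generator_le[of t] sets.sets_into_space in blast)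

lemma sets_F: "sets (F t) =
    sigma_sets (space M) (sets G \<union> sets (generated_algebra M W {0..t}) \<union> null_sets M)"
  unfolding augmented_filtration_def
  by (rule sets_measure_of) (use augmented_generator_le[of t] sets.sets_into_space in blast)

lemma sets_F_le: "sets (F t) \<subseteq> sets M"
  unfolding sets_F by (rule sets.sigma_sets_subset[OF augmented_generator_le])

lemma sets_F_mono: "s \<le> t \<Longrightarrow> sets (F s) \<subseteq> sets (F t)"
  unfolding sets_F using sets_generated_algebra_mono[of "{0..s}" "{0..t}"]
  by (intro sigma_sets_mono') auto

lemma null_sets_F: "N \<in> null_sets M \<Longrightarrow> N \<in> sets (F t)"
  unfolding sets_F by auto

lemma measurable_F_mono:
  "f \<in> measurable (F s) N \<Longrightarrow> s \<le> t \<Longrightarrow> f \<in> measurable (F t) N"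
  using sets_F_mono[of s t] by (auto simp: measurable_def)

lemma measurable_F_imp_M: "f \<in> measurable (F s) N \<Longrightarrow> f \<in> measurable M N"
  using sets_F_le[of s] by (auto simp: measurable_def)

lemma W_measurable_F:
  assumes "0 \<le> s" "s \<le> t"
  shows "W s \<in> borel_measurable (F t)"
proof (rule measurableI)
  fix A :: "real set" assume "A \<in> sets borel"
  then have "W s -` A \<inter> space M \<in> sets (generated_algebra M W {0..t})"
    unfolding sets_generated_algebra
    by (intro sigma_sets.Basic UN_I[of s]) (use assms in \<open>auto simp: sets_vimage_algebra_borel\<close>)
  then show "W s -` A \<inter> space (F t) \<in> sets (F t)"
    by (auto simp: sets_F)
qed simp

section \<open>Laws, independence and moments of increments\<close>

lemma increment_distributed:
  assumes "0 \<le> s" "s < t"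
  shows "distributed M lborel (\<lambda>\<omega>. W t \<omega> - W s \<omega>) (normal_density 0 (sqrt (t - s)))"
  using brownian assms by (simp add: brownian_motion_def)

lemma generated_sets_increment:
  assumes "0 \<le> s" "s < t" "A \<in> sets borel"
  shows "(\<lambda>\<omega>. W t \<omega> - W s \<omega>) -` A \<inter> space M \<in> sets (generated_algebra M W {0..})"
proof -
  have W: "W r \<in> borel_measurable (generated_algebra M W {0..})" if "0 \<le> r" for r
  proof (rule measurableI)
    fix A :: "real set" assume "A \<in> sets borel"
    then show "W r -` A \<inter> space (generated_algebra M W {0..}) \<in> sets (generated_algebra M W {0..})"
      unfolding sets_generated_algebra
      by (simp, intro sigma_sets.Basic UN_I[of r]) (use that in \<open>auto simp: sets_vimage_algebra_borel\<close>)
  qed simp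
  have "(\<lambda>\<omega>. W t \<omega> - W s \<omega>) \<in> borel_measurable (generated_algebra M W {0..})"
    using assms by (intro borel_measurable_diff W) auto
  from measurable_sets[OF this assms(3)] show ?thesis by simp
qed

text \<open>Brownian motion is only known to have increments independent of its own past. The
  initial field is independent of the whole path, which adds a third factor to the product formula,
  and null sets satisfy the formula trivially. A generator stable under intersection then carries
  the independence to the augmented field.\<close>

lemma indep_increment:
  assumes st: "0 \<le> s" "s < t"
  shows "indep_set (sets (F s)) (sets (vimage_algebra (space M) (\<lambda>\<omega>. W t \<omega> - W s \<omega>) borel))"
proof -
  define D where "D = sets (vimage_algebra (space M) (\<lambda>\<omega>. W t \<omega> - W s \<omega>) borel)"
  define B where "B = sets (generated_algebra M W {0..s})"
  \<comment> \<open>Null sets join as separate members: intersecting one with any event gives a null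
    set again, so \<open>P\<close> stays stable under intersection.\<close>
  define P where "P = {g \<inter> b | g b. g \<in> sets G \<and> b \<in> B} \<union> null_sets M"
  have indBD: "indep_set B D"
    using brownian st unfolding B_def D_def brownian_motion_def by blast
  have indG: "indep_set (sets G) (sets (generated_algebra M W {0..}))"
    using initial by (simp add: initial_algebra_def)
  have Dgen: "D \<subseteq> sets (generated_algebra M W {0..})"
    using generated_sets_increment[OF st] unfolding D_def sets_vimage_algebra_borel by blast
  have Bgen: "B \<subseteq> sets (generated_algebra M W {0..})"
    unfolding B_def by (rule sets_generated_algebra_mono) auto
  have BM: "B \<subseteq> sets M" unfolding B_def by (rule sets_generated_algebra_le) auto
  have DM: "D \<subseteq> sets M" using indBD by (simp add: indep_sets2_eq)
  have PM: "P \<subseteq> sets M" unfolding P_def using sets_G BM by auto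
  have "indep_set P D"
    unfolding indep_sets2_eq
  proof (intro conjI ballI PM DM)
    fix a d assume a: "a \<in> P" and d: "d \<in> D"
    show "prob (a \<inter> d) = prob a * prob d"
    proof (cases "a \<in> null_sets M")
      case True
      then have "a \<inter> d \<in> null_sets M" using DM d null_set_Int1[of a M d] by (auto simp: Int_commute)
      with True show ?thesis by (simp add: measure_eq_0_null_sets)
    next
      case False
      with a obtain g b where gb: "g \<in> sets G" "b \<in> B" "a = g \<inter> b" by (auto simp: P_def)
      \<comment> \<open>Both \<open>b\<close> and \<open>d\<close> are events of the full Brownian
        path, so \<open>g\<close> can be split off first, and then \<open>b\<close> from
        \<open>d\<close>.\<close>
      have bd: "b \<inter> d \<in> sets (generated_algebra M W {0..})"
        using Bgen Dgen gb d by auto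
      have "prob (a \<inter> d) = prob g * prob (b \<inter> d)"
        using indep_setD[OF indG gb(1) bd] gb by (simp add: Int_assoc)
      also have "\<dots> = prob g * prob b * prob d"
        using indep_setD[OF indBD gb(2) d] by simp
      also have "prob g * prob b = prob a"
        using indep_setD[OF indG gb(1)] Bgen gb by auto
      finally show ?thesis .
    qed
  qed
  moreover have "Int_stable P"
    unfolding Int_stable_def
  proof (intro ballI)
    fix a b assume ab: "a \<in> P" "b \<in> P"
    show "a \<inter> b \<in> P"
    proof (cases "a \<in> null_sets M \<or> b \<in> null_sets M")
      case True
      then have "a \<inter> b \<in> null_sets M"
        using ab PM null_set_Int1[of a M b] null_set_Int2[of b M a] by (auto simp: Int_commute)
      then show ?thesis by (simp add: P_def)
    next
      case False
      then obtain g1 b1 g2 b2 where *: "g1 \<in> sets G" "b1 \<in> B" "a = g1 \<inter> b1"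
        "g2 \<in> sets G" "b2 \<in> B" "b = g2 \<inter> b2"
        using ab by (auto simp: P_def)
      then have "a \<inter> b = (g1 \<inter> g2) \<inter> (b1 \<inter> b2)" "g1 \<inter> g2 \<in> sets G" "b1 \<inter> b2 \<in> B"
        by (auto simp: B_def)
      then show ?thesis unfolding P_def by blast
    qed
  qed
  moreover have "Int_stable D"
    unfolding D_def Int_stable_def by auto
  ultimately have "indep_set (sigma_sets (space M) P) (sigma_sets (space M) D)"
    by (rule indep_set_sigma_sets)
  moreover have "sigma_sets (space M) D = D"
    unfolding D_def by (metis sets.sigma_sets_eq space_vimage_algebra)
  moreover have "sets (F s) \<subseteq> sigma_sets (space M) P"
    unfolding sets_F
  proof (rule sigma_sets_mono', safe)
    fix x assume "x \<in> sets G"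
    moreover have "space M \<in> B" unfolding B_def by (metis space_generated_algebra sets.top)
    ultimately show "x \<in> P"
      unfolding P_def using sets.sets_into_space[of x G] space_G by (intro UnI1 CollectI exI[of _ x] exI[of _ "space M"]) auto
  next
    fix x assume x: "x \<in> sets (generated_algebra M W {0..s})"
    moreover have "space M \<in> sets G" by (metis space_G sets.top)
    ultimately show "x \<in> P"
      unfolding P_def using sets.sets_into_space[OF x] by (intro UnI1 CollectI exI[of _ x] exI[of _ "space M"]) (auto simp: B_def)
  qed (simp add: P_def)
  ultimately show ?thesis
    unfolding D_def[symmetric] indep_sets2_eq by auto
qed

lemma indep_var_increment:
  assumes st: "0 \<le> s" "s < t" and f: "f \<in> borel_measurable (F s)"
  shows "indep_var borel f borel (\<lambda>\<omega>. W t \<omega> - W s \<omega>)"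
proof -
  let ?D = "\<lambda>\<omega>. W t \<omega> - W s \<omega>"
  have fM: "f \<in> borel_measurable M" by (rule measurable_F_imp_M[OF f])
  have DM: "?D \<in> borel_measurable M"
    using st by (intro borel_measurable_diff W_measurable) auto
  have "sigma_sets (space M) {f -` A \<inter> space M |A. A \<in> sets borel} \<subseteq> sets (F s)"
    by (subst space_F[of s, symmetric], rule sets.sigma_sets_subset) (use measurable_sets[OF f] in auto)
  moreover have "sigma_sets (space M) {?D -` A \<inter> space M |A. A \<in> sets borel}
      = sets (vimage_algebra (space M) ?D borel)"
    unfolding sets_vimage_algebra_borel[symmetric] by (metis sets.sigma_sets_eq space_vimage_algebra)
  ultimately show ?thesis
    using indep_increment[OF st] fM DM unfolding indep_var_eq indep_sets2_eq by auto
qed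

lemma increment_square_integrable:
  assumes "0 \<le> s" "s \<le> t"
  shows "square_integrable M (\<lambda>\<omega>. W t \<omega> - W s \<omega>)"
    and "expectation (\<lambda>\<omega>. W t \<omega> - W s \<omega>) = 0"
    and "expectation (\<lambda>\<omega>. (W t \<omega> - W s \<omega>)\<^sup>2) = t - s"
proof -
  have "square_integrable M (\<lambda>\<omega>. W t \<omega> - W s \<omega>) \<and> expectation (\<lambda>\<omega>. W t \<omega> - W s \<omega>) = 0 \<and>
    expectation (\<lambda>\<omega>. (W t \<omega> - W s \<omega>)\<^sup>2) = t - s"
  proof (cases "s = t")
    case True
    then show ?thesis by (simp add: square_integrable_def)
  next
    case False
    with assms have st: "0 \<le> s" "s < t" by auto
    note D = increment_distributed[OF st]
    have sq: "0 < sqrt (t - s)" using st by simp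
    have "(\<lambda>\<omega>. W t \<omega> - W s \<omega>) \<in> borel_measurable M"
      using st by (intro borel_measurable_diff W_measurable) auto
    moreover have "integrable M (\<lambda>\<omega>. (W t \<omega> - W s \<omega>)\<^sup>2)"
      using integrable_normal_moment[OF sq, of 0 2] distributed_integrable[OF D, of "\<lambda>x. x\<^sup>2"] by simp
    moreover have E: "expectation (\<lambda>\<omega>. W t \<omega> - W s \<omega>) = 0"
      by (rule normal_distributed_expectation[OF sq D])
    moreover have "expectation (\<lambda>\<omega>. (W t \<omega> - W s \<omega>)\<^sup>2) = t - s"
      using normal_distributed_variance[OF sq D] st unfolding E by simp
    ultimately show ?thesis by (simp add: square_integrable_def)
  qed
  then show "square_integrable M (\<lambda>\<omega>. W t \<omega> - W s \<omega>)"
    "expectation (\<lambda>\<omega>. W t \<omega> - W s \<omega>) = 0"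
    "expectation (\<lambda>\<omega>. (W t \<omega> - W s \<omega>)\<^sup>2) = t - s" by auto
qed

text \<open>Since \<open>W 0\<close> vanishes only almost everywhere, the moments are transferred
  from the increment between the times 0 and \<open>t\<close>.\<close>

lemma W_square_integrable:
  assumes "0 \<le> t"
  shows "square_integrable M (W t)" and "expectation (W t) = 0"
    and "expectation (\<lambda>\<omega>. (W t \<omega>)\<^sup>2) = t"
proof -
  note t = increment_square_integrable[OF order.refl assms]
  have ae: "AE \<omega> in M. W t \<omega> - W 0 \<omega> = W t \<omega>" using W_0 by auto
  have ae2: "AE \<omega> in M. (W t \<omega> - W 0 \<omega>)\<^sup>2 = (W t \<omega>)\<^sup>2" using W_0 by auto
  have "integrable M (\<lambda>\<omega>. (W t \<omega> - W 0 \<omega>)\<^sup>2) \<longleftrightarrow> integrable M (\<lambda>\<omega>. (W t \<omega>)\<^sup>2)"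
    by (rule integrable_cong_AE) (use assms ae2 in \<open>auto\<close>)
  then show "square_integrable M (W t)"
    using t(1) assms by (simp add: square_integrable_def)
  show "expectation (W t) = 0"
    using integral_cong_AE[of "W t" M "\<lambda>\<omega>. W t \<omega> - W 0 \<omega>"] t(2) assms ae by auto
  have "expectation (\<lambda>\<omega>. (W t \<omega>)\<^sup>2) = expectation (\<lambda>\<omega>. (W t \<omega> - W 0 \<omega>)\<^sup>2)"
    by (rule integral_cong_AE) (use assms ae2 in auto)
  then show "expectation (\<lambda>\<omega>. (W t \<omega>)\<^sup>2) = t" using t(3) by simp
qed

text \<open>These are the martingale computations behind the isometry: independence factors the
  expectations, and the increment has mean 0 and variance \<open>t - s\<close>. Independence is
  stated for \<open>s < t\<close> only, hence the separate trivial case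
  \<open>s = t\<close>.\<close>

lemma increment_adapted_product:
  fixes f :: "'w \<Rightarrow> real"
  assumes st: "0 \<le> s" "s \<le> t" and f: "f \<in> borel_measurable (F s)" "integrable M f"
  shows "integrable M (\<lambda>\<omega>. f \<omega> * (W t \<omega> - W s \<omega>))" (is ?A)
    and "expectation (\<lambda>\<omega>. f \<omega> * (W t \<omega> - W s \<omega>)) = 0" (is ?B)
    and "integrable M (\<lambda>\<omega>. f \<omega> * (W t \<omega> - W s \<omega>)\<^sup>2)" (is ?C)
    and "expectation (\<lambda>\<omega>. f \<omega> * (W t \<omega> - W s \<omega>)\<^sup>2) = expectation f * (t - s)" (is ?D)
proof -
  have "?A \<and> ?B \<and> ?C \<and> ?D"
  proof (cases "s = t")
    case False
    with st have "s < t" by simp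
    note ind = indep_var_increment[OF st(1) this f(1)]
    have ind2: "indep_var borel f borel (\<lambda>\<omega>. (W t \<omega> - W s \<omega>)\<^sup>2)"
      using indep_var_compose[OF ind, of "\<lambda>x. x" borel "\<lambda>x. x\<^sup>2" borel] by (simp add: comp_def)
    note D = increment_square_integrable[OF st]
    show ?thesis
      using indep_var_integrable[OF ind f(2) square_integrable_integrable[OF D(1)]]
        indep_var_lebesgue_integral[OF ind f(2) square_integrable_integrable[OF D(1)]]
        indep_var_integrable[OF ind2 f(2) square_integrable_real_sq[OF D(1)]]
        indep_var_lebesgue_integral[OF ind2 f(2) square_integrable_real_sq[OF D(1)]] D
      by simp
  qed simp
  then show ?A ?B ?C ?D by auto
qed

end

section \<open>The Ito isometry and deterministic integrands\<close>

context brownian_setup begin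

lemma is_simple_mono:
  assumes "is_simple M F t N p \<xi>" "i \<le> j" "j \<le> N"
  shows "p i \<le> p j"
  using assms(2,3)
proof (induction j rule: dec_induct)
  case (step j)
  then have "p j \<le> p (Suc j)" using assms(1) by (simp add: is_simple_def)
  with step show ?case by simp
qed simp

lemma is_simple_bounds:
  assumes "is_simple M F t N p \<xi>" "i \<le> N"
  shows "0 \<le> p i" "p i \<le> t"
  using is_simple_mono[OF assms(1), of 0 i] is_simple_mono[OF assms(1), of i N] assms
  by (auto simp: is_simple_def)

lemma is_simple_value:
  assumes "is_simple M F t N p \<xi>" "i < N"
  shows "\<xi> i \<in> borel_measurable (F (p i))" "\<xi> i \<in> borel_measurable M" "square_integrable M (\<xi> i)"
proof -
  show *: "\<xi> i \<in> borel_measurable (F (p i))" using assms by (simp add: is_simple_def)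
  show **: "\<xi> i \<in> borel_measurable M" by (rule measurable_F_imp_M[OF *])
  obtain K where K: "norm (\<xi> i \<omega>) \<le> K" if "\<omega> \<in> space M" for \<omega>
    using assms unfolding is_simple_def bounded_iff by blast
  have "integrable M (\<lambda>\<omega>. (norm (\<xi> i \<omega>))\<^sup>2)"
  proof (rule integrable_const_bound[where B="K\<^sup>2"])
    show "AE x in M. norm ((norm (\<xi> i x))\<^sup>2) \<le> K\<^sup>2"
      using K by (auto intro!: AE_I2 power_mono)
  qed (use ** in measurable)
  with ** show "square_integrable M (\<xi> i)" by (simp add: square_integrable_def)
qed

text \<open>Induction on the number of intervals. The integral over the first \<open>n\<close>
  intervals and the next coefficient are both known at time \<open>p n\<close>, so the cross term is
  an adapted factor times a later increment and has mean 0. For this reason measurability with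
  respect to \<open>F (p n)\<close> is carried through the induction.\<close>

lemma simple_integral_isometry:
  fixes \<xi> :: "nat \<Rightarrow> 'w \<Rightarrow> 'a::euclidean_space"
  assumes S: "is_simple M F t N p \<xi>"
  shows "square_integrable M (simple_integral W N p \<xi>)"
    and "expectation (\<lambda>\<omega>. (norm (simple_integral W N p \<xi> \<omega>))\<^sup>2)
      = (\<Sum>i<N. (p (Suc i) - p i) * expectation (\<lambda>\<omega>. (norm (\<xi> i \<omega>))\<^sup>2))"
proof -
  have "simple_integral W n p \<xi> \<in> borel_measurable (F (p n)) \<and>
      square_integrable M (simple_integral W n p \<xi>) \<and>
      expectation (\<lambda>\<omega>. (norm (simple_integral W n p \<xi> \<omega>))\<^sup>2)
        = (\<Sum>i<n. (p (Suc i) - p i) * expectation (\<lambda>\<omega>. (norm (\<xi> i \<omega>))\<^sup>2))"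
    if "n \<le> N" for n
    using that
  proof (induction n)
    case 0
    then show ?case by (simp add: simple_integral_def[abs_def] square_integrable_def)
  next
    case (Suc n)
    define I where "I = simple_integral W n p \<xi>"
    define D where "D \<omega> = W (p (Suc n)) \<omega> - W (p n) \<omega>" for \<omega>
    have n: "n < N" using Suc by simp
    have pn: "0 \<le> p n" "p n \<le> p (Suc n)" "0 \<le> p (Suc n)"
      using is_simple_bounds[OF S] is_simple_mono[OF S, of n "Suc n"] n by auto
    have I: "I \<in> borel_measurable (F (p n))" "square_integrable M I"
      "expectation (\<lambda>\<omega>. (norm (I \<omega>))\<^sup>2) = (\<Sum>i<n. (p (Suc i) - p i) * expectation (\<lambda>\<omega>. (norm (\<xi> i \<omega>))\<^sup>2))"
      using Suc unfolding I_def by auto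
    note \<xi> = is_simple_value[OF S n]
    have step: "simple_integral W (Suc n) p \<xi> \<omega> = I \<omega> + D \<omega> *\<^sub>R \<xi> n \<omega>" for \<omega>
      by (simp add: simple_integral_def I_def D_def)
    have meas: "simple_integral W (Suc n) p \<xi> \<in> borel_measurable (F (p (Suc n)))"
      unfolding step[abs_def] D_def
      using pn by (intro borel_measurable_add borel_measurable_scaleR borel_measurable_diff W_measurable_F
          measurable_F_mono[OF I(1)] measurable_F_mono[OF \<xi>(1)]) auto
    have cross: "(\<lambda>\<omega>. I \<omega> \<bullet> \<xi> n \<omega>) \<in> borel_measurable (F (p n))"
      using I(1) \<xi>(1) by measurable
    have sq: "(\<lambda>\<omega>. (norm (\<xi> n \<omega>))\<^sup>2) \<in> borel_measurable (F (p n))"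
      using \<xi>(1) by measurable
    note A = increment_adapted_product[OF pn(1,2) cross square_integrable_inner_product[OF I(2) \<xi>(3)], folded D_def]
    note B = increment_adapted_product[OF pn(1,2) sq square_integrable_norm_sq[OF \<xi>(3)], folded D_def]
    have expand: "(norm (simple_integral W (Suc n) p \<xi> \<omega>))\<^sup>2
        = (norm (I \<omega>))\<^sup>2 + 2 * (I \<omega> \<bullet> \<xi> n \<omega> * D \<omega>) + (norm (\<xi> n \<omega>))\<^sup>2 * (D \<omega>)\<^sup>2" for \<omega>
      unfolding step power2_norm_eq_inner
      by (simp add: inner_simps inner_commute power2_eq_square algebra_simps)
    have "integrable M (\<lambda>\<omega>. (norm (simple_integral W (Suc n) p \<xi> \<omega>))\<^sup>2)"
      unfolding expand using A B square_integrable_norm_sq[OF I(2)] by simp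
    moreover have "expectation (\<lambda>\<omega>. (norm (simple_integral W (Suc n) p \<xi> \<omega>))\<^sup>2)
        = (\<Sum>i<Suc n. (p (Suc i) - p i) * expectation (\<lambda>\<omega>. (norm (\<xi> i \<omega>))\<^sup>2))"
      unfolding expand using A B square_integrable_norm_sq[OF I(2)] I(3) by simp
    ultimately show ?case
      using meas measurable_F_imp_M[OF meas] by (simp add: square_integrable_def)
  qed
  then show "square_integrable M (simple_integral W N p \<xi>)"
    "expectation (\<lambda>\<omega>. (norm (simple_integral W N p \<xi> \<omega>))\<^sup>2)
      = (\<Sum>i<N. (p (Suc i) - p i) * expectation (\<lambda>\<omega>. (norm (\<xi> i \<omega>))\<^sup>2))"
    by auto
qed

text \<open>The left-open intervals are disjoint, so at most one coefficient is active at time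
  \<open>s\<close> and squaring produces no cross terms. Since \<open>s\<close> is fixed, the
  formula also applies to coefficients that depend on \<open>s\<close>.\<close>

lemma norm_simple_process_sq:
  fixes \<xi> :: "nat \<Rightarrow> 'w \<Rightarrow> 'a::euclidean_space"
  assumes mono: "\<And>i j. i \<le> j \<Longrightarrow> j \<le> N \<Longrightarrow> p i \<le> p j"
  shows "(norm (simple_process N p \<xi> s \<omega>))\<^sup>2 = (\<Sum>i<N. indicator {p i<..p (Suc i)} s * (norm (\<xi> i \<omega>))\<^sup>2)"
proof (cases "\<exists>j<N. s \<in> {p j<..p (Suc j)}")
  case True
  then obtain j where j: "j < N" "s \<in> {p j<..p (Suc j)}" by blast
  have ind: "indicator {p i<..p (Suc i)} s = (if i = j then 1 else 0::real)" if "i < N" for i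
  proof (cases i j rule: linorder_cases)
    case less
    then have "p (Suc i) \<le> p j" using mono[of "Suc i" j] j by simp
    then show ?thesis using less j by (auto simp: indicator_def)
  next
    case greater
    then have "p (Suc j) \<le> p i" using mono[of "Suc j" i] that by simp
    then show ?thesis using greater j by (auto simp: indicator_def)
  qed (use j in auto)
  have "simple_process N p \<xi> s \<omega> = (\<Sum>i<N. if i = j then \<xi> i \<omega> else 0)"
    unfolding simple_process_def by (rule sum.cong) (auto simp: ind)
  moreover have "(\<Sum>i<N. indicator {p i<..p (Suc i)} s * (norm (\<xi> i \<omega>))\<^sup>2)
      = (\<Sum>i<N. if i = j then (norm (\<xi> i \<omega>))\<^sup>2 else 0)"
    by (rule sum.cong) (auto simp: ind)
  ultimately show ?thesis using j by simp
next
  case False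
  then have "\<And>i. i < N \<Longrightarrow> indicator {p i<..p (Suc i)} s = (0::real)" by (auto simp: indicator_def)
  then show ?thesis by (simp add: simple_process_def)
qed

lemma interval_sigma_finite: "sigma_finite_measure (restrict_space lborel {0..t::real})"
  by (rule sigma_finite_measure_restrict_space) (auto intro: lborel.sigma_finite_measure_axioms)

lemma interval_finite: "finite_measure (restrict_space lborel {0..t::real})"
  by (rule finite_measureI) (auto simp: emeasure_restrict_space emeasure_lborel_Icc_eq)

lemma measurable_indicator_interval [measurable]:
  "A \<in> sets borel \<Longrightarrow> (\<lambda>s. indicator A s :: real) \<in> borel_measurable (restrict_space lborel {0..t::real})"
  by (rule measurable_restrict_space1) auto

lemma simple_process_measurable:
  assumes S: "is_simple M F t N p \<xi>"
  shows "(\<lambda>(s, \<omega>). simple_process N p \<xi> s \<omega>) \<in> borel_measurable (restrict_space lborel {0..t} \<Otimes>\<^sub>M M)"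
  unfolding simple_process_def split_beta
proof (rule borel_measurable_sum)
  fix i assume i: "i \<in> {..<N}"
  then have [measurable]: "\<xi> i \<in> borel_measurable M" using is_simple_value[OF S] by simp
  show "(\<lambda>x. indicat_real {p i<..p (Suc i)} (fst x) *\<^sub>R \<xi> i (snd x))
      \<in> borel_measurable (restrict_space lborel {0..t} \<Otimes>\<^sub>M M)"
    by (intro borel_measurable_scaleR measurable_compose[OF measurable_fst]
        measurable_compose[OF measurable_snd]) auto
qed

text \<open>Both sides equal the sum of the interval lengths times the second moments of the
  coefficients; on the right this uses that all intervals lie inside \<open>{0..t}\<close>.
  Nonnegative integrals match the error terms in \<open>is_ito_integral\<close>.\<close>

lemma simple_process_isometry:
  fixes \<xi> :: "nat \<Rightarrow> 'w \<Rightarrow> 'a::euclidean_space"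
  assumes S: "is_simple M F t N p \<xi>"
  shows "(\<integral>\<^sup>+\<omega>. ennreal ((norm (simple_integral W N p \<xi> \<omega>))\<^sup>2) \<partial>M)
    = (\<integral>\<^sup>+s. \<integral>\<^sup>+\<omega>. ennreal ((norm (simple_process N p \<xi> s \<omega>))\<^sup>2) \<partial>M \<partial>restrict_space lborel {0..t})"
proof -
  have e0: "0 \<le> (p (Suc i) - p i)" if "i < N" for i
    using is_simple_mono[OF S, of i "Suc i"] that by simp
  have norm_sq: "(norm (simple_process N p \<xi> s \<omega>))\<^sup>2
      = (\<Sum>i<N. indicator {p i<..p (Suc i)} s * (norm (\<xi> i \<omega>))\<^sup>2)" for s \<omega>
    by (rule norm_simple_process_sq[OF is_simple_mono[OF S]])
  have inner: "(\<integral>\<^sup>+\<omega>. ennreal ((norm (simple_process N p \<xi> s \<omega>))\<^sup>2) \<partial>M)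
      = (\<Sum>i<N. ennreal (expectation (\<lambda>\<omega>. (norm (\<xi> i \<omega>))\<^sup>2)) * indicator {p i<..p (Suc i)} s)" for s
  proof -
    have "(\<integral>\<^sup>+\<omega>. ennreal ((norm (simple_process N p \<xi> s \<omega>))\<^sup>2) \<partial>M)
      = (\<integral>\<^sup>+\<omega>. (\<Sum>i<N. indicator {p i<..p (Suc i)} s * ennreal ((norm (\<xi> i \<omega>))\<^sup>2)) \<partial>M)"
      unfolding norm_sq
      by (intro nn_integral_cong) (simp add: indicator_mult_ennreal)
    also have "\<dots> = (\<Sum>i<N. \<integral>\<^sup>+\<omega>. indicator {p i<..p (Suc i)} s * ennreal ((norm (\<xi> i \<omega>))\<^sup>2) \<partial>M)"
      by (rule nn_integral_sum) (use is_simple_value(2)[OF S] in \<open>simp\<close>)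
    also have "\<dots> = (\<Sum>i<N. ennreal (expectation (\<lambda>\<omega>. (norm (\<xi> i \<omega>))\<^sup>2)) * indicator {p i<..p (Suc i)} s)"
    proof (rule sum.cong)
      fix i assume i: "i \<in> {..<N}"
      then have [measurable]: "\<xi> i \<in> borel_measurable M" using is_simple_value[OF S] by simp
      have "(\<integral>\<^sup>+\<omega>. ennreal ((norm (\<xi> i \<omega>))\<^sup>2) \<partial>M) = ennreal (expectation (\<lambda>\<omega>. (norm (\<xi> i \<omega>))\<^sup>2))"
        by (rule nn_integral_eq_integral[OF square_integrable_norm_sq[OF is_simple_value(3)[OF S]]]) (use i in auto)
      then show "(\<integral>\<^sup>+\<omega>. indicator {p i<..p (Suc i)} s * ennreal ((norm (\<xi> i \<omega>))\<^sup>2) \<partial>M)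
          = ennreal (expectation (\<lambda>\<omega>. (norm (\<xi> i \<omega>))\<^sup>2)) * indicator {p i<..p (Suc i)} s"
        by (subst nn_integral_cmult) (auto simp: mult.commute)
    qed simp
    finally show ?thesis .
  qed
  have len: "(\<integral>\<^sup>+s. indicator {p i<..p (Suc i)} s \<partial>restrict_space lborel {0..t}) = ennreal (p (Suc i) - p i)"
    if "i < N" for i
  proof -
    have "{p i<..p (Suc i)} \<subseteq> {0..t}"
      using is_simple_bounds[OF S, of i] is_simple_bounds[OF S, of "Suc i"] that by auto
    then have "(indicator {p i<..p (Suc i)} s :: ennreal) * indicator {0..t} s = indicator {p i<..p (Suc i)} s" for s
      by (auto split: split_indicator)
    then have "(\<integral>\<^sup>+s. indicator {p i<..p (Suc i)} s \<partial>restrict_space lborel {0..t})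
        = (\<integral>\<^sup>+s. indicator {p i<..p (Suc i)} s \<partial>lborel)"
      by (subst nn_integral_restrict_space) (auto simp del: nn_integral_indicator)
    then show ?thesis using e0[OF that] by simp
  qed
  have "(\<integral>\<^sup>+s. \<integral>\<^sup>+\<omega>. ennreal ((norm (simple_process N p \<xi> s \<omega>))\<^sup>2) \<partial>M \<partial>restrict_space lborel {0..t})
      = (\<Sum>i<N. \<integral>\<^sup>+s. ennreal (expectation (\<lambda>\<omega>. (norm (\<xi> i \<omega>))\<^sup>2)) * indicator {p i<..p (Suc i)} s
          \<partial>restrict_space lborel {0..t})"
    unfolding inner by (rule nn_integral_sum) (auto intro!: measurable_restrict_space1)
  also have "\<dots> = (\<Sum>i<N. ennreal (expectation (\<lambda>\<omega>. (norm (\<xi> i \<omega>))\<^sup>2)) * ennreal (p (Suc i) - p i))"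
  proof (rule sum.cong)
    fix i assume "i \<in> {..<N}"
    then show "(\<integral>\<^sup>+s. ennreal (expectation (\<lambda>\<omega>. (norm (\<xi> i \<omega>))\<^sup>2)) * indicator {p i<..p (Suc i)} s
          \<partial>restrict_space lborel {0..t}) = ennreal (expectation (\<lambda>\<omega>. (norm (\<xi> i \<omega>))\<^sup>2)) * ennreal (p (Suc i) - p i)"
      by (subst nn_integral_cmult) (auto simp: len intro!: measurable_restrict_space1)
  qed simp
  also have "\<dots> = ennreal (\<Sum>i<N. (p (Suc i) - p i) * expectation (\<lambda>\<omega>. (norm (\<xi> i \<omega>))\<^sup>2))"
    using e0 by (subst sum_ennreal[symmetric]) (auto simp: ennreal_mult mult.commute intro!: sum.cong)
  also have "\<dots> = (\<integral>\<^sup>+\<omega>. ennreal ((norm (simple_integral W N p \<xi> \<omega>))\<^sup>2) \<partial>M)"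
    unfolding simple_integral_isometry(2)[OF S, symmetric]
    by (rule nn_integral_eq_integral[symmetric, OF square_integrable_norm_sq[OF simple_integral_isometry(1)[OF S]]]) simp
  finally show ?thesis by simp
qed

text \<open>The identity is measurable from the product with \<open>M\<close> to the product with
  the coarser \<open>F t\<close>.\<close>

lemma progressive_measurable:
  assumes "progressive F t u" "0 \<le> t"
  shows "(\<lambda>(s, \<omega>). u s \<omega>) \<in> borel_measurable (restrict_space lborel {0..t} \<Otimes>\<^sub>M M)"
proof -
  have "(\<lambda>x. x) \<in> measurable (restrict_space lborel {0..t} \<Otimes>\<^sub>M M) (restrict_space borel {0..t} \<Otimes>\<^sub>M F t)"
  proof (rule measurable_pair)
    have "fst \<in> measurable (restrict_space lborel {0..t} \<Otimes>\<^sub>M M) (restrict_space lborel {0..t})" by simp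
    then show "fst \<circ> (\<lambda>x. x) \<in> measurable (restrict_space lborel {0..t} \<Otimes>\<^sub>M M) (restrict_space borel {0..t})"
      by (subst measurable_cong_sets[OF refl, of _ "restrict_space lborel {0..t}"])
        (auto simp: comp_def sets_restrict_space)
    show "snd \<circ> (\<lambda>x. x) \<in> measurable (restrict_space lborel {0..t} \<Otimes>\<^sub>M M) (F t)"
      unfolding comp_def
      by (rule measurable_compose[OF measurable_snd], rule measurable_F_imp_M[of _ t, THEN measurable_compose[rotated]])
        (auto simp: measurable_def sets_F_le[THEN subsetD] Int_absorb2 sets.sets_into_space)
  qed
  moreover have "(\<lambda>(s, \<omega>). u s \<omega>) \<in> borel_measurable (restrict_space borel {0..t} \<Otimes>\<^sub>M F t)"
    using assms unfolding progressive_def by auto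
  ultimately show ?thesis by (rule measurable_compose)
qed

lemma L2_processes_square_integrable:
  assumes "u \<in> L2_processes M F t" "0 \<le> t"
  shows "square_integrable (restrict_space lborel {0..t} \<Otimes>\<^sub>M M) (\<lambda>(s, \<omega>). u s \<omega>)"
  using assms progressive_measurable[of t u]
  by (simp add: L2_processes_def square_integrable_def case_prod_beta')

text \<open>Expanding around the mean, the cross term integrates to 0 and a nonnegative square
  \<open>(norm (c - h))\<^sup>2\<close> is left over. It is meant for a fixed time, with
  \<open>h\<close> the value of a deterministic integrand and \<open>\<zeta>\<close> that of a
  random simple process.\<close>

lemma variance_minimal:
  fixes \<zeta> :: "'w \<Rightarrow> 'a::euclidean_space"
  assumes "square_integrable M \<zeta>"
  shows "expectation (\<lambda>\<omega>. (norm (\<zeta> \<omega> - expectation \<zeta>))\<^sup>2) \<le> expectation (\<lambda>\<omega>. (norm (h - \<zeta> \<omega>))\<^sup>2)"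
proof -
  define c where "c = expectation \<zeta>"
  have sq: "square_integrable M (\<lambda>\<omega>. \<zeta> \<omega> - c)"
    by (intro square_integrable_diff square_integrable_const assms)
  have int: "integrable M \<zeta>" by (rule square_integrable_integrable[OF assms])
  have "(norm (h - \<zeta> \<omega>))\<^sup>2 = (norm (\<zeta> \<omega> - c))\<^sup>2 + 2 * ((c - h) \<bullet> (\<zeta> \<omega> - c)) + (norm (c - h))\<^sup>2" for \<omega>
    unfolding power2_norm_eq_inner by (simp add: inner_simps inner_commute algebra_simps)
  then have "expectation (\<lambda>\<omega>. (norm (h - \<zeta> \<omega>))\<^sup>2)
      = expectation (\<lambda>\<omega>. (norm (\<zeta> \<omega> - c))\<^sup>2) + 2 * expectation (\<lambda>\<omega>. (c - h) \<bullet> (\<zeta> \<omega> - c)) + (norm (c - h))\<^sup>2"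
    using square_integrable_norm_sq[OF sq] square_integrable_integrable[OF sq] by (simp add: prob_space)
  also have "expectation (\<lambda>\<omega>. (c - h) \<bullet> (\<zeta> \<omega> - c)) = 0"
    using int by (simp add: prob_space c_def)
  finally show ?thesis by (simp add: c_def)
qed

section \<open>Mean-square approximation of Ito integrals\<close>

lemma is_ito_integral_approx:
  assumes Y: "is_ito_integral M F W t H Y" and e: "0 < e"
  obtains N p \<xi> where "is_simple M F t N p \<xi>"
    "(\<integral>\<^sup>+(s, \<omega>). ennreal ((norm (H s \<omega> - simple_process N p \<xi> s \<omega>))\<^sup>2) \<partial>(restrict_space lborel {0..t} \<Otimes>\<^sub>M M)) < ennreal e"
    "(\<integral>\<^sup>+\<omega>. ennreal ((norm (Y \<omega> - simple_integral W N p \<xi> \<omega>))\<^sup>2) \<partial>M) < ennreal e"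
proof -
  from Y obtain N p \<xi> where S: "\<And>k. is_simple M F t (N k) (p k) (\<xi> k)"
    and 1: "(\<lambda>k. \<integral>\<^sup>+(s, \<omega>). ennreal ((norm (H s \<omega> - simple_process (N k) (p k) (\<xi> k) s \<omega>))\<^sup>2)
              \<partial>(restrict_space lborel {0..t} \<Otimes>\<^sub>M M)) \<longlonglongrightarrow> 0"
    and 2: "(\<lambda>k. \<integral>\<^sup>+\<omega>. ennreal ((norm (Y \<omega> - simple_integral W (N k) (p k) (\<xi> k) \<omega>))\<^sup>2) \<partial>M) \<longlonglongrightarrow> 0"
    unfolding is_ito_integral_def by blast
  have e': "0 < ennreal e" using e by simp
  have "\<forall>\<^sub>F k in sequentially.
      (\<integral>\<^sup>+(s, \<omega>). ennreal ((norm (H s \<omega> - simple_process (N k) (p k) (\<xi> k) s \<omega>))\<^sup>2)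
              \<partial>(restrict_space lborel {0..t} \<Otimes>\<^sub>M M)) < ennreal e \<and>
      (\<integral>\<^sup>+\<omega>. ennreal ((norm (Y \<omega> - simple_integral W (N k) (p k) (\<xi> k) \<omega>))\<^sup>2) \<partial>M) < ennreal e"
    using order_tendstoD(2)[OF 1 e'] order_tendstoD(2)[OF 2 e'] by eventually_elim simp
  then obtain k where "(\<integral>\<^sup>+(s, \<omega>). ennreal ((norm (H s \<omega> - simple_process (N k) (p k) (\<xi> k) s \<omega>))\<^sup>2)
              \<partial>(restrict_space lborel {0..t} \<Otimes>\<^sub>M M)) < ennreal e"
      "(\<integral>\<^sup>+\<omega>. ennreal ((norm (Y \<omega> - simple_integral W (N k) (p k) (\<xi> k) \<omega>))\<^sup>2) \<partial>M) < ennreal e"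
    using eventually_happens'[OF sequentially_bot] by blast
  then show ?thesis using that[OF S] by blast
qed

lemma square_integrable_nn_integral:
  assumes "f \<in> borel_measurable M" "(\<integral>\<^sup>+\<omega>. ennreal ((norm (f \<omega>))\<^sup>2) \<partial>M) < ennreal e"
  shows "square_integrable M f" "expectation (\<lambda>\<omega>. (norm (f \<omega>))\<^sup>2) < e"
proof -
  have "integrable M (\<lambda>\<omega>. (norm (f \<omega>))\<^sup>2)"
  proof (rule integrableI_nonneg)
    show "(\<integral>\<^sup>+\<omega>. ennreal ((norm (f \<omega>))\<^sup>2) \<partial>M) < \<infinity>"
      using assms(2) by (rule order.strict_trans) simp
  qed (use assms in auto)
  then show "square_integrable M f" using assms by (simp add: square_integrable_def)
  have "ennreal (expectation (\<lambda>\<omega>. (norm (f \<omega>))\<^sup>2)) < ennreal e"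
    using assms(2) nn_integral_eq_integral[OF \<open>integrable M (\<lambda>\<omega>. (norm (f \<omega>))\<^sup>2)\<close>] by simp
  then show "expectation (\<lambda>\<omega>. (norm (f \<omega>))\<^sup>2) < e"
    by (simp add: ennreal_less_iff)
qed

lemma expectation_norm_sq_add_le:
  assumes "square_integrable M f" "square_integrable M g"
  shows "expectation (\<lambda>\<omega>. (norm (f \<omega> + g \<omega>))\<^sup>2)
    \<le> 2 * expectation (\<lambda>\<omega>. (norm (f \<omega>))\<^sup>2) + 2 * expectation (\<lambda>\<omega>. (norm (g \<omega>))\<^sup>2)"
proof -
  have "expectation (\<lambda>\<omega>. (norm (f \<omega> + g \<omega>))\<^sup>2)
      \<le> expectation (\<lambda>\<omega>. 2 * (norm (f \<omega>))\<^sup>2 + 2 * (norm (g \<omega>))\<^sup>2)"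
    by (rule integral_mono)
      (use assms square_integrable_norm_sq[OF square_integrable_add[OF assms]] norm_add_sq_le in
        \<open>auto simp: square_integrable_norm_sq\<close>)
  then show ?thesis using assms by (simp add: square_integrable_norm_sq)
qed

text \<open>A single approximant at finite distance is enough, here with accuracy 1, because simple
  integrals are square-integrable.\<close>

lemma ito_integral_square_integrable:
  assumes Y: "is_ito_integral M F W t H Y"
  shows "square_integrable M Y"
proof -
  obtain N p \<xi> where S: "is_simple M F t N p \<xi>"
    and less: "(\<integral>\<^sup>+\<omega>. ennreal ((norm (Y \<omega> - simple_integral W N p \<xi> \<omega>))\<^sup>2) \<partial>M) < ennreal 1"
    using is_ito_integral_approx[OF Y zero_less_one] by blast
  note I = simple_integral_isometry(1)[OF S]
  have "(\<lambda>\<omega>. Y \<omega> - simple_integral W N p \<xi> \<omega>) \<in> borel_measurable M"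
    using Y I by (auto simp: is_ito_integral_def square_integrable_def)
  from square_integrable_add[OF square_integrable_nn_integral(1)[OF this less] I]
  show ?thesis by simp
qed

text \<open>Averaging the values of an approximating simple process does not increase its distance
  to a deterministic integrand.\<close>

lemma ito_integral_deterministic_approx:
  fixes h :: "real \<Rightarrow> 'a::euclidean_space"
  assumes Y: "is_ito_integral M F W t (\<lambda>s \<omega>. h s) Y" and t: "0 \<le> t" and e: "0 < e"
  obtains N p c where "is_simple M F t N p (\<lambda>i \<omega>. c i)"
    "square_integrable M (simple_integral W N p (\<lambda>i \<omega>. c i))"
    "expectation (\<lambda>\<omega>. (norm (Y \<omega> - simple_integral W N p (\<lambda>i \<omega>. c i) \<omega>))\<^sup>2) < e"
proof -
  let ?L = "restrict_space lborel {0..t}"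
  interpret L: sigma_finite_measure ?L by (rule interval_sigma_finite)
  interpret LM: pair_sigma_finite ?L M ..
  \<comment> \<open>Two errors of size \<open>e / 4\<close> will be added, and each is doubled by
    \<open>expectation_norm_sq_add_le\<close>.\<close>
  obtain N p \<xi> where S: "is_simple M F t N p \<xi>"
    and 1: "(\<integral>\<^sup>+(s, \<omega>). ennreal ((norm (h s - simple_process N p \<xi> s \<omega>))\<^sup>2) \<partial>(?L \<Otimes>\<^sub>M M)) < ennreal (e / 4)"
    and 2: "(\<integral>\<^sup>+\<omega>. ennreal ((norm (Y \<omega> - simple_integral W N p \<xi> \<omega>))\<^sup>2) \<partial>M) < ennreal (e / 4)"
    by (rule is_ito_integral_approx[OF Y, of "e / 4"]) (use e in simp_all)
  define c where "c i = expectation (\<xi> i)" for i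
  \<comment> \<open>The fluctuation of the coefficients. The integral with averaged coefficients is
    the original one minus the integral of \<open>\<zeta>\<close>, so it remains to show that the
    latter is small.\<close>
  define \<zeta> where "\<zeta> i \<omega> = \<xi> i \<omega> - c i" for i \<omega>
  have bdd: "bounded ((\<lambda>\<omega>. c i) ` space M)" for i
    by (rule boundedI[where B="norm (c i)"]) auto
  have Sc: "is_simple M F t N p (\<lambda>i \<omega>. c i)"
    using S by (auto simp: is_simple_def intro: bdd)
  have S\<zeta>: "is_simple M F t N p \<zeta>"
    using S unfolding is_simple_def \<zeta>_def by (auto intro!: bounded_minus_comp bdd)
  have meas: "(\<lambda>(s, \<omega>). h s - simple_process N p \<xi> s \<omega>) \<in> borel_measurable (?L \<Otimes>\<^sub>M M)"
  proof -
    have "(\<lambda>(s, \<omega>). h s) \<in> borel_measurable (?L \<Otimes>\<^sub>M M)"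
      using Y t by (intro progressive_measurable) (auto simp: is_ito_integral_def L2_processes_def)
    from borel_measurable_diff[OF this simple_process_measurable[OF S]] show ?thesis
      by (simp add: case_prod_beta)
  qed
  have "(\<integral>\<^sup>+\<omega>. ennreal ((norm (simple_integral W N p \<zeta> \<omega>))\<^sup>2) \<partial>M)
    = (\<integral>\<^sup>+s. \<integral>\<^sup>+\<omega>. ennreal ((norm (simple_process N p \<zeta> s \<omega>))\<^sup>2) \<partial>M \<partial>?L)"
    by (rule simple_process_isometry[OF S\<zeta>])
  \<comment> \<open>For fixed \<open>s\<close> the left-hand integrand is the variance of the simple
    process, which is at most its mean-square distance to the constant \<open>h s\<close>.\<close>
  also have "\<dots> \<le> (\<integral>\<^sup>+s. \<integral>\<^sup>+\<omega>. ennreal ((norm (h s - simple_process N p \<xi> s \<omega>))\<^sup>2) \<partial>M \<partial>?L)"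
  proof (rule nn_integral_mono)
    fix s
    have sq: "square_integrable M (simple_process N p \<xi> s)"
      unfolding simple_process_def[abs_def]
      by (intro square_integrable_sum square_integrable_scaleR is_simple_value(3)[OF S]) simp
    have int: "integrable M (\<xi> i)" if "i < N" for i
      using square_integrable_integrable is_simple_value(3)[OF S that] by blast
    have "expectation (simple_process N p \<xi> s) = (\<Sum>i<N. indicator {p i<..p (Suc i)} s *\<^sub>R c i)"
      unfolding simple_process_def[abs_def] c_def using int by simp
    then have \<zeta>: "simple_process N p \<zeta> s \<omega> = simple_process N p \<xi> s \<omega> - expectation (simple_process N p \<xi> s)" for \<omega>
      by (simp add: simple_process_def \<zeta>_def sum_subtractf scaleR_diff_right)
    have "(\<integral>\<^sup>+\<omega>. ennreal ((norm (simple_process N p \<zeta> s \<omega>))\<^sup>2) \<partial>M)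
        = ennreal (expectation (\<lambda>\<omega>. (norm (simple_process N p \<xi> s \<omega> - expectation (simple_process N p \<xi> s)))\<^sup>2))"
      unfolding \<zeta> by (rule nn_integral_eq_integral)
        (auto intro!: square_integrable_norm_sq square_integrable_diff sq square_integrable_const)
    also have "\<dots> \<le> ennreal (expectation (\<lambda>\<omega>. (norm (h s - simple_process N p \<xi> s \<omega>))\<^sup>2))"
      by (rule ennreal_leI[OF variance_minimal[OF sq]])
    also have "\<dots> = (\<integral>\<^sup>+\<omega>. ennreal ((norm (h s - simple_process N p \<xi> s \<omega>))\<^sup>2) \<partial>M)"
      by (rule nn_integral_eq_integral[symmetric])
        (auto intro!: square_integrable_norm_sq square_integrable_diff sq square_integrable_const)
    finally show "(\<integral>\<^sup>+\<omega>. ennreal ((norm (simple_process N p \<zeta> s \<omega>))\<^sup>2) \<partial>M)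
        \<le> (\<integral>\<^sup>+\<omega>. ennreal ((norm (h s - simple_process N p \<xi> s \<omega>))\<^sup>2) \<partial>M)" .
  qed
  also have "\<dots> = (\<integral>\<^sup>+(s, \<omega>). ennreal ((norm (h s - simple_process N p \<xi> s \<omega>))\<^sup>2) \<partial>(?L \<Otimes>\<^sub>M M))"
    using meas by (subst nn_integral_fst[symmetric]) (auto simp: case_prod_beta)
  also note 1
  finally have less: "(\<integral>\<^sup>+\<omega>. ennreal ((norm (simple_integral W N p \<zeta> \<omega>))\<^sup>2) \<partial>M) < ennreal (e / 4)" .
  note I\<zeta> = simple_integral_isometry(1)[OF S\<zeta>]
  note I\<xi> = simple_integral_isometry(1)[OF S]
  have Ic: "simple_integral W N p (\<lambda>i \<omega>. c i) \<omega> = simple_integral W N p \<xi> \<omega> - simple_integral W N p \<zeta> \<omega>" for \<omega>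
    by (simp add: simple_integral_def \<zeta>_def scaleR_diff_right sum_subtractf)
  have D: "square_integrable M (\<lambda>\<omega>. Y \<omega> - simple_integral W N p \<xi> \<omega>)"
    by (intro square_integrable_diff ito_integral_square_integrable[OF Y] I\<xi>)
  have "expectation (\<lambda>\<omega>. (norm (Y \<omega> - simple_integral W N p (\<lambda>i \<omega>. c i) \<omega>))\<^sup>2)
      = expectation (\<lambda>\<omega>. (norm ((Y \<omega> - simple_integral W N p \<xi> \<omega>) + simple_integral W N p \<zeta> \<omega>))\<^sup>2)"
    unfolding Ic by (simp add: algebra_simps)
  also have "\<dots> \<le> 2 * expectation (\<lambda>\<omega>. (norm (Y \<omega> - simple_integral W N p \<xi> \<omega>))\<^sup>2)
      + 2 * expectation (\<lambda>\<omega>. (norm (simple_integral W N p \<zeta> \<omega>))\<^sup>2)"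
    by (rule expectation_norm_sq_add_le[OF D I\<zeta>])
  also have "\<dots> < 2 * (e / 4) + 2 * (e / 4)"
    using square_integrable_nn_integral(2)[OF _ 2] square_integrable_nn_integral(2)[OF _ less] D I\<zeta>
    by (intro add_strict_mono) (auto simp: square_integrable_def)
  finally have "expectation (\<lambda>\<omega>. (norm (Y \<omega> - simple_integral W N p (\<lambda>i \<omega>. c i) \<omega>))\<^sup>2) < e" by simp
  then show ?thesis
    using that[OF Sc] simple_integral_isometry(1)[OF Sc] by blast
qed

end

section \<open>Linear combinations of Brownian values\<close>

lemma norm_iexp_diff_le: "norm (iexp x - iexp y) \<le> \<bar>x - y\<bar>"
proof -
  have "iexp x - iexp y = iexp y * (iexp (x - y) - 1)"
    by (simp add: algebra_simps exp_add[symmetric] flip: exp_diff)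
  then have "norm (iexp x - iexp y) = norm (iexp (x - y) - 1)"
    by (simp add: norm_mult)
  also have "\<dots> \<le> \<bar>x - y\<bar>"
    using iexp_approx1[of "x - y" 0] by simp
  finally show ?thesis .
qed

context brownian_setup begin

definition W_span :: "('w \<Rightarrow> real) set" where
  "W_span = {\<lambda>\<omega>. \<Sum>t\<in>S. c t * W t \<omega> | S c. finite S \<and> S \<subseteq> {0..}}"

lemma W_spanI: "finite S \<Longrightarrow> S \<subseteq> {0..} \<Longrightarrow> (\<lambda>\<omega>. \<Sum>t\<in>S. c t * W t \<omega>) \<in> W_span"
  unfolding W_span_def by blast

lemma W_in_W_span: "0 \<le> t \<Longrightarrow> W t \<in> W_span"
  using W_spanI[of "{t}" "\<lambda>_. 1"] by simp

lemma zero_W_span: "(\<lambda>\<omega>. 0) \<in> W_span"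
  using W_spanI[of "{}"] by simp

lemma W_span_scale:
  assumes "e \<in> W_span"
  shows "(\<lambda>\<omega>. r * e \<omega>) \<in> W_span"
proof -
  obtain S c where "finite S" "S \<subseteq> {0..}" "e = (\<lambda>\<omega>. \<Sum>t\<in>S. c t * W t \<omega>)"
    using assms unfolding W_span_def by blast
  with W_spanI[of S "\<lambda>t. r * c t"] show ?thesis
    by (simp add: sum_distrib_left mult.assoc)
qed

lemma W_span_add:
  assumes "e \<in> W_span" "f \<in> W_span"
  shows "(\<lambda>\<omega>. e \<omega> + f \<omega>) \<in> W_span"
proof -
  obtain S c where S: "finite S" "S \<subseteq> {0..}" "e = (\<lambda>\<omega>. \<Sum>t\<in>S. c t * W t \<omega>)"
    using assms(1) unfolding W_span_def by blast
  obtain S' c' where S': "finite S'" "S' \<subseteq> {0..}" "f = (\<lambda>\<omega>. \<Sum>t\<in>S'. c' t * W t \<omega>)"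
    using assms(2) unfolding W_span_def by blast
  let ?d = "\<lambda>t. (if t \<in> S then c t else 0) + (if t \<in> S' then c' t else 0)"
  have "e \<omega> + f \<omega> = (\<Sum>t\<in>S \<union> S'. ?d t * W t \<omega>)" for \<omega>
  proof -
    have "e \<omega> = (\<Sum>t\<in>S \<union> S'. (if t \<in> S then c t else 0) * W t \<omega>)"
      unfolding S(3) by (rule sum.mono_neutral_cong_left) (use S S' in auto)
    moreover have "f \<omega> = (\<Sum>t\<in>S \<union> S'. (if t \<in> S' then c' t else 0) * W t \<omega>)"
      unfolding S'(3) by (rule sum.mono_neutral_cong_left) (use S S' in auto)
    ultimately show ?thesis by (simp add: sum.distrib distrib_right)
  qed
  with W_spanI[of "S \<union> S'" ?d] S S' show ?thesis by simp
qed

lemma W_span_sum: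
  "finite I \<Longrightarrow> (\<And>i. i \<in> I \<Longrightarrow> e i \<in> W_span) \<Longrightarrow> (\<lambda>\<omega>. \<Sum>i\<in>I. e i \<omega>) \<in> W_span"
  by (induction I rule: finite_induct) (auto simp: zero_W_span W_span_add)

lemma W_span_square_integrable:
  assumes "e \<in> W_span"
  shows "square_integrable M e"
proof -
  obtain S c where "finite S" "S \<subseteq> {0..}" "e = (\<lambda>\<omega>. \<Sum>t\<in>S. c t * W t \<omega>)"
    using assms unfolding W_span_def by blast
  then show ?thesis
    by (auto intro!: square_integrable_sum square_integrable_mult W_square_integrable)
qed

lemma W_span_mean:
  assumes "e \<in> W_span"
  shows "expectation e = 0"
proof -
  obtain S c where S: "finite S" "S \<subseteq> {0..}" "e = (\<lambda>\<omega>. \<Sum>t\<in>S. c t * W t \<omega>)"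
    using assms unfolding W_span_def by blast
  have "expectation e = (\<Sum>t\<in>S. c t * expectation (W t))"
    unfolding S(3)
    by (subst Bochner_Integration.integral_sum)
      (use S(2) W_square_integrable(1) square_integrable_integrable in \<open>auto\<close>)
  also have "\<dots> = 0"
    by (rule sum.neutral) (use S W_square_integrable(2) in auto)
  finally show ?thesis .
qed

lemma char_distr_eq:
  "f \<in> borel_measurable M \<Longrightarrow> char (distr M borel f) v = (CLINT \<omega>|M. iexp (v * f \<omega>))"
  unfolding char_def by (subst integral_distr) auto

lemma increment_char:
  assumes "0 \<le> s" "s \<le> t"
  shows "(CLINT \<omega>|M. iexp (v * (W t \<omega> - W s \<omega>))) = exp (of_real (- (v\<^sup>2 * (t - s)) / 2))"
proof (cases "s = t")
  case True
  then show ?thesis by (simp add: prob_space)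
next
  case False
  with assms have st: "0 \<le> s" "s < t" by auto
  let ?N = "density lborel (\<lambda>x. ennreal (normal_density 0 (sqrt (t - s)) x))"
  have "distr M lborel (\<lambda>\<omega>. W t \<omega> - W s \<omega>) = ?N"
    using increment_distributed[OF st] by (simp add: distributed_def)
  moreover have "distr M borel (\<lambda>\<omega>. W t \<omega> - W s \<omega>) = distr M lborel (\<lambda>\<omega>. W t \<omega> - W s \<omega>)"
    by (rule distr_cong) auto
  ultimately have "distr M borel (\<lambda>\<omega>. W t \<omega> - W s \<omega>) = ?N" by simp
  then have "char (distr M borel (\<lambda>\<omega>. W t \<omega> - W s \<omega>)) v = (CLINT x|?N. iexp (v * x))"
    by (simp add: char_def)
  also have "\<dots> = exp (\<i> * of_real (v * 0) - of_real (v * ((sqrt (t - s))\<^sup>2 * v)) / 2)"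
  proof -
    have "normal_law 0 ((*) ((sqrt (t - s))\<^sup>2)) ?N" using st by (intro normal_law_density) simp
    then show ?thesis unfolding normal_law_def inner_real_def by blast
  qed
  also have "\<dots> = exp (of_real (- (v\<^sup>2 * (t - s)) / 2))"
    using st by (simp add: power2_eq_square ac_simps)
  finally show ?thesis
    using st by (simp add: char_distr_eq borel_measurable_diff W_measurable)
qed

lemma W_char:
  assumes "0 \<le> t"
  shows "(CLINT \<omega>|M. iexp (v * W t \<omega>)) = exp (of_real (- (v\<^sup>2 * t) / 2))"
proof -
  have "(CLINT \<omega>|M. iexp (v * W t \<omega>)) = (CLINT \<omega>|M. iexp (v * (W t \<omega> - W 0 \<omega>)))"
  proof (rule integral_cong_AE)
    have [measurable]: "W t \<in> borel_measurable M" "W 0 \<in> borel_measurable M"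
      using assms by (auto intro: W_measurable)
    show "(\<lambda>\<omega>. iexp (v * W t \<omega>)) \<in> borel_measurable M"
      "(\<lambda>\<omega>. iexp (v * (W t \<omega> - W 0 \<omega>))) \<in> borel_measurable M"
      by measurable
    show "AE \<omega> in M. iexp (v * W t \<omega>) = iexp (v * (W t \<omega> - W 0 \<omega>))"
      using W_0 by eventually_elim simp
  qed
  then show ?thesis using increment_char[OF order.refl assms] by simp
qed

text \<open>Induction on the largest time \<open>b\<close>. Writing \<open>W b\<close> as the value
  at the preceding time \<open>a\<close> plus an increment leaves a combination of earlier values
  and an independent normal increment. The characteristic function then factors, and the variances
  add because the product of the two parts has mean 0.\<close>

lemma W_span_char:
  assumes "e \<in> W_span"
  shows "(CLINT \<omega>|M. iexp (v * e \<omega>)) = exp (of_real (- (v\<^sup>2 * expectation (\<lambda>\<omega>. (e \<omega>)\<^sup>2)) / 2))"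
proof -
  have "(CLINT \<omega>|M. iexp (v * (\<Sum>t\<in>S. c t * W t \<omega>)))
      = exp (of_real (- (v\<^sup>2 * expectation (\<lambda>\<omega>. (\<Sum>t\<in>S. c t * W t \<omega>)\<^sup>2)) / 2))"
    if "finite S" "S \<subseteq> {0..}" for S c
    using that
  proof (induction S arbitrary: c rule: finite_linorder_max_induct)
    case empty
    then show ?case by (simp add: prob_space)
  next
    case (insert b S)
    show ?case
    proof (cases "S = {}")
      case True
      then show ?thesis
        using W_char[of b "v * c b"] W_square_integrable(3)[of b] insert.prems
        by (simp add: power_mult_distrib mult.assoc)
    next
      case False
      define a where "a = Max S"
      have a: "a \<in> S" "\<And>s. s \<in> S \<Longrightarrow> s \<le> a" unfolding a_def using insert False by auto
      have ab: "0 \<le> a" "a < b" using a insert by auto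
      \<comment> \<open>The coefficient of \<open>W b\<close> is moved to \<open>W a\<close>; the
        induction hypothesis must therefore hold for all coefficient functions.\<close>
      define c' where "c' = c(a := c a + c b)"
      define e where "e \<omega> = (\<Sum>t\<in>S. c' t * W t \<omega>)" for \<omega>
      define D where "D \<omega> = W b \<omega> - W a \<omega>" for \<omega>
      have eq: "(\<Sum>t\<in>insert b S. c t * W t \<omega>) = e \<omega> + c b * D \<omega>" for \<omega>
      proof -
        have "e \<omega> = (c a + c b) * W a \<omega> + (\<Sum>t\<in>S - {a}. c t * W t \<omega>)"
          unfolding e_def c'_def using insert.hyps(1) a(1)
          by (subst sum.remove[of S a]) (auto intro!: sum.cong)
        moreover have "(\<Sum>t\<in>S. c t * W t \<omega>) = c a * W a \<omega> + (\<Sum>t\<in>S - {a}. c t * W t \<omega>)"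
          using insert.hyps(1) a(1) by (rule sum.remove)
        moreover have "b \<notin> S" using insert.hyps by auto
        ultimately show ?thesis
          using insert.hyps(1) by (simp add: D_def algebra_simps)
      qed
      have eF: "e \<in> borel_measurable (F a)"
        unfolding e_def[abs_def] using a insert.prems
        by (intro borel_measurable_sum borel_measurable_times borel_measurable_const W_measurable_F) auto
      have eM: "e \<in> borel_measurable M" by (rule measurable_F_imp_M[OF eF])
      have esq: "square_integrable M e"
        unfolding e_def[abs_def] using insert.prems
        by (intro square_integrable_sum square_integrable_mult W_square_integrable) auto
      have "indep_var borel e borel D"
        using indep_var_increment[OF ab eF] by (simp add: D_def[abs_def])
      from indep_var_compose[OF this, of "\<lambda>x. x" borel "\<lambda>x. c b * x" borel]
      have ind: "indep_var borel e borel (\<lambda>\<omega>. c b * D \<omega>)" by (simp add: comp_def)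
      have DM: "D \<in> borel_measurable M"
        unfolding D_def[abs_def] using ab by (intro borel_measurable_diff W_measurable) auto
      have Dsq: "square_integrable M D" "expectation (\<lambda>\<omega>. (D \<omega>)\<^sup>2) = b - a"
        using increment_square_integrable[of a b] ab by (auto simp: D_def[abs_def])
      have eD: "expectation (\<lambda>\<omega>. e \<omega> * D \<omega>) = 0"
        using increment_adapted_product(2)[of a b e] ab eF square_integrable_integrable[OF esq]
        by (simp add: D_def)
      have var: "expectation (\<lambda>\<omega>. (e \<omega> + c b * D \<omega>)\<^sup>2) = expectation (\<lambda>\<omega>. (e \<omega>)\<^sup>2) + (c b)\<^sup>2 * (b - a)"
        using integral_sq_diff_scaled[OF esq Dsq(1), of "- c b"] eD Dsq(2) by simp
      have "(CLINT \<omega>|M. iexp (v * (e \<omega> + c b * D \<omega>)))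
          = (CLINT \<omega>|M. iexp (v * e \<omega>)) * (CLINT \<omega>|M. iexp (v * (c b * D \<omega>)))"
        using char_distr_add[OF ind, of v] eM DM by (simp add: char_distr_eq)
      also have "(CLINT \<omega>|M. iexp (v * e \<omega>)) = exp (of_real (- (v\<^sup>2 * expectation (\<lambda>\<omega>. (e \<omega>)\<^sup>2)) / 2))"
        unfolding e_def using insert by auto
      also have "(CLINT \<omega>|M. iexp (v * (c b * D \<omega>))) = exp (of_real (- (v\<^sup>2 * ((c b)\<^sup>2 * (b - a))) / 2))"
        using increment_char[of a b "v * c b"] ab by (simp add: D_def power_mult_distrib mult.assoc)
      also have "exp (of_real (- (v\<^sup>2 * expectation (\<lambda>\<omega>. (e \<omega>)\<^sup>2)) / 2))
            * exp (complex_of_real (- (v\<^sup>2 * ((c b)\<^sup>2 * (b - a))) / 2))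
          = exp (of_real (- (v\<^sup>2 * (expectation (\<lambda>\<omega>. (e \<omega>)\<^sup>2) + (c b)\<^sup>2 * (b - a))) / 2))"
        unfolding exp_add[symmetric] of_real_add[symmetric]
        by (intro arg_cong[where f=exp] arg_cong[where f=of_real]) (simp add: field_simps)
      finally show ?thesis unfolding eq var .
    qed
  qed
  then show ?thesis using assms unfolding W_span_def by blast
qed

section \<open>The Gaussian space as the mean-square closure of the span of Brownian values\<close>

definition gaussian_space :: "('w \<Rightarrow> real) set" where
  "gaussian_space = {R. square_integrable M R \<and>
     (\<forall>\<epsilon>>0. \<exists>e\<in>W_span. expectation (\<lambda>\<omega>. (R \<omega> - e \<omega>)\<^sup>2) < \<epsilon>)}"

lemma abs_expectation_le:
  assumes "square_integrable M R"
  shows "expectation (\<lambda>\<omega>. \<bar>R \<omega>\<bar>) \<le> sqrt (expectation (\<lambda>\<omega>. (R \<omega>)\<^sup>2))"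
proof -
  have "square_integrable M (\<lambda>\<omega>. \<bar>R \<omega>\<bar>)" using assms by (auto simp: square_integrable_def)
  from abs_integral_mult_le[OF this square_integrable_const[of 1]] show ?thesis
    by (simp add: prob_space)
qed

text \<open>Both sides are continuous under mean-square convergence: \<open>iexp\<close> is
  1-Lipschitz, so the left-hand side moves by at most \<open>\<bar>v\<bar>\<close> times the L2
  distance, and second moments converge by Cauchy-Schwarz. The formula for the span therefore passes
  to the limit.\<close>

lemma gaussian_space_char:
  assumes R: "R \<in> gaussian_space"
  shows "(CLINT \<omega>|M. iexp (v * R \<omega>)) = exp (of_real (- (v\<^sup>2 * expectation (\<lambda>\<omega>. (R \<omega>)\<^sup>2)) / 2))"
proof -
  have Rsq: "square_integrable M R" using R by (simp add: gaussian_space_def)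
  then have RM[measurable]: "R \<in> borel_measurable M" by (simp add: square_integrable_def)
  have "\<forall>k. \<exists>e\<in>W_span. expectation (\<lambda>\<omega>. (R \<omega> - e \<omega>)\<^sup>2) < 1 / real (Suc k)"
    using R by (simp add: gaussian_space_def)
  then obtain e where e: "\<And>k. e k \<in> W_span" "\<And>k. expectation (\<lambda>\<omega>. (R \<omega> - e k \<omega>)\<^sup>2) < 1 / real (Suc k)"
    by metis
  define \<delta> where "\<delta> k = expectation (\<lambda>\<omega>. (R \<omega> - e k \<omega>)\<^sup>2)" for k
  have esq: "square_integrable M (e k)" for k by (rule W_span_square_integrable[OF e(1)])
  then have eM[measurable]: "e k \<in> borel_measurable M" for k by (simp add: square_integrable_def)
  have dsq: "square_integrable M (\<lambda>\<omega>. R \<omega> - e k \<omega>)" for k by (rule square_integrable_diff[OF Rsq esq])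
  have \<delta>: "\<delta> \<longlonglongrightarrow> 0"
    by (rule tendsto_sandwich[OF _ _ tendsto_const LIMSEQ_Suc[OF lim_1_over_n]])
      (use e(2) in \<open>auto simp: \<delta>_def less_imp_le\<close>)
  have sq\<delta>: "(\<lambda>k. sqrt (\<delta> k)) \<longlonglongrightarrow> 0"
    using tendsto_real_sqrt[OF \<delta>] by simp
  have "(\<lambda>k. (CLINT \<omega>|M. iexp (v * e k \<omega>)) - (CLINT \<omega>|M. iexp (v * R \<omega>))) \<longlonglongrightarrow> 0"
  proof (rule Lim_null_comparison)
    show "(\<lambda>k. \<bar>v\<bar> * sqrt (\<delta> k)) \<longlonglongrightarrow> 0"
      using tendsto_mult_left[OF sq\<delta>, of "\<bar>v\<bar>"] by simp
    have "norm ((CLINT \<omega>|M. iexp (v * e k \<omega>)) - (CLINT \<omega>|M. iexp (v * R \<omega>))) \<le> \<bar>v\<bar> * sqrt (\<delta> k)" for k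
    proof -
      have int: "integrable M (\<lambda>\<omega>. iexp (v * f \<omega>))" if [measurable]: "f \<in> borel_measurable M" for f
        by (rule integrable_const_bound[where B=1]) auto
      have "norm ((CLINT \<omega>|M. iexp (v * e k \<omega>)) - (CLINT \<omega>|M. iexp (v * R \<omega>)))
          = norm (CLINT \<omega>|M. iexp (v * e k \<omega>) - iexp (v * R \<omega>))"
        using int by simp
      also have "\<dots> \<le> expectation (\<lambda>\<omega>. norm (iexp (v * e k \<omega>) - iexp (v * R \<omega>)))"
        by (rule integral_norm_bound)
      also have "\<dots> \<le> expectation (\<lambda>\<omega>. \<bar>v\<bar> * \<bar>R \<omega> - e k \<omega>\<bar>)"
      proof (rule integral_mono)
        show "integrable M (\<lambda>\<omega>. norm (iexp (v * e k \<omega>) - iexp (v * R \<omega>)))"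
          using int[OF eM] int[OF RM] by (intro integrable_norm Bochner_Integration.integrable_diff)
        show "integrable M (\<lambda>\<omega>. \<bar>v\<bar> * \<bar>R \<omega> - e k \<omega>\<bar>)"
          using square_integrable_integrable[OF dsq] by simp
        show "norm (iexp (v * e k \<omega>) - iexp (v * R \<omega>)) \<le> \<bar>v\<bar> * \<bar>R \<omega> - e k \<omega>\<bar>" for \<omega>
          using norm_iexp_diff_le[of "v * e k \<omega>" "v * R \<omega>"]
          by (simp add: abs_mult[symmetric] abs_minus_commute right_diff_distrib)
      qed
      also have "\<dots> \<le> \<bar>v\<bar> * sqrt (\<delta> k)"
        using abs_expectation_le[OF dsq, of k] by (simp add: \<delta>_def mult_left_mono)
      finally show ?thesis .
    qed
    then show "\<forall>\<^sub>F k in sequentially. norm ((CLINT \<omega>|M. iexp (v * e k \<omega>)) - (CLINT \<omega>|M. iexp (v * R \<omega>))) \<le> \<bar>v\<bar> * sqrt (\<delta> k)"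
      by simp
  qed
  then have lim1: "(\<lambda>k. CLINT \<omega>|M. iexp (v * e k \<omega>)) \<longlonglongrightarrow> (CLINT \<omega>|M. iexp (v * R \<omega>))"
    by (rule LIM_zero_cancel)
  have "(\<lambda>k. expectation (\<lambda>\<omega>. (e k \<omega>)\<^sup>2) - expectation (\<lambda>\<omega>. (R \<omega>)\<^sup>2)) \<longlonglongrightarrow> 0"
  proof (rule Lim_null_comparison)
    show "(\<lambda>k. 2 * (sqrt (expectation (\<lambda>\<omega>. (R \<omega>)\<^sup>2)) * sqrt (\<delta> k)) + \<delta> k) \<longlonglongrightarrow> 0"
      using tendsto_add[OF tendsto_mult_left[OF tendsto_mult_left[OF sq\<delta>]] \<delta>] by simp
    have "\<bar>expectation (\<lambda>\<omega>. (e k \<omega>)\<^sup>2) - expectation (\<lambda>\<omega>. (R \<omega>)\<^sup>2)\<bar>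
        \<le> 2 * (sqrt (expectation (\<lambda>\<omega>. (R \<omega>)\<^sup>2)) * sqrt (\<delta> k)) + \<delta> k" for k
    proof -
      \<comment> \<open>Here \<open>e k\<close> is written as \<open>R\<close> minus the residual
        \<open>R - e k\<close> and the square is expanded.\<close>
      have "expectation (\<lambda>\<omega>. (e k \<omega>)\<^sup>2)
          = expectation (\<lambda>\<omega>. (R \<omega>)\<^sup>2) - 2 * expectation (\<lambda>\<omega>. R \<omega> * (R \<omega> - e k \<omega>)) + \<delta> k"
        using integral_sq_diff_scaled[OF Rsq dsq, of 1 k] by (simp add: \<delta>_def)
      moreover have "0 \<le> \<delta> k" by (simp add: \<delta>_def)
      moreover have "\<bar>expectation (\<lambda>\<omega>. R \<omega> * (R \<omega> - e k \<omega>))\<bar> \<le> sqrt (expectation (\<lambda>\<omega>. (R \<omega>)\<^sup>2)) * sqrt (\<delta> k)"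
        unfolding \<delta>_def by (rule abs_integral_mult_le[OF Rsq dsq])
      ultimately show ?thesis by linarith
    qed
    then show "\<forall>\<^sub>F k in sequentially. norm (expectation (\<lambda>\<omega>. (e k \<omega>)\<^sup>2) - expectation (\<lambda>\<omega>. (R \<omega>)\<^sup>2))
        \<le> 2 * (sqrt (expectation (\<lambda>\<omega>. (R \<omega>)\<^sup>2)) * sqrt (\<delta> k)) + \<delta> k"
      by simp
  qed
  then have "(\<lambda>k. expectation (\<lambda>\<omega>. (e k \<omega>)\<^sup>2)) \<longlonglongrightarrow> expectation (\<lambda>\<omega>. (R \<omega>)\<^sup>2)"
    by (rule LIM_zero_cancel)
  then have "(\<lambda>k. CLINT \<omega>|M. iexp (v * e k \<omega>))
      \<longlonglongrightarrow> exp (of_real (- (v\<^sup>2 * expectation (\<lambda>\<omega>. (R \<omega>)\<^sup>2)) / 2))"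
    unfolding W_span_char[OF e(1)] by (intro tendsto_intros) auto
  with lim1 show ?thesis by (rule LIMSEQ_unique)
qed

text \<open>An element \<open>e\<close> whose squared distance to \<open>R\<close> is within \<eta>
  of the infimum can be improved by less than \<eta> along any direction \<open>w\<close>, and
  \<open>discriminant_bound\<close> turns this into near orthogonality. The bound on the residual
  comes from comparing with the zero element of the span.\<close>

lemma nearly_orthogonal_residual:
  assumes R: "square_integrable M R" and \<eta>: "0 < \<eta>"
  obtains e where "e \<in> W_span"
    "expectation (\<lambda>\<omega>. (R \<omega> - e \<omega>)\<^sup>2) \<le> expectation (\<lambda>\<omega>. (R \<omega>)\<^sup>2) + \<eta>"
    "\<And>w. w \<in> W_span \<Longrightarrow>
      \<bar>expectation (\<lambda>\<omega>. (R \<omega> - e \<omega>) * w \<omega>)\<bar> \<le> sqrt \<eta> * sqrt (expectation (\<lambda>\<omega>. (w \<omega>)\<^sup>2))"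
proof -
  define d where "d e = expectation (\<lambda>\<omega>. (R \<omega> - e \<omega>)\<^sup>2)" for e
  define J where "J = (INF e\<in>W_span. d e)"
  have bdd: "bdd_below (d ` W_span)" by (rule bdd_belowI2[of _ 0]) (simp add: d_def)
  have J: "J \<le> d e" if "e \<in> W_span" for e unfolding J_def by (rule cINF_lower[OF bdd that])
  have ne: "d ` W_span \<noteq> {}" using zero_W_span by auto
  have "\<exists>x\<in>d ` W_span. x < J + \<eta>"
    using cInf_lessD[OF ne, of "J + \<eta>"] \<eta> unfolding J_def by auto
  then obtain e where e: "e \<in> W_span" "d e < J + \<eta>" by blast
  have qsq: "square_integrable M (\<lambda>\<omega>. R \<omega> - e \<omega>)"
    by (rule square_integrable_diff[OF R W_span_square_integrable[OF e(1)]])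
  show ?thesis
  proof (rule that[OF e(1)])
    show "expectation (\<lambda>\<omega>. (R \<omega> - e \<omega>)\<^sup>2) \<le> expectation (\<lambda>\<omega>. (R \<omega>)\<^sup>2) + \<eta>"
      using e(2) J[OF zero_W_span] by (simp add: d_def)
    fix w assume w: "w \<in> W_span"
    note wsq = W_span_square_integrable[OF w]
    have "(expectation (\<lambda>\<omega>. (R \<omega> - e \<omega>) * w \<omega>))\<^sup>2 \<le> \<eta> * expectation (\<lambda>\<omega>. (w \<omega>)\<^sup>2)"
    proof (rule discriminant_bound)
      fix r
      \<comment> \<open>The perturbed element stays in the span, so its distance is still at least
        the infimum.\<close>
      have "J \<le> d (\<lambda>\<omega>. e \<omega> + r * w \<omega>)" by (intro J W_span_add W_span_scale e w)
      also have "\<dots> = expectation (\<lambda>\<omega>. ((R \<omega> - e \<omega>) - r * w \<omega>)\<^sup>2)"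
        by (simp add: d_def algebra_simps)
      also have "\<dots> = d e - 2 * r * expectation (\<lambda>\<omega>. (R \<omega> - e \<omega>) * w \<omega>) + r\<^sup>2 * expectation (\<lambda>\<omega>. (w \<omega>)\<^sup>2)"
        unfolding d_def by (rule integral_sq_diff_scaled[OF qsq wsq])
      finally show "2 * r * expectation (\<lambda>\<omega>. (R \<omega> - e \<omega>) * w \<omega>) - r\<^sup>2 * expectation (\<lambda>\<omega>. (w \<omega>)\<^sup>2) \<le> \<eta>"
        using e(2) by linarith
    qed simp
    then show "\<bar>expectation (\<lambda>\<omega>. (R \<omega> - e \<omega>) * w \<omega>)\<bar> \<le> sqrt \<eta> * sqrt (expectation (\<lambda>\<omega>. (w \<omega>)\<^sup>2))"
      by (metis real_sqrt_abs real_sqrt_le_mono real_sqrt_mult)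
  qed
qed

text \<open>A quantitative form of the double-orthogonal characterisation of a closed subspace; working
  with nearly orthogonal residuals avoids the completeness of the space of square-integrable
  variables.\<close>

lemma gaussian_space_criterion:
  assumes R: "square_integrable M R" and K: "0 \<le> K"
    and dual: "\<And>q \<epsilon>. square_integrable M q \<Longrightarrow> expectation q = 0 \<Longrightarrow> 0 \<le> \<epsilon> \<Longrightarrow>
      (\<And>w. w \<in> W_span \<Longrightarrow> \<bar>expectation (\<lambda>\<omega>. q \<omega> * w \<omega>)\<bar> \<le> \<epsilon> * sqrt (expectation (\<lambda>\<omega>. (w \<omega>)\<^sup>2))) \<Longrightarrow>
      \<bar>expectation (\<lambda>\<omega>. q \<omega> * R \<omega>)\<bar> \<le> K * \<epsilon>"
  shows "(\<lambda>\<omega>. R \<omega> - expectation R) \<in> gaussian_space"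
proof -
  define R0 where "R0 \<omega> = R \<omega> - expectation R" for \<omega>
  have R0: "square_integrable M R0"
    unfolding R0_def[abs_def] by (intro square_integrable_diff R square_integrable_const)
  have meanR0: "expectation R0 = 0"
    unfolding R0_def[abs_def] using square_integrable_integrable[OF R] by (simp add: prob_space)
  \<comment> \<open>A bound for the L2 norm of every near-projection \<open>e\<close> used below:
    since \<open>e = R0 - q\<close>, its second moment is at most twice that of \<open>R0\<close>
    plus twice that of \<open>q\<close>, and the latter exceeds that of \<open>R0\<close> by at most
    \<open>\<theta>\<^sup>2\<close>, which is at most 1.\<close>
  define C where "C = sqrt (4 * expectation (\<lambda>\<omega>. (R0 \<omega>)\<^sup>2) + 2)"
  have "\<exists>e\<in>W_span. expectation (\<lambda>\<omega>. (R0 \<omega> - e \<omega>)\<^sup>2) < \<epsilon>" if \<epsilon>: "0 < \<epsilon>" for \<epsilon>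
  proof -
    have C0: "0 \<le> C" by (simp add: C_def)
    \<comment> \<open>The squared residual will be at most \<open>\<theta> * (K + C)\<close>. This
      choice makes it smaller than \<epsilon>, and it is possible because neither \<open>K\<close>
      nor \<open>C\<close> depends on the residual.\<close>
    define \<theta> where "\<theta> = min 1 (\<epsilon> / (K + C + 1))"
    have pos: "0 < K + C + 1" using K C0 by linarith
    have "\<theta> \<le> \<epsilon> / (K + C + 1)" unfolding \<theta>_def by simp
    with pos have "\<theta> * (K + C + 1) \<le> \<epsilon>" by (simp add: pos_le_divide_eq)
    moreover have "0 < \<theta>" "\<theta> \<le> 1" using \<epsilon> pos by (auto simp: \<theta>_def)
    ultimately have \<theta>: "0 < \<theta>" "\<theta> \<le> 1" "\<theta> * (K + C + 1) \<le> \<epsilon>" by auto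
    have \<theta>2: "0 < \<theta>\<^sup>2" "\<theta>\<^sup>2 \<le> 1" "sqrt (\<theta>\<^sup>2) = \<theta>" using \<theta> by (auto simp: power_le_one)
    obtain e where e: "e \<in> W_span"
      and d: "expectation (\<lambda>\<omega>. (R0 \<omega> - e \<omega>)\<^sup>2) \<le> expectation (\<lambda>\<omega>. (R0 \<omega>)\<^sup>2) + \<theta>\<^sup>2"
      and near: "\<And>w. w \<in> W_span \<Longrightarrow>
        \<bar>expectation (\<lambda>\<omega>. (R0 \<omega> - e \<omega>) * w \<omega>)\<bar> \<le> \<theta> * sqrt (expectation (\<lambda>\<omega>. (w \<omega>)\<^sup>2))"
      by (rule nearly_orthogonal_residual[OF R0 \<theta>2(1), unfolded \<theta>2(3)]) blast
    define q where "q \<omega> = R0 \<omega> - e \<omega>" for \<omega>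
    note esq = W_span_square_integrable[OF e]
    have qsq: "square_integrable M q"
      unfolding q_def[abs_def] by (rule square_integrable_diff[OF R0 esq])
    have Eq: "expectation q = 0"
      unfolding q_def[abs_def]
      using square_integrable_integrable[OF R0] square_integrable_integrable[OF esq]
      by (simp add: W_span_mean[OF e] meanR0)
    have E1: "\<bar>expectation (\<lambda>\<omega>. q \<omega> * R \<omega>)\<bar> \<le> K * \<theta>"
      by (rule dual[OF qsq Eq]) (use \<theta> near in \<open>auto simp: q_def\<close>)
    have "expectation (\<lambda>\<omega>. (e \<omega>)\<^sup>2) = expectation (\<lambda>\<omega>. (norm (R0 \<omega> + (- 1) *\<^sub>R q \<omega>))\<^sup>2)"
      by (simp add: q_def)
    also have "\<dots> \<le> 2 * expectation (\<lambda>\<omega>. (norm (R0 \<omega>))\<^sup>2) + 2 * expectation (\<lambda>\<omega>. (norm ((- 1) *\<^sub>R q \<omega>))\<^sup>2)"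
      by (rule expectation_norm_sq_add_le[OF R0 square_integrable_scaleR[OF qsq]])
    also have "\<dots> \<le> 4 * expectation (\<lambda>\<omega>. (R0 \<omega>)\<^sup>2) + 2"
      using d[folded q_def] \<theta>2 by simp
    finally have "sqrt (expectation (\<lambda>\<omega>. (e \<omega>)\<^sup>2)) \<le> C" unfolding C_def by simp
    then have "\<theta> * sqrt (expectation (\<lambda>\<omega>. (e \<omega>)\<^sup>2)) \<le> \<theta> * C" using \<theta> by simp
    with near[OF e] have E2: "\<bar>expectation (\<lambda>\<omega>. q \<omega> * e \<omega>)\<bar> \<le> \<theta> * C" by (simp add: q_def)
    \<comment> \<open>One factor \<open>q\<close> is replaced by
      \<open>R - expectation R - e\<close>. The three terms are controlled by the duality
      hypothesis, by the zero mean of \<open>q\<close>, and by near orthogonality to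
      \<open>e\<close> itself.\<close>
    have "(q \<omega>)\<^sup>2 = q \<omega> * R \<omega> - expectation R * q \<omega> - q \<omega> * e \<omega>" for \<omega>
      by (simp add: q_def R0_def power2_eq_square algebra_simps)
    then have "expectation (\<lambda>\<omega>. (q \<omega>)\<^sup>2) = expectation (\<lambda>\<omega>. q \<omega> * R \<omega>) - expectation (\<lambda>\<omega>. q \<omega> * e \<omega>)"
      using square_integrable_product[OF qsq R] square_integrable_product[OF qsq esq]
        square_integrable_integrable[OF qsq] Eq by simp
    also have "\<dots> \<le> K * \<theta> + \<theta> * C" using E1 E2 by linarith
    also have "\<dots> < \<theta> * (K + C + 1)" using \<theta> by (simp add: algebra_simps)
    also have "\<dots> \<le> \<epsilon>" by (rule \<theta>(3))
    finally show ?thesis using e by (auto simp: q_def)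
  qed
  then show ?thesis using R0 by (simp add: gaussian_space_def R0_def[abs_def])
qed

end

section \<open>Mean-field dynamics\<close>

lemma square_integrable_snd_component:
  assumes "finite_measure N" "finite_measure M" and q: "square_integrable M q"
  shows "square_integrable (N \<Otimes>\<^sub>M M) (\<lambda>(s, \<omega>). q \<omega>)"
proof -
  interpret N: finite_measure N by fact
  interpret M: finite_measure M by fact
  interpret P: pair_sigma_finite N M ..
  have [measurable]: "q \<in> borel_measurable M" using q by (simp add: square_integrable_def)
  have "(\<integral>\<^sup>+x. ennreal ((norm (q (snd x)))\<^sup>2) \<partial>(N \<Otimes>\<^sub>M M)) = (\<integral>\<^sup>+s. \<integral>\<^sup>+\<omega>. ennreal ((norm (q \<omega>))\<^sup>2) \<partial>M \<partial>N)"
    by (subst M.nn_integral_fst[symmetric]) auto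
  also have "\<dots> = ennreal (\<integral>\<omega>. (norm (q \<omega>))\<^sup>2 \<partial>M) * emeasure N (space N)"
    using nn_integral_eq_integral[OF square_integrable_norm_sq[OF q]] by simp
  also have "\<dots> < \<infinity>"
    by (simp add: less_top[symmetric] ennreal_mult_eq_top_iff)
  finally have "integrable (N \<Otimes>\<^sub>M M) (\<lambda>x. (norm (q (snd x)))\<^sup>2)"
    by (intro integrableI_nonneg) auto
  then show ?thesis by (simp add: square_integrable_def case_prod_beta')
qed

text \<open>Cauchy-Schwarz against the constant 1 in the first variable, for almost every
  \<open>\<omega>\<close>, followed by Fubini. The factor \<open>measure N (space N)\<close> is the
  squared norm of that constant.\<close>

lemma square_integrable_integral_fst:
  fixes Z :: "'b \<Rightarrow> 'c \<Rightarrow> 'a::euclidean_space"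
  assumes "finite_measure N" "finite_measure M" and Z: "square_integrable (N \<Otimes>\<^sub>M M) (\<lambda>(s, \<omega>). Z s \<omega>)"
  shows "square_integrable M (\<lambda>\<omega>. \<integral>s. Z s \<omega> \<partial>N)"
    and "(\<integral>\<omega>. (norm (\<integral>s. Z s \<omega> \<partial>N))\<^sup>2 \<partial>M)
      \<le> measure N (space N) * (\<integral>s. \<integral>\<omega>. (norm (Z s \<omega>))\<^sup>2 \<partial>M \<partial>N)"
proof -
  interpret N: finite_measure N by fact
  interpret M: finite_measure M by fact
  interpret P: pair_sigma_finite N M ..
  have ZM[measurable]: "(\<lambda>(s, \<omega>). Z s \<omega>) \<in> borel_measurable (N \<Otimes>\<^sub>M M)"
    using Z by (simp add: square_integrable_def)
  have Zint: "integrable (N \<Otimes>\<^sub>M M) (\<lambda>(s, \<omega>). (norm (Z s \<omega>))\<^sup>2)"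
    using square_integrable_norm_sq[OF Z] by (simp add: case_prod_beta')
  have meas: "(\<lambda>\<omega>. \<integral>s. Z s \<omega> \<partial>N) \<in> borel_measurable M"
    by (rule N.borel_measurable_lebesgue_integral) (use measurable_compose[OF measurable_pair_swap' ZM] in \<open>simp add: case_prod_beta'\<close>)
  let ?c = "measure N (space N)"
  have "AE \<omega> in M. (norm (\<integral>s. Z s \<omega> \<partial>N))\<^sup>2 \<le> ?c * (\<integral>s. (norm (Z s \<omega>))\<^sup>2 \<partial>N)"
    using P.AE_integrable_snd[OF Zint] AE_space
  proof eventually_elim
    fix \<omega> assume int: "integrable N (\<lambda>s. (norm (Z s \<omega>))\<^sup>2)" and \<omega>: "\<omega> \<in> space M"
    have "(\<lambda>s. (s, \<omega>)) \<in> measurable N (N \<Otimes>\<^sub>M M)" using \<omega> by simp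
    from measurable_compose[OF this ZM] have [measurable]: "(\<lambda>s. Z s \<omega>) \<in> borel_measurable N" by simp
    have sq: "square_integrable N (\<lambda>s. norm (Z s \<omega>))"
      using int by (simp add: square_integrable_def)
    have "norm (\<integral>s. Z s \<omega> \<partial>N) \<le> (\<integral>s. norm (Z s \<omega>) * 1 \<partial>N)"
      using integral_norm_bound[of N "\<lambda>s. Z s \<omega>"] by simp
    then have "(norm (\<integral>s. Z s \<omega> \<partial>N))\<^sup>2 \<le> (\<integral>s. norm (Z s \<omega>) * 1 \<partial>N)\<^sup>2"
      by (rule power_mono) simp
    also have "\<dots> \<le> (\<integral>s. (norm (Z s \<omega>))\<^sup>2 \<partial>N) * (\<integral>s. 1\<^sup>2 \<partial>N)"
      by (rule integral_Cauchy_Schwarz[OF sq N.square_integrable_const])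
    finally show "(norm (\<integral>s. Z s \<omega> \<partial>N))\<^sup>2 \<le> ?c * (\<integral>s. (norm (Z s \<omega>))\<^sup>2 \<partial>N)"
      by (simp add: mult.commute)
  qed
  note le = this
  then have bd: "AE \<omega> in M. norm ((norm (\<integral>s. Z s \<omega> \<partial>N))\<^sup>2) \<le> norm (?c * (\<integral>s. (norm (Z s \<omega>))\<^sup>2 \<partial>N))"
    by eventually_elim (simp add: abs_mult)
  have rhs: "integrable M (\<lambda>\<omega>. ?c * (\<integral>s. (norm (Z s \<omega>))\<^sup>2 \<partial>N))"
    using P.integrable_snd[OF Zint] by simp
  then have lhs: "integrable M (\<lambda>\<omega>. (norm (\<integral>s. Z s \<omega> \<partial>N))\<^sup>2)"
    by (rule Bochner_Integration.integrable_bound[OF _ _ bd]) (use meas in measurable)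
  with meas show "square_integrable M (\<lambda>\<omega>. \<integral>s. Z s \<omega> \<partial>N)" by (simp add: square_integrable_def)
  show "(\<integral>\<omega>. (norm (\<integral>s. Z s \<omega> \<partial>N))\<^sup>2 \<partial>M) \<le> ?c * (\<integral>s. \<integral>\<omega>. (norm (Z s \<omega>))\<^sup>2 \<partial>M \<partial>N)"
    using integral_mono_AE[OF lhs rhs le] P.Fubini_integral[OF Zint] by simp
qed

lemma product_square_integrableI:
  assumes "finite_measure N" "finite_measure M"
    and Z: "(\<lambda>(s, \<omega>). Z s \<omega>) \<in> borel_measurable (N \<Otimes>\<^sub>M M)"
    and sq: "\<And>s. s \<in> space N \<Longrightarrow> square_integrable M (Z s)"
    and le: "\<And>s. s \<in> space N \<Longrightarrow> (\<integral>\<omega>. (norm (Z s \<omega>))\<^sup>2 \<partial>M) \<le> K"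
  shows "square_integrable (N \<Otimes>\<^sub>M M) (\<lambda>(s, \<omega>). Z s \<omega>)"
proof -
  interpret N: finite_measure N by fact
  interpret M: finite_measure M by fact
  have ZM[measurable]: "(\<lambda>z. Z (fst z) (snd z)) \<in> borel_measurable (N \<Otimes>\<^sub>M M)"
    using Z by (simp add: case_prod_beta')
  have "(\<integral>\<^sup>+z. ennreal ((norm (Z (fst z) (snd z)))\<^sup>2) \<partial>(N \<Otimes>\<^sub>M M))
      = (\<integral>\<^sup>+s. \<integral>\<^sup>+\<omega>. ennreal ((norm (Z s \<omega>))\<^sup>2) \<partial>M \<partial>N)"
    by (subst M.nn_integral_fst[symmetric]) auto
  also have "\<dots> \<le> (\<integral>\<^sup>+s. ennreal K \<partial>N)"
  proof (rule nn_integral_mono)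
    fix s assume s: "s \<in> space N"
    show "(\<integral>\<^sup>+\<omega>. ennreal ((norm (Z s \<omega>))\<^sup>2) \<partial>M) \<le> ennreal K"
      using nn_integral_eq_integral[OF square_integrable_norm_sq[OF sq[OF s]]] le[OF s]
      by (simp add: ennreal_leI)
  qed
  also have "\<dots> < \<infinity>"
    by (simp add: ennreal_mult_eq_top_iff less_top[symmetric])
  finally have "integrable (N \<Otimes>\<^sub>M M) (\<lambda>z. (norm (Z (fst z) (snd z)))\<^sup>2)"
    by (intro integrableI_nonneg) auto
  with ZM show ?thesis by (simp add: square_integrable_def case_prod_beta')
qed

text \<open>Integrals up to a variable time \<open>t\<close> become integrals against one fixed
  finite measure on the whole horizon, so that a single product measure serves every use of
  Fubini.\<close>

lemma set_lebesgue_integral_restrict: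
  fixes f :: "real \<Rightarrow> 'a::euclidean_space"
  assumes "t \<le> T"
  shows "(LINT s:{0..t}|lborel. f s) = (\<integral>s. indicator {0..t} s *\<^sub>R f s \<partial>restrict_space lborel {0..T})"
proof -
  have *: "(indicator {0..T} s :: real) * indicator {0..t} s = indicator {0..t} s" for s
    using assms by (auto split: split_indicator)
  show ?thesis
    unfolding set_lebesgue_integral_def by (subst integral_restrict_space) (simp_all add: *)
qed

section \<open>Bounds for Ito integrals of deterministic integrands\<close>

context brownian_setup begin

text \<open>One factor 2 is spent comparing \<open>Y\<close> with a simple integral and another
  comparing the simple process with \<open>h\<close>, whence \<open>4 * L\<close>. With both errors
  below \<open>\<epsilon> / 6\<close>, the remainders add up to
  \<open>2 * (\<epsilon> / 6) + 2 * (\<epsilon> / 3) = \<epsilon>\<close>. For \<open>L = 0\<close>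
  the bound forces \<open>Y\<close> to vanish almost everywhere.\<close>

lemma ito_integral_norm_bound:
  fixes h :: "real \<Rightarrow> 'a::euclidean_space"
  assumes Y: "is_ito_integral M F W t (\<lambda>s \<omega>. h s) Y" and t: "0 \<le> t"
    and L: "(\<integral>\<^sup>+s. ennreal ((norm (h s))\<^sup>2) \<partial>restrict_space lborel {0..t}) \<le> ennreal L" "0 \<le> L"
  shows "expectation (\<lambda>\<omega>. (norm (Y \<omega>))\<^sup>2) \<le> 4 * L"
proof (rule field_le_epsilon)
  fix \<epsilon> :: real assume \<epsilon>: "0 < \<epsilon>"
  let ?L = "restrict_space lborel {0..t}"
  interpret L: sigma_finite_measure ?L by (rule interval_sigma_finite)
  interpret LM: pair_sigma_finite ?L M ..
  obtain N p \<xi> where S: "is_simple M F t N p \<xi>"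
    and 1: "(\<integral>\<^sup>+(s, \<omega>). ennreal ((norm (h s - simple_process N p \<xi> s \<omega>))\<^sup>2) \<partial>(?L \<Otimes>\<^sub>M M)) < ennreal (\<epsilon> / 6)"
    and 2: "(\<integral>\<^sup>+\<omega>. ennreal ((norm (Y \<omega> - simple_integral W N p \<xi> \<omega>))\<^sup>2) \<partial>M) < ennreal (\<epsilon> / 6)"
    by (rule is_ito_integral_approx[OF Y, of "\<epsilon> / 6"]) (use \<epsilon> in simp_all)
  have hM: "(\<lambda>(s, \<omega>). h s) \<in> borel_measurable (?L \<Otimes>\<^sub>M M)"
    using Y t by (intro progressive_measurable) (auto simp: is_ito_integral_def L2_processes_def)
  note \<xi>M = simple_process_measurable[OF S]
  have m1: "(\<lambda>x. ennreal ((norm (h (fst x)))\<^sup>2)) \<in> borel_measurable (?L \<Otimes>\<^sub>M M)"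
    using hM by (simp add: case_prod_beta')
  have m2: "(\<lambda>x. ennreal ((norm (h (fst x) - simple_process N p \<xi> (fst x) (snd x)))\<^sup>2)) \<in> borel_measurable (?L \<Otimes>\<^sub>M M)"
    using borel_measurable_diff[OF hM \<xi>M] by (simp add: case_prod_beta')
  have m3: "(\<lambda>x. ennreal ((norm (simple_process N p \<xi> (fst x) (snd x)))\<^sup>2)) \<in> borel_measurable (?L \<Otimes>\<^sub>M M)"
    using \<xi>M by (simp add: case_prod_beta')
  have h: "(\<integral>\<^sup>+x. ennreal ((norm (h (fst x)))\<^sup>2) \<partial>(?L \<Otimes>\<^sub>M M)) \<le> ennreal L"
    using L(1) m1 by (subst nn_integral_fst[symmetric]) (auto simp: emeasure_space_1)
  have "(\<integral>\<^sup>+\<omega>. ennreal ((norm (simple_integral W N p \<xi> \<omega>))\<^sup>2) \<partial>M)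
    = (\<integral>\<^sup>+x. ennreal ((norm (simple_process N p \<xi> (fst x) (snd x)))\<^sup>2) \<partial>(?L \<Otimes>\<^sub>M M))"
    unfolding simple_process_isometry[OF S] using m3 by (subst nn_integral_fst[symmetric]) auto
  also have "\<dots> \<le> (\<integral>\<^sup>+x. 2 * ennreal ((norm (h (fst x)))\<^sup>2)
      + 2 * ennreal ((norm (h (fst x) - simple_process N p \<xi> (fst x) (snd x)))\<^sup>2) \<partial>(?L \<Otimes>\<^sub>M M))"
  proof (rule nn_integral_mono)
    fix x
    have "(norm (simple_process N p \<xi> (fst x) (snd x)))\<^sup>2
        \<le> 2 * (norm (h (fst x)))\<^sup>2 + 2 * (norm (h (fst x) - simple_process N p \<xi> (fst x) (snd x)))\<^sup>2"
      using norm_add_sq_le[of "h (fst x)" "simple_process N p \<xi> (fst x) (snd x) - h (fst x)"]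
      by (simp add: norm_minus_commute)
    from ennreal_leI[OF this]
    show "ennreal ((norm (simple_process N p \<xi> (fst x) (snd x)))\<^sup>2) \<le> 2 * ennreal ((norm (h (fst x)))\<^sup>2)
      + 2 * ennreal ((norm (h (fst x) - simple_process N p \<xi> (fst x) (snd x)))\<^sup>2)"
      by (simp add: ennreal_plus ennreal_mult)
  qed
  also have "\<dots> = 2 * (\<integral>\<^sup>+x. ennreal ((norm (h (fst x)))\<^sup>2) \<partial>(?L \<Otimes>\<^sub>M M))
      + 2 * (\<integral>\<^sup>+x. ennreal ((norm (h (fst x) - simple_process N p \<xi> (fst x) (snd x)))\<^sup>2) \<partial>(?L \<Otimes>\<^sub>M M))"
    using m1 m2 by (subst nn_integral_add) (auto simp: nn_integral_cmult)
  also have "\<dots> \<le> 2 * ennreal L + 2 * ennreal (\<epsilon> / 6)"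
    using h 1 by (intro add_mono mult_left_mono) (auto simp: case_prod_beta' less_imp_le)
  also have "\<dots> = ennreal (2 * L + \<epsilon> / 3)"
  proof -
    have "2 * ennreal L = ennreal (2 * L)" "2 * ennreal (\<epsilon> / 6) = ennreal (\<epsilon> / 3)"
      using ennreal_mult'[of 2 L] ennreal_mult'[of 2 "\<epsilon> / 6"] by simp_all
    then show ?thesis using L(2) \<epsilon> by (simp add: ennreal_plus)
  qed
  finally have I: "(\<integral>\<^sup>+\<omega>. ennreal ((norm (simple_integral W N p \<xi> \<omega>))\<^sup>2) \<partial>M) \<le> ennreal (2 * L + \<epsilon> / 3)" .
  note Isq = simple_integral_isometry(1)[OF S]
  have EI: "expectation (\<lambda>\<omega>. (norm (simple_integral W N p \<xi> \<omega>))\<^sup>2) \<le> 2 * L + \<epsilon> / 3"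
    using I nn_integral_eq_integral[OF square_integrable_norm_sq[OF Isq]] L(2) \<epsilon> by (simp del: ennreal_plus)
  have D: "square_integrable M (\<lambda>\<omega>. Y \<omega> - simple_integral W N p \<xi> \<omega>)"
    by (intro square_integrable_diff ito_integral_square_integrable[OF Y] Isq)
  have ED: "expectation (\<lambda>\<omega>. (norm (Y \<omega> - simple_integral W N p \<xi> \<omega>))\<^sup>2) < \<epsilon> / 6"
    by (rule square_integrable_nn_integral(2)[OF _ 2]) (use D in \<open>simp add: square_integrable_def\<close>)
  have "expectation (\<lambda>\<omega>. (norm (Y \<omega>))\<^sup>2)
      = expectation (\<lambda>\<omega>. (norm ((Y \<omega> - simple_integral W N p \<xi> \<omega>) + simple_integral W N p \<xi> \<omega>))\<^sup>2)"
    by simp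
  also have "\<dots> \<le> 2 * expectation (\<lambda>\<omega>. (norm (Y \<omega> - simple_integral W N p \<xi> \<omega>))\<^sup>2)
      + 2 * expectation (\<lambda>\<omega>. (norm (simple_integral W N p \<xi> \<omega>))\<^sup>2)"
    by (rule expectation_norm_sq_add_le[OF D Isq])
  also have "\<dots> \<le> 4 * L + \<epsilon>" using EI ED by linarith
  finally show "expectation (\<lambda>\<omega>. (norm (Y \<omega>))\<^sup>2) \<le> 4 * L + \<epsilon>" .
qed

text \<open>Each coordinate of \<open>Y\<close> is a mean-square limit of elements of
  \<open>W_span\<close>, so near orthogonality of \<open>q\<close> passes from the span to
  \<open>Y\<close>. The dimension enters when the norm is bounded by the sum of the
  coordinates.\<close>

lemma ito_integral_dual_bound:
  fixes h :: "real \<Rightarrow> 'a::euclidean_space"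
  assumes Y: "is_ito_integral M F W t (\<lambda>s \<omega>. h s) Y" and t: "0 \<le> t"
    and L: "expectation (\<lambda>\<omega>. (norm (Y \<omega>))\<^sup>2) \<le> L"
    and q: "square_integrable M q" and \<epsilon>: "0 \<le> \<epsilon>"
    and near: "\<And>w. w \<in> W_span \<Longrightarrow> \<bar>expectation (\<lambda>\<omega>. q \<omega> * w \<omega>)\<bar> \<le> \<epsilon> * sqrt (expectation (\<lambda>\<omega>. (w \<omega>)\<^sup>2))"
  shows "norm (expectation (\<lambda>\<omega>. q \<omega> *\<^sub>R Y \<omega>)) \<le> real DIM('a) * sqrt (2 * L + 2) * \<epsilon>"
proof -
  note Ysq = ito_integral_square_integrable[OF Y]
  have "\<bar>expectation (\<lambda>\<omega>. q \<omega> * (b \<bullet> Y \<omega>))\<bar> \<le> sqrt (2 * L + 2) * \<epsilon>" if b: "b \<in> Basis" for b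
  proof (rule field_le_epsilon)
    fix \<eta> :: real assume \<eta>: "0 < \<eta>"
    define Q where "Q = sqrt (expectation (\<lambda>\<omega>. (q \<omega>)\<^sup>2))"
    have Q0: "0 \<le> Q" by (simp add: Q_def)
    \<comment> \<open>Replacing a coordinate of \<open>Y\<close> by an element of the span costs at
      most \<open>Q * \<theta>\<close>, which is kept below \<eta>. The cap
      \<open>\<theta> \<le> 1\<close> bounds the second moment of that element by
      \<open>2 * L + 2\<close>, independently of \<eta>.\<close>
    define \<theta> where "\<theta> = min 1 (\<eta> / (Q + 1))"
    have "\<theta> \<le> \<eta> / (Q + 1)" by (simp add: \<theta>_def)
    then have "\<theta> * (Q + 1) \<le> \<eta>" using Q0 by (simp add: pos_le_divide_eq)
    moreover have \<theta>: "0 < \<theta>" "\<theta> \<le> 1" using \<eta> Q0 by (auto simp: \<theta>_def)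
    ultimately have Q\<theta>: "Q * \<theta> \<le> \<eta>" by (simp add: algebra_simps)
    have \<theta>2: "0 < \<theta>\<^sup>2" "\<theta>\<^sup>2 \<le> 1" "sqrt (\<theta>\<^sup>2) = \<theta>" using \<theta> by (auto simp: power_le_one)
    obtain N p c where S: "is_simple M F t N p (\<lambda>i \<omega>. c i)"
      and Isq: "square_integrable M (simple_integral W N p (\<lambda>i \<omega>. c i))"
      and app: "expectation (\<lambda>\<omega>. (norm (Y \<omega> - simple_integral W N p (\<lambda>i \<omega>. c i) \<omega>))\<^sup>2) < \<theta>\<^sup>2"
      by (rule ito_integral_deterministic_approx[OF Y t \<theta>2(1)])
    define w where "w \<omega> = b \<bullet> simple_integral W N p (\<lambda>i \<omega>. c i) \<omega>" for \<omega>
    have "w = (\<lambda>\<omega>. \<Sum>i<N. (b \<bullet> c i) * (W (p (Suc i)) \<omega> + (-1) * W (p i) \<omega>))"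
      by (rule ext) (simp add: w_def simple_integral_def inner_sum_right mult.commute)
    also have "\<dots> \<in> W_span"
      by (intro W_span_sum W_span_scale W_span_add W_in_W_span) (use is_simple_bounds[OF S] in auto)
    finally have w: "w \<in> W_span" .
    have wsq: "square_integrable M w" by (rule W_span_square_integrable[OF w])
    have Dsq: "square_integrable M (\<lambda>\<omega>. Y \<omega> - simple_integral W N p (\<lambda>i \<omega>. c i) \<omega>)"
      by (rule square_integrable_diff[OF Ysq Isq])
    have bY: "square_integrable M (\<lambda>\<omega>. b \<bullet> Y \<omega>)" by (rule square_integrable_inner[OF Ysq])
    have dsq: "square_integrable M (\<lambda>\<omega>. b \<bullet> Y \<omega> - w \<omega>)" by (rule square_integrable_diff[OF bY wsq])
    have le: "(b \<bullet> z)\<^sup>2 \<le> (norm z)\<^sup>2" for z :: 'a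
      using norm_nth_le[OF b, of z] by (simp add: inner_commute power2_le_iff_abs_le)
    have d: "expectation (\<lambda>\<omega>. (b \<bullet> Y \<omega> - w \<omega>)\<^sup>2) \<le> \<theta>\<^sup>2"
    proof -
      have "expectation (\<lambda>\<omega>. (b \<bullet> Y \<omega> - w \<omega>)\<^sup>2)
          \<le> expectation (\<lambda>\<omega>. (norm (Y \<omega> - simple_integral W N p (\<lambda>i \<omega>. c i) \<omega>))\<^sup>2)"
        using le by (intro integral_mono square_integrable_real_sq[OF dsq] square_integrable_norm_sq[OF Dsq])
          (auto simp: w_def inner_diff_right[symmetric])
      with app show ?thesis by simp
    qed
    have bYL: "expectation (\<lambda>\<omega>. (b \<bullet> Y \<omega>)\<^sup>2) \<le> L"
      using integral_mono[OF square_integrable_real_sq[OF bY] square_integrable_norm_sq[OF Ysq] le] L by simp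
    have "expectation (\<lambda>\<omega>. (w \<omega>)\<^sup>2) = expectation (\<lambda>\<omega>. (norm (b \<bullet> Y \<omega> + (-1) *\<^sub>R (b \<bullet> Y \<omega> - w \<omega>)))\<^sup>2)"
      by simp
    also have "\<dots> \<le> 2 * expectation (\<lambda>\<omega>. (norm (b \<bullet> Y \<omega>))\<^sup>2)
        + 2 * expectation (\<lambda>\<omega>. (norm ((-1) *\<^sub>R (b \<bullet> Y \<omega> - w \<omega>)))\<^sup>2)"
      by (rule expectation_norm_sq_add_le[OF bY square_integrable_scaleR[OF dsq]])
    also have "\<dots> = 2 * expectation (\<lambda>\<omega>. (b \<bullet> Y \<omega>)\<^sup>2) + 2 * expectation (\<lambda>\<omega>. (b \<bullet> Y \<omega> - w \<omega>)\<^sup>2)"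
      unfolding norm_scaleR by simp
    also have "\<dots> \<le> 2 * L + 2" using bYL d \<theta>2 by linarith
    finally have "sqrt (expectation (\<lambda>\<omega>. (w \<omega>)\<^sup>2)) \<le> sqrt (2 * L + 2)" by simp
    with near[OF w] \<epsilon> have E1: "\<bar>expectation (\<lambda>\<omega>. q \<omega> * w \<omega>)\<bar> \<le> \<epsilon> * sqrt (2 * L + 2)"
      by (meson mult_left_mono order_trans)
    have "\<bar>expectation (\<lambda>\<omega>. q \<omega> * (b \<bullet> Y \<omega> - w \<omega>))\<bar>
        \<le> Q * sqrt (expectation (\<lambda>\<omega>. (b \<bullet> Y \<omega> - w \<omega>)\<^sup>2))"
      unfolding Q_def by (rule abs_integral_mult_le[OF q dsq])
    also have "\<dots> \<le> Q * \<theta>"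
      using real_sqrt_le_mono[OF d] Q0 unfolding \<theta>2(3) by (rule mult_left_mono)
    finally have E2: "\<bar>expectation (\<lambda>\<omega>. q \<omega> * (b \<bullet> Y \<omega> - w \<omega>))\<bar> \<le> \<eta>" using Q\<theta> by linarith
    have "expectation (\<lambda>\<omega>. q \<omega> * (b \<bullet> Y \<omega>))
        = expectation (\<lambda>\<omega>. q \<omega> * w \<omega> + q \<omega> * (b \<bullet> Y \<omega> - w \<omega>))"
      by (simp add: algebra_simps)
    also have "\<dots> = expectation (\<lambda>\<omega>. q \<omega> * w \<omega>) + expectation (\<lambda>\<omega>. q \<omega> * (b \<bullet> Y \<omega> - w \<omega>))"
      by (intro Bochner_Integration.integral_add square_integrable_product q wsq dsq)
    finally show "\<bar>expectation (\<lambda>\<omega>. q \<omega> * (b \<bullet> Y \<omega>))\<bar> \<le> sqrt (2 * L + 2) * \<epsilon> + \<eta>"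
      using E1 E2 by (simp add: mult.commute)
  qed
  moreover have "expectation (\<lambda>\<omega>. q \<omega> *\<^sub>R Y \<omega>) \<bullet> b = expectation (\<lambda>\<omega>. q \<omega> * (b \<bullet> Y \<omega>))" for b
    using integral_inner_left[of b M "\<lambda>\<omega>. q \<omega> *\<^sub>R Y \<omega>"] square_integrable_scaleR_product[OF q Ysq]
    by (simp add: inner_commute)
  ultimately have "(\<Sum>b\<in>Basis. \<bar>expectation (\<lambda>\<omega>. q \<omega> *\<^sub>R Y \<omega>) \<bullet> b\<bar>) \<le> (\<Sum>b\<in>(Basis::'a set). sqrt (2 * L + 2) * \<epsilon>)"
    by (intro sum_mono) simp
  then show ?thesis
    using norm_le_l1[of "expectation (\<lambda>\<omega>. q \<omega> *\<^sub>R Y \<omega>)"] by (simp add: mult.assoc)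
qed

section \<open>A fixed solution whose mean-field terms are arbitrary functions
  \<open>\<beta>\<close> and \<open>\<gamma>\<close> of the two means\<close>

context
  fixes T :: real and A :: "'a::euclidean_space \<Rightarrow> 'a" and \<beta> \<gamma> :: "'a \<Rightarrow> 'u::euclidean_space \<Rightarrow> 'a"
    and x :: 'a and u :: "real \<Rightarrow> 'w \<Rightarrow> 'u" and X :: "real \<Rightarrow> 'w \<Rightarrow> 'a"
  assumes T: "0 < T" and A: "linear A"
    and sol: "is_solution M F W T (\<lambda>X m v. A X + \<beta> m v) (\<lambda>X m v. \<gamma> m v) x u X"
begin

abbreviation "drift s \<equiv> \<beta> (expectation (X s)) (expectation (u s))"
abbreviation "diffusion s \<equiv> \<gamma> (expectation (X s)) (expectation (u s))"
abbreviation "horizon \<equiv> restrict_space lborel {0..T}"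

lemma bounded_linear_A: "bounded_linear A"
  using A linear_conv_bounded_linear by blast

lemma X_L2: "X \<in> L2_processes M F T"
  using sol by (simp add: is_solution_def)

lemma X_product_square_integrable: "square_integrable (horizon \<Otimes>\<^sub>M M) (\<lambda>(s, \<omega>). X s \<omega>)"
  by (rule L2_processes_square_integrable[OF X_L2]) (use T in simp)

lemma X_measurable:
  assumes "t \<in> {0..T}"
  shows "X t \<in> borel_measurable M"
proof -
  have "(\<lambda>\<omega>. (t, \<omega>)) \<in> measurable M (horizon \<Otimes>\<^sub>M M)"
    using assms by (intro measurable_Pair1') (simp add: space_restrict_space)
  from measurable_compose[OF this, of "\<lambda>(s, \<omega>). X s \<omega>" borel] X_product_square_integrable show ?thesis
    by (simp add: square_integrable_def)
qed

text \<open>The equation only provides integrability of the full drift along almost every path. By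
  Fubini the part \<open>A (X s \<omega>)\<close> is integrable for almost every
  \<open>\<omega>\<close>; subtracting it shows the same for the mean-field part, and the integral
  splits.\<close>

lemma solution_decomposition:
  assumes t: "t \<in> {0..T}"
  obtains Y where "is_ito_integral M F W t (\<lambda>s \<omega>. diffusion s) Y"
    "AE \<omega> in M. X t \<omega> = x + (LINT s:{0..t}|lborel. A (X s \<omega>)) + (LINT s:{0..t}|lborel. drift s) + Y \<omega>"
proof -
  interpret L: finite_measure horizon by (rule interval_finite)
  interpret P: pair_sigma_finite horizon M ..
  interpret PF: finite_measure "horizon \<Otimes>\<^sub>M M"
    by (rule finite_measure_pair_measure) unfold_locales
  obtain Y where Y: "is_ito_integral M F W t (\<lambda>s \<omega>. diffusion s) Y"
    and ae: "AE \<omega> in M. set_integrable lborel {0..t} (\<lambda>s. A (X s \<omega>) + drift s) \<and>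
      X t \<omega> = x + (LINT s:{0..t}|lborel. A (X s \<omega>) + drift s) + Y \<omega>"
    using sol t unfolding is_solution_def by blast
  have "integrable (horizon \<Otimes>\<^sub>M M) (\<lambda>(s, \<omega>). X s \<omega>)"
    by (rule PF.square_integrable_integrable[OF X_product_square_integrable])
  from P.AE_integrable_snd[OF this] have "AE \<omega> in M. set_integrable lborel {0..t} (\<lambda>s. A (X s \<omega>))"
  proof eventually_elim
    fix \<omega> assume "integrable horizon (\<lambda>s. X s \<omega>)"
    then have "integrable horizon (\<lambda>s. A (X s \<omega>))"
      by (rule integrable_bounded_linear[OF bounded_linear_A])
    then have "set_integrable lborel {0..T} (\<lambda>s. A (X s \<omega>))"
      by (subst set_integrable_eq) auto
    then show "set_integrable lborel {0..t} (\<lambda>s. A (X s \<omega>))"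
      by (rule set_integrable_subset) (use t in auto)
  qed
  with ae have "AE \<omega> in M. X t \<omega> = x + (LINT s:{0..t}|lborel. A (X s \<omega>)) + (LINT s:{0..t}|lborel. drift s) + Y \<omega>"
  proof eventually_elim
    case (elim \<omega>)
    from set_integral_diff(1)[of lborel "{0..t}" "\<lambda>s. A (X s \<omega>) + drift s" "\<lambda>s. A (X s \<omega>)"] elim
    have "set_integrable lborel {0..t} drift" by simp
    with elim show ?case by (simp add: set_integral_add)
  qed
  with Y that show ?thesis by blast
qed

lemma drift_part_square_integrable:
  assumes t: "t \<in> {0..T}"
  shows "square_integrable M (\<lambda>\<omega>. LINT s:{0..t}|lborel. A (X s \<omega>))"
proof -
  have "t \<le> T" using t by simp
  note eq = set_lebesgue_integral_restrict[OF this]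
  have sq: "square_integrable (horizon \<Otimes>\<^sub>M M) (\<lambda>(s, \<omega>). A (X s \<omega>))"
    using square_integrable_linear[OF bounded_linear_A X_product_square_integrable] by (simp add: case_prod_beta')
  have "(\<lambda>z. indicat_real {0..t} (fst z)) \<in> borel_measurable (horizon \<Otimes>\<^sub>M M)"
    by (rule measurable_compose[OF measurable_fst]) auto
  with sq have "square_integrable (horizon \<Otimes>\<^sub>M M) (\<lambda>(s, \<omega>). indicator {0..t} s *\<^sub>R A (X s \<omega>))"
    by (intro square_integrable_bound[OF square_integrable_norm_sq[OF sq]])
      (auto simp: square_integrable_def case_prod_beta' indicator_def)
  then show ?thesis
    unfolding eq by (rule square_integrable_integral_fst(1)[OF interval_finite finite_measure_axioms])
qed

text \<open>Membership in \<open>L2_processes\<close> controls second moments only for almost every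
  time. The equation extends this to each fixed time, in particular to the terminal one.\<close>

lemma X_square_integrable:
  assumes t: "t \<in> {0..T}"
  shows "square_integrable M (X t)"
proof -
  obtain Y where Y: "is_ito_integral M F W t (\<lambda>s \<omega>. diffusion s) Y"
    and ae: "AE \<omega> in M. X t \<omega> = x + (LINT s:{0..t}|lborel. A (X s \<omega>)) + (LINT s:{0..t}|lborel. drift s) + Y \<omega>"
    by (rule solution_decomposition[OF t])
  have sq: "square_integrable M (\<lambda>\<omega>. x + (LINT s:{0..t}|lborel. A (X s \<omega>)) + (LINT s:{0..t}|lborel. drift s) + Y \<omega>)"
    by (intro square_integrable_add square_integrable_const drift_part_square_integrable[OF t]
        ito_integral_square_integrable[OF Y])
  have "integrable M (\<lambda>\<omega>. (norm (X t \<omega>))\<^sup>2)"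
    using square_integrable_norm_sq[OF sq]
  proof (rule integrable_cong_AE_imp)
    show "(\<lambda>\<omega>. (norm (X t \<omega>))\<^sup>2) \<in> borel_measurable M" using X_measurable[OF t] by measurable
    show "AE \<omega> in M. (norm (x + (LINT s:{0..t}|lborel. A (X s \<omega>)) + (LINT s:{0..t}|lborel. drift s) + Y \<omega>))\<^sup>2
        = (norm (X t \<omega>))\<^sup>2"
      using ae by eventually_elim simp
  qed
  then show ?thesis using X_measurable[OF t] by (simp add: square_integrable_def)
qed

text \<open>The expectation of \<open>q\<close> times the solution satisfies a linear integral
  equation up to an error \<epsilon> coming from the stochastic integrals. Gronwall turns that error
  into a bound at \<open>T\<close> that is still linear in \<epsilon>.\<close>

lemma solution_dual_bound:
  assumes q: "square_integrable M q" and Eq: "expectation q = 0" and \<epsilon>: "0 \<le> \<epsilon>"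
    and near: "\<And>t Y. t \<in> {0..T} \<Longrightarrow> is_ito_integral M F W t (\<lambda>s \<omega>. diffusion s) Y \<Longrightarrow>
      norm (expectation (\<lambda>\<omega>. q \<omega> *\<^sub>R Y \<omega>)) \<le> \<epsilon>"
  shows "norm (expectation (\<lambda>\<omega>. q \<omega> *\<^sub>R X T \<omega>)) \<le> 2 * \<epsilon> * exp (2 * (onorm A + 1) * T)"
proof -
  interpret L: finite_measure horizon by (rule interval_finite)
  interpret P: pair_sigma_finite horizon M ..
  interpret A: bounded_linear A by (rule bounded_linear_A)
  define f where "f t = expectation (\<lambda>\<omega>. q \<omega> *\<^sub>R X t \<omega>)" for t
  have qX: "integrable M (\<lambda>\<omega>. q \<omega> *\<^sub>R X t \<omega>)" if "t \<in> {0..T}" for t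
    by (rule square_integrable_scaleR_product[OF q X_square_integrable[OF that]])
  have qsq: "square_integrable (horizon \<Otimes>\<^sub>M M) (\<lambda>(s, \<omega>). q \<omega>)"
    by (rule square_integrable_snd_component[OF interval_finite finite_measure_axioms q])
  have qXP: "integrable (horizon \<Otimes>\<^sub>M M) (\<lambda>(s, \<omega>). q \<omega> *\<^sub>R X s \<omega>)"
    using square_integrable_scaleR_product[OF qsq X_product_square_integrable] by (simp add: case_prod_beta')
  have fint: "set_integrable lborel {0..T} f"
    using P.integrable_fst[OF qXP] unfolding f_def by (subst set_integrable_eq) auto
  \<comment> \<open>The summand 1 keeps the Gronwall constant positive even when \<open>A\<close> is
    zero.\<close>
  have f_le: "norm (f t) \<le> \<epsilon> + (onorm A + 1) * (LINT s:{0..t}|lborel. norm (f s))" if t: "t \<in> {0..T}" for t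
  proof -
    have tT: "t \<le> T" using t by simp
    obtain Y where Y: "is_ito_integral M F W t (\<lambda>s \<omega>. diffusion s) Y"
      and ae: "AE \<omega> in M. X t \<omega> = x + (LINT s:{0..t}|lborel. A (X s \<omega>)) + (LINT s:{0..t}|lborel. drift s) + Y \<omega>"
      by (rule solution_decomposition[OF t])
    define I where "I \<omega> = (LINT s:{0..t}|lborel. A (X s \<omega>))" for \<omega>
    define c where "c = x + (LINT s:{0..t}|lborel. drift s)"
    have Isq: "square_integrable M I" unfolding I_def[abs_def] by (rule drift_part_square_integrable[OF t])
    note Ysq = ito_integral_square_integrable[OF Y]
    have qI: "integrable M (\<lambda>\<omega>. q \<omega> *\<^sub>R I \<omega>)" and qY: "integrable M (\<lambda>\<omega>. q \<omega> *\<^sub>R Y \<omega>)"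
      by (intro square_integrable_scaleR_product q Isq Ysq)+
    have qc: "integrable M (\<lambda>\<omega>. q \<omega> *\<^sub>R c)" using square_integrable_integrable[OF q] by simp
    have "f t = expectation (\<lambda>\<omega>. q \<omega> *\<^sub>R c + q \<omega> *\<^sub>R I \<omega> + q \<omega> *\<^sub>R Y \<omega>)"
      unfolding f_def
    proof (rule integral_cong_AE)
      show "AE \<omega> in M. q \<omega> *\<^sub>R X t \<omega> = q \<omega> *\<^sub>R c + q \<omega> *\<^sub>R I \<omega> + q \<omega> *\<^sub>R Y \<omega>"
        using ae by eventually_elim (simp add: c_def I_def algebra_simps)
    qed (use qX[OF t] qI qY qc in auto)
    also have "\<dots> = expectation (\<lambda>\<omega>. q \<omega> *\<^sub>R c) + expectation (\<lambda>\<omega>. q \<omega> *\<^sub>R I \<omega>) + expectation (\<lambda>\<omega>. q \<omega> *\<^sub>R Y \<omega>)"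
      using qc qI qY by simp
    \<comment> \<open>The initial value and the integrated mean-field drift are deterministic, so
      they disappear against the centred \<open>q\<close>.\<close>
    also have "expectation (\<lambda>\<omega>. q \<omega> *\<^sub>R c) = 0"
      using square_integrable_integrable[OF q] by (simp add: Eq)
    also have "expectation (\<lambda>\<omega>. q \<omega> *\<^sub>R I \<omega>) = (LINT s:{0..t}|lborel. A (f s))"
    proof -
      have "(\<lambda>z. indicat_real {0..t} (fst z)) \<in> borel_measurable (horizon \<Otimes>\<^sub>M M)"
        by (rule measurable_compose[OF measurable_fst]) auto
      from borel_measurable_scaleR[OF this borel_measurable_integrable[OF integrable_bounded_linear[OF bounded_linear_A qXP]]]
      have int: "integrable (horizon \<Otimes>\<^sub>M M) (\<lambda>(s, \<omega>). indicator {0..t} s *\<^sub>R A (q \<omega> *\<^sub>R X s \<omega>))"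
        by (intro Bochner_Integration.integrable_bound[OF integrable_bounded_linear[OF bounded_linear_A qXP]])
          (auto simp: case_prod_beta' split: split_indicator)
      have "expectation (\<lambda>\<omega>. q \<omega> *\<^sub>R I \<omega>)
          = expectation (\<lambda>\<omega>. \<integral>s. indicator {0..t} s *\<^sub>R A (q \<omega> *\<^sub>R X s \<omega>) \<partial>horizon)"
        unfolding I_def set_lebesgue_integral_restrict[OF tT]
        by (simp add: A.scaleR mult.commute flip: integral_scaleR_right)
      also have "\<dots> = (\<integral>s. expectation (\<lambda>\<omega>. indicator {0..t} s *\<^sub>R A (q \<omega> *\<^sub>R X s \<omega>)) \<partial>horizon)"
        by (rule P.Fubini_integral[OF int])
      also have "\<dots> = (\<integral>s. indicator {0..t} s *\<^sub>R A (f s) \<partial>horizon)"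
      proof (rule Bochner_Integration.integral_cong)
        fix s assume "s \<in> space horizon"
        then have "s \<in> {0..T}" by (simp add: space_restrict_space)
        then show "expectation (\<lambda>\<omega>. indicator {0..t} s *\<^sub>R A (q \<omega> *\<^sub>R X s \<omega>)) = indicator {0..t} s *\<^sub>R A (f s)"
          using integral_bounded_linear[OF bounded_linear_A qX] by (simp add: f_def)
      qed simp
      finally show ?thesis unfolding set_lebesgue_integral_restrict[OF tT] .
    qed
    finally have "norm (f t) \<le> norm (LINT s:{0..t}|lborel. A (f s)) + norm (expectation (\<lambda>\<omega>. q \<omega> *\<^sub>R Y \<omega>))"
      using norm_triangle_ineq by simp
    moreover have "norm (LINT s:{0..t}|lborel. A (f s)) \<le> (onorm A + 1) * (LINT s:{0..t}|lborel. norm (f s))"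
    proof -
      have ft: "set_integrable lborel {0..t} f" by (rule set_integrable_subset[OF fint]) (use t in auto)
      then have ftn: "set_integrable lborel {0..t} (\<lambda>s. norm (f s))" by (rule set_integrable_norm)
      have "integrable lborel (\<lambda>s. A (indicator {0..t} s *\<^sub>R f s))"
        using ft unfolding set_integrable_def by (rule integrable_bounded_linear[OF bounded_linear_A])
      then have Aft: "set_integrable lborel {0..t} (\<lambda>s. A (f s))"
        unfolding set_integrable_def by (simp add: A.scaleR)
      have "norm (LINT s:{0..t}|lborel. A (f s)) \<le> (LINT s:{0..t}|lborel. norm (A (f s)))"
        by (rule set_integral_norm_bound[OF Aft])
      also have "\<dots> \<le> (LINT s:{0..t}|lborel. (onorm A + 1) * norm (f s))"
      proof (rule set_integral_mono)
        show "norm (A (f s)) \<le> (onorm A + 1) * norm (f s)" for s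
          unfolding distrib_right using onorm[OF bounded_linear_A, of "f s"] norm_ge_zero[of "f s"] by linarith
      qed (use ftn Aft set_integrable_norm in auto)
      finally show ?thesis by simp
    qed
    ultimately show ?thesis using near[OF t Y] by linarith
  qed
  have "norm (f T) \<le> 2 * \<epsilon> * exp (2 * (onorm A + 1) * T)"
  proof (rule gronwall[where T=T and f="\<lambda>t. norm (f t)"])
    show "0 < onorm A + 1" using onorm_pos_le[OF bounded_linear_A] by simp
    show "set_integrable lborel {0..T} (\<lambda>t. norm (f t))" by (rule set_integrable_norm[OF fint])
  qed (use \<epsilon> T f_le in auto)
  then show ?thesis by (simp add: f_def)
qed

text \<open>The bound has to be the same for all times, because Gronwall needs one error term on the
  whole horizon. Enlarging the time interval only increases the integral of the squared diffusion,
  so the horizon itself supplies the bound.\<close>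

lemma diffusion_L2_bound:
  obtains L where "0 \<le> L"
    "\<And>t Y. t \<in> {0..T} \<Longrightarrow> is_ito_integral M F W t (\<lambda>s \<omega>. diffusion s) Y \<Longrightarrow>
      expectation (\<lambda>\<omega>. (norm (Y \<omega>))\<^sup>2) \<le> L"
proof -
  interpret L: finite_measure horizon by (rule interval_finite)
  interpret P: pair_sigma_finite horizon M ..
  obtain Y where "is_ito_integral M F W T (\<lambda>s \<omega>. diffusion s) Y"
    using solution_decomposition[of T] T by auto
  then have "(\<lambda>s \<omega>. diffusion s) \<in> L2_processes M F T" by (simp add: is_ito_integral_def)
  then have sq: "square_integrable (horizon \<Otimes>\<^sub>M M) (\<lambda>(s, \<omega>). diffusion s)"
    by (rule L2_processes_square_integrable) (use T in simp)
  define \<Lambda> where "\<Lambda> = (\<integral>z. (norm (diffusion (fst z)))\<^sup>2 \<partial>(horizon \<Otimes>\<^sub>M M))"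
  have "(\<integral>\<^sup>+s. ennreal ((norm (diffusion s))\<^sup>2) \<partial>horizon)
      = (\<integral>\<^sup>+z. ennreal ((norm (diffusion (fst z)))\<^sup>2) \<partial>(horizon \<Otimes>\<^sub>M M))"
    using sq by (subst nn_integral_fst[symmetric]) (auto simp: emeasure_space_1 square_integrable_def case_prod_beta')
  also have "\<dots> = ennreal \<Lambda>"
    unfolding \<Lambda>_def using square_integrable_norm_sq[OF sq] by (intro nn_integral_eq_integral) (auto simp: case_prod_beta')
  finally have full: "(\<integral>\<^sup>+s. ennreal ((norm (diffusion s))\<^sup>2) \<partial>horizon) = ennreal \<Lambda>" .
  have \<Lambda>: "0 \<le> \<Lambda>" by (simp add: \<Lambda>_def)
  show ?thesis
  proof (rule that[of "4 * \<Lambda>"])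
    fix t Y assume t: "t \<in> {0..T}" and Y: "is_ito_integral M F W t (\<lambda>s \<omega>. diffusion s) Y"
    have "(\<integral>\<^sup>+s. ennreal ((norm (diffusion s))\<^sup>2) \<partial>restrict_space lborel {0..t})
        \<le> (\<integral>\<^sup>+s. ennreal ((norm (diffusion s))\<^sup>2) \<partial>horizon)"
      using t by (simp add: nn_integral_restrict_space)
        (auto intro!: nn_integral_mono split: split_indicator)
    then show "expectation (\<lambda>\<omega>. (norm (Y \<omega>))\<^sup>2) \<le> 4 * \<Lambda>"
      using ito_integral_norm_bound[OF Y] \<Lambda> t unfolding full by simp
  qed (use \<Lambda> in simp)
qed

lemma solution_gaussian:
  "(\<lambda>\<omega>. v \<bullet> X T \<omega> - expectation (\<lambda>\<omega>. v \<bullet> X T \<omega>)) \<in> gaussian_space"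
proof -
  have TT: "T \<in> {0..T}" using T by simp
  note XT = X_square_integrable[OF TT]
  obtain L where L: "0 \<le> L" "\<And>t Y. t \<in> {0..T} \<Longrightarrow> is_ito_integral M F W t (\<lambda>s \<omega>. diffusion s) Y \<Longrightarrow>
      expectation (\<lambda>\<omega>. (norm (Y \<omega>))\<^sup>2) \<le> L"
    by (rule diffusion_L2_bound) blast
  define k where "k = real DIM('a) * sqrt (2 * L + 2)"
  have k: "0 \<le> k" using L(1) by (simp add: k_def)
  show ?thesis
  \<comment> \<open>The constant is a product: \<open>norm v\<close> from Cauchy-Schwarz,
    \<open>k\<close> from the stochastic integrals, and the remaining factor from Gronwall.\<close>
  proof (rule gaussian_space_criterion[where K="norm v * (2 * k * exp (2 * (onorm A + 1) * T))"])
    show "square_integrable M (\<lambda>\<omega>. v \<bullet> X T \<omega>)" by (rule square_integrable_inner[OF XT])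
    show "0 \<le> norm v * (2 * k * exp (2 * (onorm A + 1) * T))" using k by simp
    fix q :: "'w \<Rightarrow> real" and \<epsilon> :: real
    assume q: "square_integrable M q" "expectation q = 0" and \<epsilon>: "0 \<le> \<epsilon>"
      and near: "\<And>w. w \<in> W_span \<Longrightarrow>
        \<bar>expectation (\<lambda>\<omega>. q \<omega> * w \<omega>)\<bar> \<le> \<epsilon> * sqrt (expectation (\<lambda>\<omega>. (w \<omega>)\<^sup>2))"
    have "norm (expectation (\<lambda>\<omega>. q \<omega> *\<^sub>R X T \<omega>)) \<le> 2 * (k * \<epsilon>) * exp (2 * (onorm A + 1) * T)"
    proof (rule solution_dual_bound[OF q])
      show "0 \<le> k * \<epsilon>" using k \<epsilon> by simp
      fix t Y assume "t \<in> {0..T}" "is_ito_integral M F W t (\<lambda>s \<omega>. diffusion s) Y"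
      then show "norm (expectation (\<lambda>\<omega>. q \<omega> *\<^sub>R Y \<omega>)) \<le> k * \<epsilon>"
        unfolding k_def using L(2) by (intro ito_integral_dual_bound[OF _ _ _ q(1) \<epsilon> near]) auto
    qed
    then have "norm v * norm (expectation (\<lambda>\<omega>. q \<omega> *\<^sub>R X T \<omega>))
        \<le> norm v * (2 * (k * \<epsilon>) * exp (2 * (onorm A + 1) * T))"
      by (rule mult_left_mono) simp
    moreover have "expectation (\<lambda>\<omega>. q \<omega> * (v \<bullet> X T \<omega>)) = v \<bullet> expectation (\<lambda>\<omega>. q \<omega> *\<^sub>R X T \<omega>)"
      using integral_inner_right[of v M "\<lambda>\<omega>. q \<omega> *\<^sub>R X T \<omega>"] square_integrable_scaleR_product[OF q(1) XT] by simp
    ultimately show "\<bar>expectation (\<lambda>\<omega>. q \<omega> * (v \<bullet> X T \<omega>))\<bar>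
        \<le> norm v * (2 * k * exp (2 * (onorm A + 1) * T)) * \<epsilon>"
      using Cauchy_Schwarz_ineq2[of v "expectation (\<lambda>\<omega>. q \<omega> *\<^sub>R X T \<omega>)"] by (simp add: algebra_simps)
  qed
qed

text \<open>A Cramer-Wold argument: every projection of the centred terminal value lies in the
  Gaussian space, so its characteristic function is known, and these projections determine that of
  the vector. The operator \<open>S\<close> is the covariance, for which
  \<open>v \<bullet> S v\<close> is the variance of the projection along \<open>v\<close>.\<close>

lemma solution_law_Gauss: "distr M borel (X T) \<in> Gauss"
proof -
  have TT: "T \<in> {0..T}" using T by simp
  note XT = X_square_integrable[OF TT]
  have XM: "X T \<in> borel_measurable M" by (rule X_measurable[OF TT])
  define \<alpha> where "\<alpha> = expectation (X T)"
  define Z where "Z \<omega> = X T \<omega> - \<alpha>" for \<omega>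
  have Zsq: "square_integrable M Z"
    unfolding Z_def[abs_def] by (intro square_integrable_diff XT square_integrable_const)
  define S where "S w = expectation (\<lambda>\<omega>. (w \<bullet> Z \<omega>) *\<^sub>R Z \<omega>)" for w
  have intS: "integrable M (\<lambda>\<omega>. (w \<bullet> Z \<omega>) *\<^sub>R Z \<omega>)" for w
    by (rule square_integrable_scaleR_product[OF square_integrable_inner[OF Zsq] Zsq])
  have inner: "v \<bullet> S w = expectation (\<lambda>\<omega>. (v \<bullet> Z \<omega>) * (w \<bullet> Z \<omega>))" for v w
    using integral_inner_right[of v M "\<lambda>\<omega>. (w \<bullet> Z \<omega>) *\<^sub>R Z \<omega>"] intS by (simp add: S_def mult.commute)
  have "covariance_operator S"
    unfolding covariance_operator_def
  proof (intro conjI allI)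
    show "linear S"
    proof (rule linearI)
      show "S (a + b) = S a + S b" for a b
        unfolding S_def using intS by (simp add: inner_add_left scaleR_add_left)
      show "S (r *\<^sub>R a) = r *\<^sub>R S a" for r a
        unfolding S_def by (simp add: scaleR_scaleR[symmetric] del: scaleR_scaleR)
    qed
    show "v \<bullet> S w = S v \<bullet> w" for v w
      using inner[of v w] inner[of w v] by (simp add: inner_commute mult.commute)
    show "0 \<le> v \<bullet> S v" for v unfolding inner by simp
  qed
  moreover have "normal_law \<alpha> S (distr M borel (X T))"
    unfolding normal_law_def
  proof (intro conjI allI)
    show "prob_space (distr M borel (X T))" by (rule prob_space_distr[OF XM])
    fix v
    have mean: "expectation (\<lambda>\<omega>. v \<bullet> X T \<omega>) = v \<bullet> \<alpha>"
      using integral_inner_right[of v M "X T"] square_integrable_integrable[OF XT] by (simp add: \<alpha>_def)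
    then have vZ: "(\<lambda>\<omega>. v \<bullet> Z \<omega>) \<in> gaussian_space"
      using solution_gaussian[of v] by (simp add: Z_def inner_diff_right)
    have "(CLINT x|distr M borel (X T). iexp (v \<bullet> x)) = (CLINT \<omega>|M. iexp (v \<bullet> X T \<omega>))"
      using XM by (subst integral_distr) auto
    also have "\<dots> = (CLINT \<omega>|M. iexp (v \<bullet> \<alpha>) * iexp (1 * (v \<bullet> Z \<omega>)))"
      by (simp add: Z_def inner_diff_right exp_add[symmetric] algebra_simps)
    also have "\<dots> = iexp (v \<bullet> \<alpha>) * (CLINT \<omega>|M. iexp (1 * (v \<bullet> Z \<omega>)))"
      by (rule integral_mult_right_zero)
    also have "\<dots> = iexp (v \<bullet> \<alpha>) * exp (of_real (- (1\<^sup>2 * expectation (\<lambda>\<omega>. (v \<bullet> Z \<omega>)\<^sup>2)) / 2))"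
      unfolding gaussian_space_char[OF vZ] ..
    also have "\<dots> = exp (\<i> * of_real (v \<bullet> \<alpha>) - of_real (v \<bullet> S v) / 2)"
      unfolding inner by (simp add: exp_add[symmetric] power2_eq_square)
    finally show "(CLINT x|distr M borel (X T). iexp (v \<bullet> x)) = exp (\<i> * of_real (v \<bullet> \<alpha>) - of_real (v \<bullet> S v) / 2)" .
  qed simp
  ultimately show ?thesis unfolding Gauss_def by blast
qed

lemma solution_degenerate:
  assumes zero: "\<And>m v. \<gamma> m v = 0"
  shows "AE \<omega> in M. X T \<omega> = expectation (X T)"
proof -
  have TT: "T \<in> {0..T}" using T by simp
  note XT = X_square_integrable[OF TT]
  have "AE \<omega> in M. b \<bullet> X T \<omega> = b \<bullet> expectation (X T)" for b
  proof -
    define q where "q \<omega> = b \<bullet> X T \<omega> - b \<bullet> expectation (X T)" for \<omega>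
    have qsq: "square_integrable M q"
      unfolding q_def[abs_def] by (intro square_integrable_diff square_integrable_inner XT square_integrable_const)
    have bX: "integrable M (\<lambda>\<omega>. b \<bullet> X T \<omega>)"
      by (rule square_integrable_integrable[OF square_integrable_inner[OF XT]])
    have Eq: "expectation q = 0"
      unfolding q_def[abs_def] using bX square_integrable_integrable[OF XT] by (simp add: prob_space)
    \<comment> \<open>The error is exactly 0 here: with zero diffusion every stochastic integral
      vanishes almost everywhere.\<close>
    have "norm (expectation (\<lambda>\<omega>. q \<omega> *\<^sub>R X T \<omega>)) \<le> 2 * 0 * exp (2 * (onorm A + 1) * T)"
    proof (rule solution_dual_bound[OF qsq Eq order.refl])
      fix t Y assume t: "t \<in> {0..T}" and Y: "is_ito_integral M F W t (\<lambda>s \<omega>. diffusion s) Y"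
      have "expectation (\<lambda>\<omega>. (norm (Y \<omega>))\<^sup>2) \<le> 4 * 0"
        by (rule ito_integral_norm_bound[OF Y]) (use t zero in auto)
      then have "expectation (\<lambda>\<omega>. (norm (Y \<omega>))\<^sup>2) = 0" by (simp add: order_antisym)
      then have "AE \<omega> in M. Y \<omega> = 0"
        using integral_nonneg_eq_0_iff_AE[of M "\<lambda>\<omega>. (norm (Y \<omega>))\<^sup>2"]
          square_integrable_norm_sq[OF ito_integral_square_integrable[OF Y]] by simp
      then have "expectation (\<lambda>\<omega>. q \<omega> *\<^sub>R Y \<omega>) = 0"
        by (intro integral_eq_zero_AE) auto
      then show "norm (expectation (\<lambda>\<omega>. q \<omega> *\<^sub>R Y \<omega>)) \<le> 0" by simp
    qed
    then have "expectation (\<lambda>\<omega>. q \<omega> *\<^sub>R X T \<omega>) = 0" by simp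
    then have "expectation (\<lambda>\<omega>. q \<omega> * (b \<bullet> X T \<omega>)) = 0"
      using integral_inner_right[of b M "\<lambda>\<omega>. q \<omega> *\<^sub>R X T \<omega>"] square_integrable_scaleR_product[OF qsq XT] by simp
    \<comment> \<open>The variance of the projection is the expectation of \<open>q\<close> times
      the projection itself, up to a multiple of the mean of \<open>q\<close>; both are 0.\<close>
    moreover have "(q \<omega>)\<^sup>2 = q \<omega> * (b \<bullet> X T \<omega>) - (b \<bullet> expectation (X T)) * q \<omega>" for \<omega>
      by (simp add: q_def power2_eq_square algebra_simps)
    ultimately have "expectation (\<lambda>\<omega>. (q \<omega>)\<^sup>2) = 0"
      using square_integrable_product[OF qsq square_integrable_inner[OF XT, of b]]
        square_integrable_integrable[OF qsq] Eq by simp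
    then have "AE \<omega> in M. q \<omega> = 0"
      using integral_nonneg_eq_0_iff_AE[of M "\<lambda>\<omega>. (q \<omega>)\<^sup>2"] square_integrable_real_sq[OF qsq] by simp
    then show ?thesis by eventually_elim (simp add: q_def)
  qed
  then have "AE \<omega> in M. \<forall>b\<in>Basis. b \<bullet> X T \<omega> = b \<bullet> expectation (X T)"
    by (intro AE_finite_allI) auto
  then show ?thesis
    by eventually_elim (auto intro: euclidean_eqI simp: inner_commute)
qed

end

lemma reachable_laws_subset_Gauss:
  assumes "0 < T" "linear A"
  shows "reachable_laws M F W T (\<lambda>X m v. A X + \<beta> m v) (\<lambda>X m v. \<gamma> m v) x \<subseteq> Gauss"
  using solution_law_Gauss[OF assms] unfolding reachable_laws_def by blast

lemma reachable_laws_degenerate: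
  assumes "0 < T" "linear A" "\<And>m v. \<gamma> m v = 0"
    and \<mu>: "\<mu> \<in> reachable_laws M F W T (\<lambda>X m v. A X + \<beta> m v) (\<lambda>X m v. \<gamma> m v) x"
  shows "\<exists>\<alpha>. \<mu> = return borel \<alpha>"
proof -
  obtain u X where sol: "is_solution M F W T (\<lambda>X m v. A X + \<beta> m v) (\<lambda>X m v. \<gamma> m v) x u X"
    and \<mu>: "\<mu> = distr M borel (X T)"
    using \<mu> unfolding reachable_laws_def by blast
  have "distr M borel (X T) = distr M borel (\<lambda>\<omega>. expectation (X T))"
    using solution_degenerate[OF assms(1,2) sol assms(3)] X_measurable[OF assms(1,2) sol, of T] assms(1)
    by (intro distr_cong_AE) auto
  then show ?thesis unfolding \<mu> by (auto simp: distr_const)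
qed

end

section \<open>Steering the scalar system\<close>

lemma exp_diff_le:
  fixes x y :: real
  assumes "x \<le> K" "y \<le> K"
  shows "\<bar>exp x - exp y\<bar> \<le> exp K * \<bar>x - y\<bar>"
proof -
  have *: "exp x - exp y \<le> exp K * (x - y) \<and> exp y \<le> exp x" if "y \<le> x" "x \<le> K" for x y :: real
  proof -
    have "exp x - exp y = exp x * (1 - exp (y - x))"
      by (simp add: exp_diff right_diff_distrib)
    also have "\<dots> \<le> exp x * (x - y)"
    proof (rule mult_left_mono)
      show "1 - exp (y - x) \<le> x - y" using exp_ge_add_one_self[of "y - x"] by linarith
    qed simp
    also have "\<dots> \<le> exp K * (x - y)" using that by (intro mult_right_mono) auto
    finally show ?thesis using that by simp
  qed
  show ?thesis
    using *[of y x] *[of x y] assms by (cases "y \<le> x") auto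
qed

text \<open>The order of the end points is part of the claim because the induction step needs it to
  glue the last interval to the preceding ones.\<close>

lemma sum_indicator_partition:
  fixes p :: "nat \<Rightarrow> real"
  assumes "\<And>i. i < N \<Longrightarrow> p i \<le> p (Suc i)"
  shows "(\<Sum>i<N. indicator {p i<..p (Suc i)} s) = (indicator {p 0<..p N} s :: real) \<and> p 0 \<le> p N"
  using assms
proof (induction N)
  case (Suc N)
  then have IH: "(\<Sum>i<N. indicator {p i<..p (Suc i)} s) = (indicator {p 0<..p N} s :: real)" "p 0 \<le> p N"
    and "p N \<le> p (Suc N)" by auto
  then show ?case by (auto simp: indicator_def)
qed simp

lemma integral_exp_interval:
  fixes a :: real
  assumes "0 \<le> r" "r \<le> s" "s \<le> t"
  shows "(\<integral>x. indicator {r<..s} x * (a * exp (a * x)) \<partial>restrict_space lborel {0..t}) = exp (a * s) - exp (a * r)"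
proof -
  have "(\<integral>x. indicator {r<..s} x * (a * exp (a * x)) \<partial>restrict_space lborel {0..t})
      = (\<integral>x. indicator {0..t} x *\<^sub>R (indicator {r<..s} x * (a * exp (a * x))) \<partial>lborel)"
    by (rule integral_restrict_space) simp
  also have "\<dots> = (\<integral>x. a * exp (a * x) * indicator {r..s} x \<partial>lborel)"
  proof (rule integral_cong_AE)
    show "AE x in lborel. indicator {0..t} x *\<^sub>R (indicator {r<..s} x * (a * exp (a * x))) = a * exp (a * x) * indicator {r..s} x"
      using AE_lborel_singleton[of r] by eventually_elim (use assms in \<open>auto split: split_indicator\<close>)
  qed auto
  also have "\<dots> = exp (a * s) - exp (a * r)"
    by (rule integral_FTC_Icc_real) (use assms in \<open>auto intro!: derivative_eq_intros continuous_intros\<close>)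
  finally show ?thesis .
qed

context brownian_setup begin

lemma L2_processesI:
  fixes Z :: "real \<Rightarrow> 'w \<Rightarrow> 'a::euclidean_space"
  assumes Z: "progressive F t Z" and t: "0 \<le> t"
    and sq: "\<And>s. s \<in> {0..t} \<Longrightarrow> square_integrable M (Z s)"
    and le: "\<And>s. s \<in> {0..t} \<Longrightarrow> expectation (\<lambda>\<omega>. (norm (Z s \<omega>))\<^sup>2) \<le> K"
  shows "Z \<in> L2_processes M F t"
proof -
  have "square_integrable (restrict_space lborel {0..t} \<Otimes>\<^sub>M M) (\<lambda>(s, \<omega>). Z s \<omega>)"
    by (rule product_square_integrableI[OF interval_finite finite_measure_axioms progressive_measurable[OF Z t] sq le])
      (simp_all add: space_restrict_space)
  then show ?thesis
    using Z square_integrable_norm_sq by (fastforce simp: L2_processes_def case_prod_beta')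
qed

lemma progressive_deterministic:
  fixes f :: "real \<Rightarrow> 'a::euclidean_space"
  assumes "continuous_on {0..t} f"
  shows "progressive F t (\<lambda>s \<omega>. f s)"
  unfolding progressive_def
proof
  fix r assume "r \<in> {0..t}"
  then have "f \<in> borel_measurable (restrict_space borel {0..r})"
    by (intro borel_measurable_continuous_on_restrict continuous_on_subset[OF assms]) auto
  then show "(\<lambda>(s, \<omega>). f s) \<in> borel_measurable (restrict_space borel {0..r} \<Otimes>\<^sub>M F r)"
    by (simp add: case_prod_beta')
qed

lemma L2_processes_deterministic:
  fixes f :: "real \<Rightarrow> 'a::euclidean_space"
  assumes f: "continuous_on {0..t} f" and t: "0 \<le> t"
  shows "(\<lambda>s \<omega>. f s) \<in> L2_processes M F t"
proof -
  have "compact (f ` {0..t})" by (rule compact_continuous_image[OF f]) simp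
  then obtain K where K: "norm (f s) \<le> K" if "s \<in> {0..t}" for s
    by (meson bounded_iff compact_imp_bounded imageI)
  show ?thesis
  proof (rule L2_processesI[where K="K\<^sup>2"])
    fix s assume "s \<in> {0..t}"
    then show "expectation (\<lambda>\<omega>. (norm (f s))\<^sup>2) \<le> K\<^sup>2"
      using K by (simp add: prob_space power_mono)
  qed (use t f in \<open>auto intro: progressive_deterministic square_integrable_const\<close>)
qed

section \<open>A version of Brownian motion with continuous paths on the whole space\<close>

definition null_paths :: "'w set" where
  "null_paths = (SOME N. N \<in> null_sets M \<and> {\<omega>\<in>space M. \<not> continuous_on {0..} (\<lambda>t. W t \<omega>)} \<subseteq> N)"

lemma null_paths:
  "null_paths \<in> null_sets M" "\<omega> \<in> space M - null_paths \<Longrightarrow> continuous_on {0..} (\<lambda>t. W t \<omega>)"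
proof -
  have "AE \<omega> in M. continuous_on {0..} (\<lambda>t. W t \<omega>)"
    using brownian by (simp add: brownian_motion_def)
  then have "\<exists>N. N \<in> null_sets M \<and> {\<omega>\<in>space M. \<not> continuous_on {0..} (\<lambda>t. W t \<omega>)} \<subseteq> N"
    unfolding eventually_ae_filter by blast
  from someI_ex[OF this] show "null_paths \<in> null_sets M"
    "\<omega> \<in> space M - null_paths \<Longrightarrow> continuous_on {0..} (\<lambda>t. W t \<omega>)"
    unfolding null_paths_def by auto
qed

text \<open>Setting the path to zero on one fixed null set makes every path continuous. The
  augmented filtration contains that set, so \<open>V\<close> stays adapted, and it agrees with
  \<open>W\<close> at all times simultaneously outside the set.\<close>

definition V :: "real \<Rightarrow> 'w \<Rightarrow> real" where
  "V t \<omega> = (if \<omega> \<in> null_paths then 0 else W t \<omega>)"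

lemma V_continuous: "\<omega> \<in> space M \<Longrightarrow> continuous_on {0..} (\<lambda>t. V t \<omega>)"
  using null_paths(2)[of \<omega>] by (cases "\<omega> \<in> null_paths") (auto simp: V_def)

lemma V_eq_W: "AE \<omega> in M. \<forall>t. V t \<omega> = W t \<omega>"
  using AE_not_in[OF null_paths(1)] by eventually_elim (simp add: V_def)

lemma V_measurable_F:
  assumes "0 \<le> s" "s \<le> t"
  shows "V s \<in> borel_measurable (F t)"
proof -
  have "null_paths \<in> sets (F t)" by (rule null_sets_F[OF null_paths(1)])
  then have "{\<omega>\<in>space (F t). \<omega> \<in> null_paths} \<in> sets (F t)"
    by (metis (no_types) Collect_mem_eq Int_commute Collect_conj_eq sets.Int sets.top)
  then show ?thesis
    unfolding V_def[abs_def] by (intro measurable_If W_measurable_F assms) auto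
qed

lemma V_measurable: "0 \<le> t \<Longrightarrow> V t \<in> borel_measurable M"
  by (rule measurable_F_imp_M[OF V_measurable_F]) auto

text \<open>Approximation of the time from the left keeps the approximants adapted.\<close>

lemma V_progressive: "progressive F t V"
  unfolding progressive_def
proof
  fix r assume r: "r \<in> {0..t}"
  let ?P = "restrict_space borel {0..r} \<Otimes>\<^sub>M F r"
  \<comment> \<open>Rounding down takes countably many values and stays to the left of
    \<open>s\<close>. The cap at \<open>r\<close> matters because the countable composition asks for
    measurability at every index, including those whose grid time exceeds \<open>r\<close>.\<close>
  let ?d = "\<lambda>n s. min r (real (nat \<lfloor>real (Suc n) * s\<rfloor>) / real (Suc n))"
  have step: "(\<lambda>z. V (?d n (fst z)) (snd z)) \<in> borel_measurable ?P" for n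
  proof (rule measurable_compose_countable[where f="\<lambda>i z. V (min r (real i / real (Suc n))) (snd z)" and g="\<lambda>z. nat \<lfloor>real (Suc n) * fst z\<rfloor>"])
    show "(\<lambda>z. V (min r (real i / real (Suc n))) (snd z)) \<in> borel_measurable ?P" for i
      by (rule measurable_compose[OF measurable_snd V_measurable_F]) (use r in auto)
    have [measurable]: "(\<lambda>x::real. x) \<in> borel_measurable (restrict_space borel {0..r})"
      by (rule measurable_restrict_space1) simp
    have "fst \<in> borel_measurable ?P"
      by (rule measurable_compose[OF measurable_fst]) simp
    then have "(\<lambda>z. \<lfloor>real (Suc n) * fst z\<rfloor>) \<in> measurable ?P (count_space UNIV)"
      by measurable
    then show "(\<lambda>z. nat \<lfloor>real (Suc n) * fst z\<rfloor>) \<in> measurable ?P (count_space UNIV)"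
      by measurable
  qed
  have "(\<lambda>z. V (fst z) (snd z)) \<in> borel_measurable ?P"
  proof (rule borel_measurable_LIMSEQ_metric[OF step])
    fix z assume z: "z \<in> space ?P"
    then have s: "0 \<le> fst z" "fst z \<le> r" and \<omega>: "snd z \<in> space M"
      by (auto simp: space_pair_measure space_restrict_space)
    have lower: "fst z - 1 / real (Suc n) \<le> ?d n (fst z)" and upper: "?d n (fst z) \<le> fst z" for n
    proof -
      have f: "real (nat \<lfloor>real (Suc n) * fst z\<rfloor>) = of_int \<lfloor>real (Suc n) * fst z\<rfloor>"
        using s by (simp add: of_nat_nat)
      have "real_of_int \<lfloor>real (Suc n) * fst z\<rfloor> \<le> real (Suc n) * fst z" by (rule of_int_floor_le)
      then show "?d n (fst z) \<le> fst z" unfolding f by (simp add: field_simps min.coboundedI2)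
      have "real (Suc n) * fst z - 1 \<le> real_of_int \<lfloor>real (Suc n) * fst z\<rfloor>" by linarith
      then have "(real (Suc n) * fst z - 1) / real (Suc n) \<le> real_of_int \<lfloor>real (Suc n) * fst z\<rfloor> / real (Suc n)"
        by (rule divide_right_mono) simp
      then have "fst z - 1 / real (Suc n) \<le> real_of_int \<lfloor>real (Suc n) * fst z\<rfloor> / real (Suc n)"
        by (simp add: diff_divide_distrib)
      moreover have "fst z - 1 / real (Suc n) \<le> r" using s by (simp add: add_increasing2 diff_le_eq)
      ultimately show "fst z - 1 / real (Suc n) \<le> ?d n (fst z)" unfolding f by simp
    qed
    have "(\<lambda>n. ?d n (fst z)) \<longlonglongrightarrow> fst z"
    proof (rule tendsto_sandwich)
      have "(\<lambda>n. fst z - 1 / real (Suc n)) \<longlonglongrightarrow> fst z - 0"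
        by (intro tendsto_diff tendsto_const LIMSEQ_Suc[OF lim_1_over_n])
      then show "(\<lambda>n. fst z - 1 / real (Suc n)) \<longlonglongrightarrow> fst z" by simp
    qed (use lower upper in auto)
    \<comment> \<open>Convergence is needed at every point of the product space, hence the use of
      \<open>V\<close> instead of \<open>W\<close>.\<close>
    then show "(\<lambda>n. V (?d n (fst z)) (snd z)) \<longlonglongrightarrow> V (fst z) (snd z)"
      by (rule continuous_on_tendsto_compose[OF V_continuous[OF \<omega>]]) (use s r in auto)
  qed
  then show "(\<lambda>(s, \<omega>). V s \<omega>) \<in> borel_measurable ?P" by (simp add: case_prod_beta')
qed

lemma V_moments:
  assumes "0 \<le> t"
  shows "square_integrable M (V t)" "expectation (V t) = 0" "expectation (\<lambda>\<omega>. (V t \<omega>)\<^sup>2) = t"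
proof -
  note W = W_square_integrable[OF assms]
  have ae: "AE \<omega> in M. V t \<omega> = W t \<omega>" "AE \<omega> in M. (V t \<omega>)\<^sup>2 = (W t \<omega>)\<^sup>2" using V_eq_W by auto
  note [measurable] = V_measurable[OF assms] W_measurable[OF assms]
  have "integrable M (\<lambda>\<omega>. (V t \<omega>)\<^sup>2) \<longleftrightarrow> integrable M (\<lambda>\<omega>. (W t \<omega>)\<^sup>2)"
    by (rule integrable_cong_AE) (use ae in auto)
  then show "square_integrable M (V t)" using W(1) by (simp add: square_integrable_def)
  show "expectation (V t) = 0"
    using integral_cong_AE[of "V t" M "W t"] ae W(2) by simp
  have "expectation (\<lambda>\<omega>. (V t \<omega>)\<^sup>2) = expectation (\<lambda>\<omega>. (W t \<omega>)\<^sup>2)"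
    by (rule integral_cong_AE) (use ae in auto)
  then show "expectation (\<lambda>\<omega>. (V t \<omega>)\<^sup>2) = t" using W(3) by simp
qed

lemma V_increment:
  assumes "0 \<le> s" "s \<le> t"
  shows "expectation (\<lambda>\<omega>. (V t \<omega> - V s \<omega>)\<^sup>2) = t - s"
proof -
  have ae: "AE \<omega> in M. (V t \<omega> - V s \<omega>)\<^sup>2 = (W t \<omega> - W s \<omega>)\<^sup>2" using V_eq_W by auto
  have t: "0 \<le> t" using assms by simp
  note [measurable] = V_measurable[OF assms(1)] W_measurable[OF assms(1)] V_measurable[OF t] W_measurable[OF t]
  have "expectation (\<lambda>\<omega>. (V t \<omega> - V s \<omega>)\<^sup>2) = expectation (\<lambda>\<omega>. (W t \<omega> - W s \<omega>)\<^sup>2)"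
    by (rule integral_cong_AE) (use ae in auto)
  then show ?thesis using increment_square_integrable(3)[OF assms] by simp
qed

section \<open>The Ito integral of an exponential\<close>

lemma tendsto_zero_ennreal_bound:
  assumes "\<And>k. f k \<le> ennreal (B / real (Suc k))"
  shows "f \<longlonglongrightarrow> 0"
proof (rule tendsto_sandwich[OF _ _ tendsto_const])
  have "(\<lambda>k. B * (1 / real (Suc k))) \<longlonglongrightarrow> B * 0"
    by (intro tendsto_mult tendsto_const LIMSEQ_Suc[OF lim_1_over_n])
  from tendsto_ennrealI[OF this] show "(\<lambda>k. ennreal (B / real (Suc k))) \<longlonglongrightarrow> 0" by simp
qed (use assms in auto)

text \<open>\<open>Y\<close> is the stochastic integral after integration by parts, which makes sense pathwise.\<close>

lemma ito_integral_exp: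
  fixes a \<kappa> t :: real
  assumes t: "0 \<le> t"
  defines "Y \<equiv> \<lambda>\<omega>. \<kappa> * exp (a * t) * V t \<omega> - \<kappa> * (LINT s:{0..t}|lborel. a * exp (a * s) * V s \<omega>)"
  shows "is_ito_integral M F W t (\<lambda>s \<omega>. \<kappa> * exp (a * s)) Y"
proof -
  let ?L = "restrict_space lborel {0..t}"
  interpret L: finite_measure ?L by (rule interval_finite)
  \<comment> \<open>A uniform grid with \<open>Suc k\<close> intervals, which avoids division by
    zero at \<open>k = 0\<close>. The approximating integrand freezes the exponential at the left
    end of each interval.\<close>
  define p where "p k i = real i * t / real (Suc k)" for k i :: nat
  define e where "e k i = exp (a * p k i)" for k i
  define N where "N k = Suc k" for k :: nat
  \<comment> \<open>\<open>C\<close> bounds the exponential on \<open>{0..t}\<close> for either sign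
    of \<open>a\<close>, and is also the Lipschitz factor in \<open>exp_diff_le\<close>.\<close>
  define C where "C = exp (\<bar>a\<bar> * t)"
  have C: "0 < C" by (simp add: C_def)
  have expC: "exp (a * s) \<le> C" if "s \<in> {0..t}" for s
    unfolding C_def using that t abs_le_D1[of "a * s" "\<bar>a\<bar> * t"] by (simp add: abs_mult mult_left_mono)
  have p0: "p k 0 = 0" and pN: "p k (N k) = t" for k by (auto simp: p_def N_def)
  have pmono: "p k i \<le> p k j" if "i \<le> j" for k i j
    using that t by (simp add: p_def divide_right_mono mult_right_mono)
  have pstep: "p k (Suc i) - p k i = t / real (Suc k)" for k i
    unfolding p_def diff_divide_distrib[symmetric] by (simp add: distrib_right)
  have pt: "p k i \<in> {0..t}" if "i \<le> N k" for k i
    using pmono[of 0 i k] pmono[OF that, of k] by (simp add: p0 pN)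
  have bdd: "bounded ((\<lambda>\<omega>. \<kappa> * e k i) ` space M)" for k i
    by (rule boundedI[where B="norm (\<kappa> * e k i)"]) auto
  have S: "is_simple M F t (N k) (p k) (\<lambda>i \<omega>. \<kappa> * e k i)" for k
    unfolding is_simple_def using pmono[of _ "Suc _" k] by (auto simp: p0 pN intro: bdd)
  \<comment> \<open>The left-open intervals miss time 0, so the partition identity excludes that
    null set of times.\<close>
  have part: "(\<Sum>i<N k. indicator {p k i<..p k (Suc i)} s) = (1::real)" if "s \<in> {0..t}" "s \<noteq> 0" for k s
    using conjunct1[OF sum_indicator_partition[of "N k" "p k" s]] pmono[of _ "Suc _" k] that by (simp add: p0 pN)
  have ne0: "AE s in ?L. s \<in> {0..t} \<and> s \<noteq> 0"
    using AE_lborel_singleton[of 0] by (subst AE_restrict_space_iff) auto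
  have H: "(\<lambda>s \<omega>. \<kappa> * exp (a * s)) \<in> L2_processes M F t"
    by (rule L2_processes_deterministic[OF _ t]) (intro continuous_intros)
  have conv1: "(\<lambda>k. \<integral>\<^sup>+(s, \<omega>). ennreal ((norm (\<kappa> * exp (a * s) - simple_process (N k) (p k) (\<lambda>i \<omega>. \<kappa> * e k i) s \<omega>))\<^sup>2)
      \<partial>(?L \<Otimes>\<^sub>M M)) \<longlonglongrightarrow> 0"
  proof (rule tendsto_zero_ennreal_bound)
    fix k
    \<comment> \<open>The squared error is of order \<open>1 / (real (Suc k))\<^sup>2\<close>; the
      weaker order is kept so that both limits use the same comparison.\<close>
    define D where "D = (\<kappa> * (C * (\<bar>a\<bar> * t)))\<^sup>2 / real (Suc k)"
    have D0: "0 \<le> D" by (simp add: D_def)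
    have le: "(norm (\<kappa> * exp (a * s) - simple_process (N k) (p k) (\<lambda>i \<omega>. \<kappa> * e k i) s \<omega>))\<^sup>2 \<le> D"
      if s: "s \<in> {0..t}" "s \<noteq> 0" for s and \<omega> :: 'w
    proof -
      have "\<kappa> * exp (a * s) = (\<Sum>i<N k. indicator {p k i<..p k (Suc i)} s * (\<kappa> * exp (a * s)))"
        using part[OF s, of k] by (simp add: sum_distrib_right[symmetric])
      then have "\<kappa> * exp (a * s) - simple_process (N k) (p k) (\<lambda>i \<omega>. \<kappa> * e k i) s \<omega>
          = simple_process (N k) (p k) (\<lambda>i \<omega>. \<kappa> * exp (a * s) - \<kappa> * e k i) s \<omega>"
        by (simp add: simple_process_def sum_subtractf right_diff_distrib)
      then have "(norm (\<kappa> * exp (a * s) - simple_process (N k) (p k) (\<lambda>i \<omega>. \<kappa> * e k i) s \<omega>))\<^sup>2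
          = (\<Sum>i<N k. indicator {p k i<..p k (Suc i)} s * (norm (\<kappa> * exp (a * s) - \<kappa> * e k i))\<^sup>2)"
        using norm_simple_process_sq[of "N k" "p k" "\<lambda>i \<omega>. \<kappa> * exp (a * s) - \<kappa> * e k i" s \<omega>] pmono by simp
      also have "\<dots> \<le> (\<Sum>i<N k. indicator {p k i<..p k (Suc i)} s * D)"
      proof (rule sum_mono)
        fix i assume i: "i \<in> {..<N k}"
        show "indicator {p k i<..p k (Suc i)} s * (norm (\<kappa> * exp (a * s) - \<kappa> * e k i))\<^sup>2
            \<le> indicator {p k i<..p k (Suc i)} s * D"
        proof (cases "s \<in> {p k i<..p k (Suc i)}")
          case True
          have "\<bar>exp (a * s) - e k i\<bar> \<le> C * \<bar>a * s - a * p k i\<bar>"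
            unfolding e_def C_def
          proof (rule exp_diff_le)
            show "a * s \<le> \<bar>a\<bar> * t"
              using s t abs_le_D1[of "a * s" "\<bar>a\<bar> * t"] by (simp add: abs_mult mult_left_mono)
            show "a * p k i \<le> \<bar>a\<bar> * t"
              using pt[of i k] i t abs_le_D1[of "a * p k i" "\<bar>a\<bar> * t"] by (simp add: abs_mult mult_left_mono)
          qed
          also have "\<bar>a * s - a * p k i\<bar> = \<bar>a\<bar> * (s - p k i)"
            using True by (simp add: right_diff_distrib[symmetric] abs_mult)
          also have "C * (\<bar>a\<bar> * (s - p k i)) \<le> C * (\<bar>a\<bar> * (t / real (Suc k)))"
            using True pstep[of k i] C by (intro mult_left_mono) auto
          finally have "\<bar>\<kappa>\<bar> * \<bar>exp (a * s) - e k i\<bar> \<le> \<bar>\<kappa>\<bar> * (C * (\<bar>a\<bar> * (t / real (Suc k))))"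
            by (rule mult_left_mono) simp
          then have "norm (\<kappa> * exp (a * s) - \<kappa> * e k i) \<le> \<bar>\<kappa>\<bar> * (C * (\<bar>a\<bar> * t)) / real (Suc k)"
            by (simp add: right_diff_distrib[symmetric] abs_mult)
          then have "(norm (\<kappa> * exp (a * s) - \<kappa> * e k i))\<^sup>2 \<le> (\<bar>\<kappa>\<bar> * (C * (\<bar>a\<bar> * t)) / real (Suc k))\<^sup>2"
            by (rule power_mono) simp
          also have "\<dots> = (\<kappa> * (C * (\<bar>a\<bar> * t)))\<^sup>2 / (real (Suc k))\<^sup>2"
            by (simp add: power_divide power_mult_distrib)
          also have "\<dots> \<le> D"
            unfolding D_def by (intro divide_left_mono) (auto simp: power2_eq_square)
          finally show ?thesis using True by simp
        qed simp
      qed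
      also have "\<dots> = D" using part[OF s, of k] by (simp add: sum_distrib_right[symmetric])
      finally show ?thesis .
    qed
    have "(\<integral>\<^sup>+(s, \<omega>). ennreal ((norm (\<kappa> * exp (a * s) - simple_process (N k) (p k) (\<lambda>i \<omega>. \<kappa> * e k i) s \<omega>))\<^sup>2) \<partial>(?L \<Otimes>\<^sub>M M))
        = (\<integral>\<^sup>+s. \<integral>\<^sup>+\<omega>. ennreal ((norm (\<kappa> * exp (a * s) - simple_process (N k) (p k) (\<lambda>i \<omega>. \<kappa> * e k i) s \<omega>))\<^sup>2) \<partial>M \<partial>?L)"
    proof (subst nn_integral_fst[symmetric])
      have "(\<lambda>(s, \<omega>). \<kappa> * exp (a * s)) \<in> borel_measurable (?L \<Otimes>\<^sub>M M)"
        by (rule progressive_measurable[OF _ t]) (use H in \<open>simp add: L2_processes_def\<close>)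
      from borel_measurable_diff[OF this simple_process_measurable[OF S]]
      show "(\<lambda>(s, \<omega>). ennreal ((norm (\<kappa> * exp (a * s) - simple_process (N k) (p k) (\<lambda>i \<omega>. \<kappa> * e k i) s \<omega>))\<^sup>2))
          \<in> borel_measurable (?L \<Otimes>\<^sub>M M)"
        by (simp add: case_prod_beta')
    qed simp
    also have "\<dots> \<le> (\<integral>\<^sup>+s. \<integral>\<^sup>+\<omega>. ennreal D \<partial>M \<partial>?L)"
      by (rule nn_integral_mono_AE, use ne0 in eventually_elim) (intro nn_integral_mono ennreal_leI le, auto)
    also have "\<dots> = ennreal D * ennreal t"
      using t by (simp add: emeasure_space_1 emeasure_restrict_space space_restrict_space)
    also have "\<dots> = ennreal ((\<kappa> * (C * (\<bar>a\<bar> * t)))\<^sup>2 * t / real (Suc k))"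
      using D0 t by (simp add: ennreal_mult[symmetric] D_def)
    finally show "(\<integral>\<^sup>+(s, \<omega>). ennreal ((norm (\<kappa> * exp (a * s) - simple_process (N k) (p k) (\<lambda>i \<omega>. \<kappa> * e k i) s \<omega>))\<^sup>2) \<partial>(?L \<Otimes>\<^sub>M M))
        \<le> ennreal ((\<kappa> * (C * (\<bar>a\<bar> * t)))\<^sup>2 * t / real (Suc k))" .
  qed
  have Vprod: "(\<lambda>z. V (fst z) (snd z)) \<in> borel_measurable (?L \<Otimes>\<^sub>M M)"
    using progressive_measurable[OF V_progressive t] by (simp add: case_prod_beta')
  have expL: "(\<lambda>s. exp (a * s)) \<in> borel_measurable ?L"
    by (rule measurable_restrict_space1) simp
  define G where "G \<omega> = (\<integral>s. a * exp (a * s) * V s \<omega> \<partial>?L)" for \<omega>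
  have YG: "Y \<omega> = \<kappa> * exp (a * t) * V t \<omega> - \<kappa> * G \<omega>" for \<omega>
  proof -
    have "indicator {0..t} s *\<^sub>R (a * exp (a * s) * V s \<omega>) = a * exp (a * s) * V s \<omega>" if "s \<in> space ?L" for s
      using that by (simp add: space_restrict_space)
    then have "(LINT s:{0..t}|lborel. a * exp (a * s) * V s \<omega>) = G \<omega>"
      unfolding G_def set_lebesgue_integral_restrict[OF order.refl] by (rule Bochner_Integration.integral_cong[OF refl])
    then show ?thesis by (simp add: Y_def)
  qed
  have "(\<lambda>z. a * exp (a * fst z) * V (fst z) (snd z)) \<in> borel_measurable (?L \<Otimes>\<^sub>M M)"
    using Vprod measurable_compose[OF measurable_fst expL, of M] by measurable
  from measurable_compose[OF measurable_pair_swap' this]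
  have "G \<in> borel_measurable M"
    unfolding G_def[abs_def] by (intro L.borel_measurable_lebesgue_integral) (simp add: case_prod_beta')
  then have YM: "Y \<in> borel_measurable M"
    unfolding YG[abs_def] using V_measurable[OF t] by measurable
  have conv2: "(\<lambda>k. \<integral>\<^sup>+\<omega>. ennreal ((norm (Y \<omega> - simple_integral W (N k) (p k) (\<lambda>i \<omega>. \<kappa> * e k i) \<omega>))\<^sup>2) \<partial>M) \<longlonglongrightarrow> 0"
  proof (rule tendsto_zero_ennreal_bound)
    fix k
    \<comment> \<open>The approximation error will turn out to be the time integral of
      \<open>Z\<close>, in which each \<open>s\<close> is compared with the right end of its grid
      interval. \<open>Z\<close> looks ahead in time, but only its second moments are used, and
      these are of the order of the mesh.\<close>
    define \<phi> where "\<phi> s i \<omega> = \<kappa> * (a * exp (a * s)) * (V (p k (Suc i)) \<omega> - V s \<omega>)" for s i \<omega>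
    define Z where "Z s \<omega> = simple_process (N k) (p k) (\<phi> s) s \<omega>" for s \<omega>
    define B where "B = (\<kappa> * a * C)\<^sup>2"
    have B0: "0 \<le> B" by (simp add: B_def)
    have Zsum: "Z s \<omega> = (\<Sum>i<N k. indicator {p k i<..p k (Suc i)} s * \<phi> s i \<omega>)" for s \<omega>
      by (simp add: Z_def simple_process_def)
    have Zsq: "(Z s \<omega>)\<^sup>2 = (\<Sum>i<N k. indicator {p k i<..p k (Suc i)} s * (\<phi> s i \<omega>)\<^sup>2)" for s \<omega>
      using norm_simple_process_sq[of "N k" "p k" "\<phi> s" s \<omega>] pmono by (simp add: Z_def)
    have \<phi>sq: "square_integrable M (\<phi> s i)" if "s \<in> {0..t}" "i < N k" for s i
      unfolding \<phi>_def[abs_def] using that pt[of "Suc i" k]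
      by (intro square_integrable_mult square_integrable_diff V_moments) auto
    have Zs: "square_integrable M (Z s)" if "s \<in> {0..t}" for s
      unfolding Zsum[abs_def] by (intro square_integrable_sum square_integrable_mult \<phi>sq that) simp
    have EZ: "expectation (\<lambda>\<omega>. (Z s \<omega>)\<^sup>2) \<le> B * t / real (Suc k)" if s: "s \<in> {0..t}" for s
    proof (cases "s = 0")
      case True
      then have "Z s \<omega> = 0" for \<omega>
        unfolding Zsum using pt[of _ k] by (intro sum.neutral) (auto simp: indicator_def not_less)
      then show ?thesis using B0 t by simp
    next
      case False
      have "expectation (\<lambda>\<omega>. (Z s \<omega>)\<^sup>2) = (\<Sum>i<N k. indicator {p k i<..p k (Suc i)} s * expectation (\<lambda>\<omega>. (\<phi> s i \<omega>)\<^sup>2))"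
        unfolding Zsq using \<phi>sq[OF s] by (subst Bochner_Integration.integral_sum) (auto intro: square_integrable_real_sq)
      also have "\<dots> \<le> (\<Sum>i<N k. indicator {p k i<..p k (Suc i)} s * (B * t / real (Suc k)))"
      proof (rule sum_mono)
        fix i assume i: "i \<in> {..<N k}"
        show "indicator {p k i<..p k (Suc i)} s * expectation (\<lambda>\<omega>. (\<phi> s i \<omega>)\<^sup>2)
          \<le> indicator {p k i<..p k (Suc i)} s * (B * t / real (Suc k))"
        proof (cases "s \<in> {p k i<..p k (Suc i)}")
          case True
          have "expectation (\<lambda>\<omega>. (\<phi> s i \<omega>)\<^sup>2) = (\<kappa> * (a * exp (a * s)))\<^sup>2 * expectation (\<lambda>\<omega>. (V (p k (Suc i)) \<omega> - V s \<omega>)\<^sup>2)"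
            by (simp add: \<phi>_def power_mult_distrib)
          also have "\<dots> = (\<kappa> * (a * exp (a * s)))\<^sup>2 * (p k (Suc i) - s)"
            using True s by (subst V_increment) auto
          also have "\<dots> \<le> B * (t / real (Suc k))"
          proof (rule mult_mono)
            have "(\<kappa> * (a * exp (a * s)))\<^sup>2 = (\<kappa> * a)\<^sup>2 * (exp (a * s))\<^sup>2" by (simp add: power_mult_distrib)
            also have "\<dots> \<le> (\<kappa> * a)\<^sup>2 * C\<^sup>2"
              by (intro mult_left_mono power_mono expC s) auto
            finally show "(\<kappa> * (a * exp (a * s)))\<^sup>2 \<le> B" by (simp add: B_def power_mult_distrib)
            show "p k (Suc i) - s \<le> t / real (Suc k)" using True pstep[of k i] by simp
          qed (use True B0 in auto)
          finally show ?thesis using True by simp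
        qed simp
      qed
      also have "\<dots> = B * t / real (Suc k)"
        unfolding sum_distrib_right[symmetric] part[OF s False] by simp
      finally show ?thesis .
    qed
    have Zprod: "(\<lambda>z. Z (fst z) (snd z)) \<in> borel_measurable (?L \<Otimes>\<^sub>M M)"
      unfolding Zsum \<phi>_def
    proof (intro borel_measurable_sum borel_measurable_times borel_measurable_diff borel_measurable_const Vprod)
      fix i assume "i \<in> {..<N k}"
      then show "(\<lambda>z. V (p k (Suc i)) (snd z)) \<in> borel_measurable (?L \<Otimes>\<^sub>M M)"
        using pt[of "Suc i" k] by (intro measurable_compose[OF measurable_snd] V_measurable) auto
      show "(\<lambda>z. indicat_real {p k i<..p k (Suc i)} (fst z)) \<in> borel_measurable (?L \<Otimes>\<^sub>M M)"
        by (rule measurable_compose[OF measurable_fst]) auto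
      show "(\<lambda>z. exp (a * fst z)) \<in> borel_measurable (?L \<Otimes>\<^sub>M M)"
        by (rule measurable_compose[OF measurable_fst expL])
    qed
    have Zprodsq: "square_integrable (?L \<Otimes>\<^sub>M M) (\<lambda>(s, \<omega>). Z s \<omega>)"
    proof (rule product_square_integrableI[OF interval_finite finite_measure_axioms])
      show "expectation (\<lambda>\<omega>. (norm (Z s \<omega>))\<^sup>2) \<le> B * t / real (Suc k)" if "s \<in> space ?L" for s
        using EZ[of s] that by (simp add: space_restrict_space)
    qed (use Zprod Zs in \<open>auto simp: space_restrict_space case_prod_beta'\<close>)
    note I = square_integrable_integral_fst[OF interval_finite finite_measure_axioms Zprodsq]
    have Lmeas: "measure ?L (space ?L) = t"
      using t by (simp add: measure_restrict_space space_restrict_space)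
    have "(\<integral>s. expectation (\<lambda>\<omega>. (norm (Z s \<omega>))\<^sup>2) \<partial>?L) \<le> (\<integral>s. B * t / real (Suc k) \<partial>?L)"
    proof (rule integral_mono')
      show "expectation (\<lambda>\<omega>. (norm (Z s \<omega>))\<^sup>2) \<le> B * t / real (Suc k)" if "s \<in> space ?L" for s
        using EZ[of s] that by (simp add: space_restrict_space)
    qed (use B0 t in auto)
    also have "\<dots> = t * (B * t / real (Suc k))" using Lmeas by simp
    finally have "t * (\<integral>s. expectation (\<lambda>\<omega>. (norm (Z s \<omega>))\<^sup>2) \<partial>?L) \<le> t * (t * (B * t / real (Suc k)))"
      using t by (rule mult_left_mono)
    \<comment> \<open>Three factors \<open>t\<close> meet here: one from Cauchy-Schwarz in time, one
      from the length of the time interval and one from the mesh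
      \<open>t / real (Suc k)\<close>.\<close>
    with I(2) have EI: "expectation (\<lambda>\<omega>. (norm (\<integral>s. Z s \<omega> \<partial>?L))\<^sup>2) \<le> B * t ^ 3 / real (Suc k)"
      unfolding Lmeas by (simp add: power3_eq_cube mult_ac)
    have eq: "AE \<omega> in M. Y \<omega> - simple_integral W (N k) (p k) (\<lambda>i \<omega>. \<kappa> * e k i) \<omega> = (\<integral>s. Z s \<omega> \<partial>?L)"
      using V_eq_W W_0 AE_space
    proof eventually_elim
      fix \<omega> assume VW: "\<forall>t. V t \<omega> = W t \<omega>" and W0: "W 0 \<omega> = 0" and \<omega>: "\<omega> \<in> space M"
      have V0: "V 0 \<omega> = 0" using VW W0 by simp
      have Vc: "continuous_on {0..t} (\<lambda>s. V s \<omega>)"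
        by (rule continuous_on_subset[OF V_continuous[OF \<omega>]]) auto
      have int1: "integrable ?L (\<lambda>s. a * exp (a * s) * V s \<omega>)"
      proof -
        have "set_integrable lborel {0..t} (\<lambda>s. a * exp (a * s) * V s \<omega>)"
          by (rule borel_integrable_atLeastAtMost') (intro continuous_intros Vc)
        then show ?thesis by (subst set_integrable_eq[symmetric]) auto
      qed
      have int2: "integrable ?L (\<lambda>s. indicator {p k i<..p k (Suc i)} s * (a * exp (a * s)))" for i
      proof -
        have "set_integrable lborel {0..t} (\<lambda>s. a * exp (a * s))"
          by (rule borel_integrable_atLeastAtMost') (intro continuous_intros)
        then have "integrable ?L (\<lambda>s. a * exp (a * s))"
          by (subst set_integrable_eq[symmetric]) auto
        then show ?thesis
          by (rule Bochner_Integration.integrable_bound) (use expL in \<open>auto split: split_indicator\<close>)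
      qed
      have "(\<integral>s. Z s \<omega> \<partial>?L) = (\<integral>s. \<kappa> * (\<Sum>i<N k. V (p k (Suc i)) \<omega> * (indicator {p k i<..p k (Suc i)} s * (a * exp (a * s))))
          - \<kappa> * (a * exp (a * s) * V s \<omega>) \<partial>?L)"
      proof (rule integral_cong_AE)
        show "(\<lambda>s. Z s \<omega>) \<in> borel_measurable ?L"
          using measurable_compose[OF measurable_Pair2'[OF \<omega>] Zprod] by simp
        show "AE s in ?L. Z s \<omega> = \<kappa> * (\<Sum>i<N k. V (p k (Suc i)) \<omega> * (indicator {p k i<..p k (Suc i)} s * (a * exp (a * s))))
          - \<kappa> * (a * exp (a * s) * V s \<omega>)"
          using ne0
        proof eventually_elim
          fix s assume s: "s \<in> {0..t} \<and> s \<noteq> 0"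
          have "Z s \<omega> = \<kappa> * (\<Sum>i<N k. V (p k (Suc i)) \<omega> * (indicator {p k i<..p k (Suc i)} s * (a * exp (a * s))))
             - (\<Sum>i<N k. indicator {p k i<..p k (Suc i)} s * (\<kappa> * (a * exp (a * s) * V s \<omega>)))"
            unfolding Zsum \<phi>_def sum_distrib_left sum_subtractf[symmetric]
            by (rule sum.cong) (auto simp: algebra_simps)
          then show "Z s \<omega> = \<kappa> * (\<Sum>i<N k. V (p k (Suc i)) \<omega> * (indicator {p k i<..p k (Suc i)} s * (a * exp (a * s))))
              - \<kappa> * (a * exp (a * s) * V s \<omega>)"
            using part[of s k] s unfolding sum_distrib_right[symmetric] by simp
        qed
      qed (use int1 int2 in \<open>auto intro!: borel_measurable_diff borel_measurable_times borel_measurable_sum\<close>)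
      also have "\<dots> = \<kappa> * (\<Sum>i<N k. V (p k (Suc i)) \<omega> * (e k (Suc i) - e k i)) - \<kappa> * G \<omega>"
      proof -
        have "(\<integral>s. indicator {p k i<..p k (Suc i)} s * (a * exp (a * s)) \<partial>?L) = e k (Suc i) - e k i" if "i < N k" for i
          unfolding e_def by (rule integral_exp_interval) (use pt[of i k] pt[of "Suc i" k] pmono[of i "Suc i" k] that in auto)
        then show ?thesis
          using int1 int2 by (simp add: G_def)
      qed
      also have "\<dots> = Y \<omega> - simple_integral W (N k) (p k) (\<lambda>i \<omega>. \<kappa> * e k i) \<omega>"
      proof -
        \<comment> \<open>Summation by parts: the increments of the exponential and those of the
          path together telescope to the product at the end point, as the product at time 0 is 0 on
          this path.\<close>
        have "(\<Sum>i<N k. V (p k (Suc i)) \<omega> * (e k (Suc i) - e k i)) + (\<Sum>i<N k. (V (p k (Suc i)) \<omega> - V (p k i) \<omega>) * e k i)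
            = (\<Sum>i<N k. e k (Suc i) * V (p k (Suc i)) \<omega> - e k i * V (p k i) \<omega>)"
          unfolding sum.distrib[symmetric] by (rule sum.cong) (auto simp: algebra_simps)
        also have "\<dots> = exp (a * t) * V t \<omega>"
          using sum_lessThan_telescope[of "\<lambda>i. e k i * V (p k i) \<omega>" "N k"] by (simp add: pN p0 V0 e_def)
        finally have "\<kappa> * (\<Sum>i<N k. V (p k (Suc i)) \<omega> * (e k (Suc i) - e k i))
            = \<kappa> * (exp (a * t) * V t \<omega> - (\<Sum>i<N k. (V (p k (Suc i)) \<omega> - V (p k i) \<omega>) * e k i))"
          by (simp add: eq_diff_eq)
        then show ?thesis
          using VW by (simp add: YG simple_integral_def sum_distrib_left right_diff_distrib mult_ac)
      qed
      finally show "Y \<omega> - simple_integral W (N k) (p k) (\<lambda>i \<omega>. \<kappa> * e k i) \<omega> = (\<integral>s. Z s \<omega> \<partial>?L)" by simp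
    qed
    have "(\<integral>\<^sup>+\<omega>. ennreal ((norm (Y \<omega> - simple_integral W (N k) (p k) (\<lambda>i \<omega>. \<kappa> * e k i) \<omega>))\<^sup>2) \<partial>M)
        = (\<integral>\<^sup>+\<omega>. ennreal ((norm (\<integral>s. Z s \<omega> \<partial>?L))\<^sup>2) \<partial>M)"
      by (rule nn_integral_cong_AE) (use eq in auto)
    also have "\<dots> = ennreal (expectation (\<lambda>\<omega>. (norm (\<integral>s. Z s \<omega> \<partial>?L))\<^sup>2))"
      by (rule nn_integral_eq_integral[OF square_integrable_norm_sq[OF I(1)]]) simp
    also have "\<dots> \<le> ennreal (B * t ^ 3 / real (Suc k))" by (rule ennreal_leI[OF EI])
    finally show "(\<integral>\<^sup>+\<omega>. ennreal ((norm (Y \<omega> - simple_integral W (N k) (p k) (\<lambda>i \<omega>. \<kappa> * e k i) \<omega>))\<^sup>2) \<partial>M)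
        \<le> ennreal ((\<kappa> * a * C)\<^sup>2 * t ^ 3 / real (Suc k))" by (simp add: B_def)
  qed
  show ?thesis
    unfolding is_ito_integral_def
    by (intro conjI H YM exI[of _ N] exI[of _ p] exI[of _ "\<lambda>k i \<omega>. \<kappa> * e k i"] allI S conv1 conv2)
qed

section \<open>Exact steering of the scalar equation to a prescribed normal law\<close>

lemma scaled_law:
  fixes \<alpha> s T :: real
  assumes T: "0 < T" and s: "0 \<le> s"
  shows "distr M borel (\<lambda>\<omega>. \<alpha> + s / sqrt T * V T \<omega>)
    = (if s = 0 then return borel \<alpha> else density lborel (normal_density \<alpha> s))"
proof (cases "s = 0")
  case True
  then show ?thesis by (simp add: distr_const)
next
  case False
  then have s: "0 < s" using s by simp
  have [measurable]: "V T \<in> borel_measurable M" "W T \<in> borel_measurable M" "W 0 \<in> borel_measurable M"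
    using T by (auto intro: V_measurable W_measurable)
  have "distributed M lborel (\<lambda>\<omega>. W T \<omega> - W 0 \<omega>) (normal_density 0 (sqrt T))"
    using increment_distributed[of 0 T] T by simp
  from normal_density_affine[OF this, of "s / sqrt T" \<alpha>] T s
  have "distributed M lborel (\<lambda>\<omega>. \<alpha> + s / sqrt T * (W T \<omega> - W 0 \<omega>)) (normal_density \<alpha> s)"
    by simp
  then have "density lborel (normal_density \<alpha> s) = distr M lborel (\<lambda>\<omega>. \<alpha> + s / sqrt T * (W T \<omega> - W 0 \<omega>))"
    by (simp add: distributed_def)
  also have "\<dots> = distr M borel (\<lambda>\<omega>. \<alpha> + s / sqrt T * (W T \<omega> - W 0 \<omega>))"
    by (rule distr_cong) auto
  also have "\<dots> = distr M borel (\<lambda>\<omega>. \<alpha> + s / sqrt T * V T \<omega>)"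
  proof (rule distr_cong_AE)
    show "AE \<omega> in M. \<alpha> + s / sqrt T * (W T \<omega> - W 0 \<omega>) = \<alpha> + s / sqrt T * V T \<omega>"
      using V_eq_W W_0 by eventually_elim simp
  qed auto
  finally show ?thesis using False by simp
qed

text \<open>The control is chosen so that the stochastic convolution collapses to a multiple of the
  Brownian motion; the mean is then steered through the initial value.\<close>

lemma scalar_reachable:
  fixes T a\<^sub>1 a\<^sub>2 b \<delta> \<alpha> \<sigma> :: real
  assumes T: "0 < T" and \<delta>: "\<delta> \<noteq> 0" and \<sigma>: "0 \<le> \<sigma>"
  shows "\<exists>x. (if \<sigma> = 0 then return borel \<alpha> else density lborel (normal_density \<alpha> \<sigma>))
    \<in> reachable_laws M F W T (\<lambda>X m v. a\<^sub>1 * X + a\<^sub>2 * m + b * v) (\<lambda>X m v. \<delta> * v) x"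
proof -
  \<comment> \<open>At time \<open>T\<close> the factor
    \<open>\<kappa> * exp (a\<^sub>1 * T)\<close> becomes \<open>\<sigma> / sqrt T\<close>, and
    \<open>V T\<close> has variance \<open>T\<close>.\<close>
  define \<kappa> where "\<kappa> = \<sigma> / sqrt T * exp (- a\<^sub>1 * T)"
  \<comment> \<open>Dividing by \<open>\<delta>\<close> makes the diffusion equal to
    \<open>\<kappa> * exp (a\<^sub>1 * s)\<close>, which matches the linear drift rate.\<close>
  define v where "v s = \<kappa> / \<delta> * exp (a\<^sub>1 * s)" for s
  \<comment> \<open>The mean obeys a linear equation with rate \<open>a\<^sub>1 + a\<^sub>2\<close>.
    It is solved by variation of constants, with \<open>J\<close> the accumulated forcing.\<close>
  define c where "c = a\<^sub>1 + a\<^sub>2"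
  define J where "J s = integral {0..s} (\<lambda>r. exp (- c * r) * (b * v r))" for s
  \<comment> \<open>The mean equation is solved backwards from the terminal value \<alpha>, which
    compensates for whatever the control does to the mean.\<close>
  define x where "x = exp (- c * T) * \<alpha> - J T"
  define m where "m s = exp (c * s) * (x + J s)" for s
  define u where "u s \<omega> = v s" for s and \<omega> :: 'w
  define X where "X s \<omega> = m s + \<kappa> * exp (a\<^sub>1 * s) * V s \<omega>" for s \<omega>
  have m0: "m 0 = x" by (simp add: m_def J_def)
  have mT: "m T = \<alpha>" by (simp add: m_def x_def right_diff_distrib mult_exp_exp flip: mult.assoc)
  have vc: "continuous_on A v" for A unfolding v_def[abs_def] by (intro continuous_intros)
  have J': "(J has_real_derivative exp (- c * s) * (b * v s)) (at s within {0..T})" if "s \<in> {0..T}" for s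
    unfolding J_def[abs_def]
    by (rule integral_has_real_derivative) (use that in \<open>auto intro!: continuous_intros vc\<close>)
  have m': "(m has_real_derivative c * m s + b * v s) (at s within {0..T})" if "s \<in> {0..T}" for s
  proof -
    have E: "((\<lambda>s. exp (c * s)) has_real_derivative exp (c * s) * c) (at s within {0..T})"
      by (auto intro!: derivative_eq_intros)
    have "(m has_real_derivative exp (c * s) * (0 + exp (- c * s) * (b * v s)) + exp (c * s) * c * (x + J s)) (at s within {0..T})"
      unfolding m_def[abs_def] by (rule DERIV_mult'[OF E DERIV_add[OF DERIV_const J'[OF that]]])
    moreover have "exp (c * s) * (0 + exp (- c * s) * (b * v s)) + exp (c * s) * c * (x + J s) = c * m s + b * v s"
      by (simp add: m_def exp_minus field_simps)
    ultimately show ?thesis by simp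
  qed
  have mc: "continuous_on {0..T} m"
    by (rule DERIV_continuous_on[OF m'])
  have Eu: "expectation (u s) = v s" for s by (simp add: u_def[abs_def] prob_space)
  have EX: "expectation (X s) = m s" if "s \<in> {0..T}" for s
    unfolding X_def[abs_def] using V_moments[of s] square_integrable_integrable[OF V_moments(1), of s] that
    by (simp add: prob_space)
  have X: "X \<in> L2_processes M F T"
  proof -
    have 1: "progressive F T X"
      unfolding progressive_def
    proof
      fix r assume r: "r \<in> {0..T}"
      have A: "(\<lambda>(s, \<omega>). m s) \<in> borel_measurable (restrict_space borel {0..r} \<Otimes>\<^sub>M F r)"
        "(\<lambda>(s, \<omega>). \<kappa> * exp (a\<^sub>1 * s)) \<in> borel_measurable (restrict_space borel {0..r} \<Otimes>\<^sub>M F r)"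
      proof -
        have "continuous_on {0..T} (\<lambda>s. \<kappa> * exp (a\<^sub>1 * s))" by (intro continuous_intros)
        from progressive_deterministic[OF mc] progressive_deterministic[OF this] r
        show "(\<lambda>(s, \<omega>). m s) \<in> borel_measurable (restrict_space borel {0..r} \<Otimes>\<^sub>M F r)"
          "(\<lambda>(s, \<omega>). \<kappa> * exp (a\<^sub>1 * s)) \<in> borel_measurable (restrict_space borel {0..r} \<Otimes>\<^sub>M F r)"
          by (auto simp: progressive_def)
      qed
      have B: "(\<lambda>(s, \<omega>). V s \<omega>) \<in> borel_measurable (restrict_space borel {0..r} \<Otimes>\<^sub>M F r)"
        using V_progressive[of T] r by (auto simp: progressive_def)
      from borel_measurable_add[OF A(1) borel_measurable_times[OF A(2) B]]
      show "(\<lambda>(s, \<omega>). X s \<omega>) \<in> borel_measurable (restrict_space borel {0..r} \<Otimes>\<^sub>M F r)"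
        by (simp add: X_def case_prod_beta')
    qed
    have "continuous_on {0..T} (\<lambda>s. 2 * (m s)\<^sup>2 + 2 * ((\<kappa> * exp (a\<^sub>1 * s))\<^sup>2 * s))"
      by (intro continuous_intros mc)
    then have "compact ((\<lambda>s. 2 * (m s)\<^sup>2 + 2 * ((\<kappa> * exp (a\<^sub>1 * s))\<^sup>2 * s)) ` {0..T})"
      by (rule compact_continuous_image) simp
    then have "bounded ((\<lambda>s. 2 * (m s)\<^sup>2 + 2 * ((\<kappa> * exp (a\<^sub>1 * s))\<^sup>2 * s)) ` {0..T})"
      by (rule compact_imp_bounded)
    then obtain K where *: "\<forall>z\<in>(\<lambda>s. 2 * (m s)\<^sup>2 + 2 * ((\<kappa> * exp (a\<^sub>1 * s))\<^sup>2 * s)) ` {0..T}. norm z \<le> K"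
      unfolding bounded_iff by (rule exE)
    have K: "2 * (m s)\<^sup>2 + 2 * ((\<kappa> * exp (a\<^sub>1 * s))\<^sup>2 * s) \<le> K" if "s \<in> {0..T}" for s
      using bspec[OF * imageI[OF that]] unfolding real_norm_def by linarith
    show ?thesis
    proof (rule L2_processesI[OF 1])
      fix s assume s: "s \<in> {0..T}"
      then have Vs: "square_integrable M (\<lambda>\<omega>. \<kappa> * exp (a\<^sub>1 * s) * V s \<omega>)"
        by (intro square_integrable_mult V_moments) auto
      show "square_integrable M (X s)"
        unfolding X_def[abs_def] by (intro square_integrable_add square_integrable_const Vs)
      have "expectation (\<lambda>\<omega>. (norm (X s \<omega>))\<^sup>2)
          \<le> 2 * expectation (\<lambda>\<omega>. (norm (m s))\<^sup>2) + 2 * expectation (\<lambda>\<omega>. (norm (\<kappa> * exp (a\<^sub>1 * s) * V s \<omega>))\<^sup>2)"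
        unfolding X_def by (rule expectation_norm_sq_add_le[OF square_integrable_const Vs])
      also have "\<dots> = 2 * (m s)\<^sup>2 + 2 * ((\<kappa> * exp (a\<^sub>1 * s))\<^sup>2 * s)"
        using V_moments(3)[of s] s by (simp add: prob_space power_mult_distrib)
      finally show "expectation (\<lambda>\<omega>. (norm (X s \<omega>))\<^sup>2) \<le> K" using K[OF s] by simp
    qed (use T in simp)
  qed
  have "is_solution M F W T (\<lambda>X m v. a\<^sub>1 * X + a\<^sub>2 * m + b * v) (\<lambda>X m v. \<delta> * v) x u X"
    unfolding is_solution_def
  proof (intro conjI ballI X)
    have Xc: "continuous_on {0..T} (\<lambda>s. X s \<omega>)" if "\<omega> \<in> space M" for \<omega>
      unfolding X_def by (intro continuous_intros mc continuous_on_subset[OF V_continuous[OF that]]) auto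
    show "AE \<omega> in M. continuous_on {0..T} (\<lambda>t. X t \<omega>)" using Xc by auto
    fix t assume t: "t \<in> {0..T}"
    then have t0: "0 \<le> t" by simp
    define Y where "Y \<omega> = \<kappa> * exp (a\<^sub>1 * t) * V t \<omega> - \<kappa> * (LINT s:{0..t}|lborel. a\<^sub>1 * exp (a\<^sub>1 * s) * V s \<omega>)" for \<omega>
    have "is_ito_integral M F W t (\<lambda>s \<omega>. \<delta> * expectation (u s)) Y"
      using ito_integral_exp[OF t0, of \<kappa> a\<^sub>1] \<delta> by (simp add: Eu v_def Y_def[abs_def])
    moreover have "AE \<omega> in M. set_integrable lborel {0..t} (\<lambda>s. a\<^sub>1 * X s \<omega> + a\<^sub>2 * expectation (X s) + b * expectation (u s)) \<and>
       X t \<omega> = x + (LINT s:{0..t}|lborel. a\<^sub>1 * X s \<omega> + a\<^sub>2 * expectation (X s) + b * expectation (u s)) + Y \<omega>"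
    proof (rule AE_I2)
      fix \<omega> assume \<omega>: "\<omega> \<in> space M"
      have Vc: "continuous_on {0..t} (\<lambda>s. V s \<omega>)"
        by (rule continuous_on_subset[OF V_continuous[OF \<omega>]]) auto
      have mct: "continuous_on {0..t} m" by (rule continuous_on_subset[OF mc]) (use t in auto)
      \<comment> \<open>The random part of the drift is exactly the integrand subtracted in
        \<open>Y\<close>, so the two cancel and only the Brownian term remains.\<close>
      have drift: "a\<^sub>1 * X s \<omega> + a\<^sub>2 * expectation (X s) + b * expectation (u s)
          = (c * m s + b * v s) + \<kappa> * (a\<^sub>1 * exp (a\<^sub>1 * s) * V s \<omega>)" if "s \<in> {0..t}" for s
        using EX[of s] that t by (simp add: Eu X_def c_def algebra_simps)
      have i1: "set_integrable lborel {0..t} (\<lambda>s. c * m s + b * v s)"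
        by (rule borel_integrable_atLeastAtMost') (intro continuous_intros mct vc)
      have i2: "set_integrable lborel {0..t} (\<lambda>s. \<kappa> * (a\<^sub>1 * exp (a\<^sub>1 * s) * V s \<omega>))"
        by (rule borel_integrable_atLeastAtMost') (intro continuous_intros Vc)
      have "((\<lambda>s. c * m s + b * v s) has_integral m t - m 0) {0..t}"
      proof (rule fundamental_theorem_of_calculus[OF t0])
        fix s assume "s \<in> {0..t}"
        then show "(m has_vector_derivative c * m s + b * v s) (at s within {0..t})"
          using m'[of s] t unfolding has_real_derivative_iff_has_vector_derivative[symmetric]
          by (auto intro: DERIV_subset)
      qed
      then have I1: "(LINT s:{0..t}|lborel. c * m s + b * v s) = m t - x"
        using set_borel_integral_eq_integral(2)[OF i1] by (simp add: integral_unique m0)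
      have eq: "(LINT s:{0..t}|lborel. a\<^sub>1 * X s \<omega> + a\<^sub>2 * expectation (X s) + b * expectation (u s))
          = (LINT s:{0..t}|lborel. (c * m s + b * v s) + \<kappa> * (a\<^sub>1 * exp (a\<^sub>1 * s) * V s \<omega>))"
        by (rule set_lebesgue_integral_cong) (use drift in auto)
      have "set_integrable lborel {0..t} (\<lambda>s. a\<^sub>1 * X s \<omega> + a\<^sub>2 * expectation (X s) + b * expectation (u s))"
        using set_integral_add(1)[OF i1 i2] by (subst set_integrable_cong[OF refl refl drift]) auto
      moreover have "X t \<omega> = x + (LINT s:{0..t}|lborel. a\<^sub>1 * X s \<omega> + a\<^sub>2 * expectation (X s) + b * expectation (u s)) + Y \<omega>"
        unfolding eq set_integral_add(2)[OF i1 i2] I1 by (simp add: X_def Y_def)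
      ultimately show "set_integrable lborel {0..t} (\<lambda>s. a\<^sub>1 * X s \<omega> + a\<^sub>2 * expectation (X s) + b * expectation (u s)) \<and>
        X t \<omega> = x + (LINT s:{0..t}|lborel. a\<^sub>1 * X s \<omega> + a\<^sub>2 * expectation (X s) + b * expectation (u s)) + Y \<omega>" ..
    qed
    ultimately show "\<exists>Y. is_ito_integral M F W t (\<lambda>s \<omega>. \<delta> * expectation (u s)) Y \<and>
      (AE \<omega> in M. set_integrable lborel {0..t} (\<lambda>s. a\<^sub>1 * X s \<omega> + a\<^sub>2 * expectation (X s) + b * expectation (u s)) \<and>
       X t \<omega> = x + (LINT s:{0..t}|lborel. a\<^sub>1 * X s \<omega> + a\<^sub>2 * expectation (X s) + b * expectation (u s)) + Y \<omega>)"
      by blast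
  qed
  moreover have "u \<in> L2_processes M F T"
    unfolding u_def[abs_def] by (rule L2_processes_deterministic[OF vc]) (use T in simp)
  moreover have "X T = (\<lambda>\<omega>. \<alpha> + \<sigma> / sqrt T * V T \<omega>)"
    by (rule ext) (simp add: X_def mT \<kappa>_def mult_exp_exp)
  then have "distr M borel (X T) = (if \<sigma> = 0 then return borel \<alpha> else density lborel (normal_density \<alpha> \<sigma>))"
    using scaled_law[OF T \<sigma>, of \<alpha>] by simp
  ultimately show ?thesis
    unfolding reachable_laws_def by (intro exI[of _ x] CollectI exI[of _ u] exI[of _ X]) simp
qed

lemma ETCNL_scalar_iff:
  fixes T a\<^sub>1 a\<^sub>2 b \<delta> :: real
  assumes T: "0 < T"
  shows "ETCNL M F W T (\<lambda>X m (v :: real). a\<^sub>1 * X + a\<^sub>2 * m + b * v) (\<lambda>X m v. \<delta> * v) \<longleftrightarrow> \<delta> \<noteq> 0"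
proof
  have lin: "linear ((*) a\<^sub>1)" by (simp add: linear_times)
  let ?R = "reachable_laws M F W T (\<lambda>X m (v :: real). a\<^sub>1 * X + a\<^sub>2 * m + b * v) (\<lambda>X m v. \<delta> * v)"
  \<comment> \<open>Regrouping brings the drift into the form of a linear part plus a function of
    the two means, as the general results require.\<close>
  have eq: "(\<lambda>X m (v :: real). a\<^sub>1 * X + a\<^sub>2 * m + b * v) = (\<lambda>X m v. a\<^sub>1 * X + (a\<^sub>2 * m + b * v))"
    by (simp add: add.assoc)
  {
    assume E: "ETCNL M F W T (\<lambda>X m (v :: real). a\<^sub>1 * X + a\<^sub>2 * m + b * v) (\<lambda>X m v. \<delta> * v)"
    show "\<delta> \<noteq> 0"
    proof
      assume "\<delta> = 0"
      \<comment> \<open>The standard normal law has no atoms, whereas a system without diffusion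
        reaches only Dirac masses.\<close>
      let ?\<mu> = "density lborel (normal_density 0 1)"
      have "?\<mu> \<in> (Gauss :: real measure set)" unfolding Gauss_real by force
      then obtain x where "?\<mu> \<in> ?R x" using E unfolding ETCNL_def by blast
      then obtain \<alpha> :: real where \<alpha>: "?\<mu> = return borel \<alpha>"
        using reachable_laws_degenerate[OF T lin, of "\<lambda>m v. \<delta> * v" ?\<mu> "\<lambda>m v. a\<^sub>2 * m + b * v" x] \<open>\<delta> = 0\<close>
        unfolding eq by auto
      have "emeasure ?\<mu> {\<alpha>} = 0"
        by (subst emeasure_density) (auto simp: nn_integral_indicator_singleton intro!: nn_integral_null_set)
      moreover have "emeasure (return borel \<alpha>) {\<alpha>} = 1" by simp
      ultimately show False unfolding \<alpha> by simp
    qed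
  }
  assume \<delta>: "\<delta> \<noteq> 0"
  have "?R x \<subseteq> Gauss" for x
    unfolding eq by (rule reachable_laws_subset_Gauss[OF T lin])
  moreover have "\<exists>x. \<mu> \<in> ?R x" if "\<mu> \<in> Gauss" for \<mu>
  proof -
    from that consider (dirac) \<alpha> where "\<mu> = return borel \<alpha>"
      | (density) \<alpha> s where "0 < s" "\<mu> = density lborel (normal_density \<alpha> s)"
      unfolding Gauss_real by auto
    then show ?thesis
    proof cases
      case dirac
      then show ?thesis using scalar_reachable[OF T \<delta> order.refl, of \<alpha> a\<^sub>1 a\<^sub>2 b] by simp
    next
      case density
      then show ?thesis using scalar_reachable[OF T \<delta>, of s \<alpha> a\<^sub>1 a\<^sub>2 b] by simp
    qed
  qed
  ultimately show "ETCNL M F W T (\<lambda>X m (v :: real). a\<^sub>1 * X + a\<^sub>2 * m + b * v) (\<lambda>X m v. \<delta> * v)"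
    unfolding ETCNL_def by blast
qed

end

theorem theorem5p1:
  fixes T :: real
    and M G :: "'w measure"
    and W :: "real \<Rightarrow> 'w \<Rightarrow> real"
    and A\<^sub>1 A\<^sub>2 C :: "real ^ 'd ^ 'd"
    and B\<^sub>2 D\<^sub>2 :: "real ^ 'n ^ 'd"
    and a\<^sub>1 a\<^sub>2 b \<delta> :: real
    and F :: "real \<Rightarrow> 'w measure"
  assumes "T > 0"
    and "brownian_motion M W"
    and "initial_algebra M W G"
    and "supports_laws M G (wasserstein2_space :: (real ^ 'd) measure set)"
    and "F = augmented_filtration M W G"
  shows "(\<forall>x :: real ^ 'd.
            reachable_laws M F W T
              (\<lambda>X m (v :: real ^ 'n). A\<^sub>1 *v X + A\<^sub>2 *v m + B\<^sub>2 *v v)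
              (\<lambda>X m v. C *v m + D\<^sub>2 *v v) x
            \<subseteq> Gauss)
       \<and> (ETCNL M F W T
              (\<lambda>X m (v :: real). a\<^sub>1 * X + a\<^sub>2 * m + b * v)
              (\<lambda>X m v. \<delta> * v)
            \<longleftrightarrow> \<delta> \<noteq> 0)"
proof -
  interpret prob_space M using assms(2) by (simp add: brownian_motion_def)
  interpret brownian_setup M W G by unfold_locales fact+
  have "reachable_laws M F W T (\<lambda>X m (v :: real ^ 'n). A\<^sub>1 *v X + A\<^sub>2 *v m + B\<^sub>2 *v v)
      (\<lambda>X m v. C *v m + D\<^sub>2 *v v) x \<subseteq> Gauss" for x
    using reachable_laws_subset_Gauss[OF assms(1) matrix_vector_mul_linear,
        of A\<^sub>1 "\<lambda>m v. A\<^sub>2 *v m + B\<^sub>2 *v v" "\<lambda>m v. C *v m + D\<^sub>2 *v v" x]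
    unfolding assms(5) by (simp add: add.assoc)
  then show ?thesis
    unfolding assms(5) using ETCNL_scalar_iff[OF assms(1)] by blast
qed

end
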